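(* For each $N\in\mathbb N$ let $\mathbf c^N:[0,\infty)\to\mathcal P(\mathcal X^N)$ be a solution of the $N$-particle evolution $\dot{\mathbf c}^N(t)=\mathbf c^N(t)\bm Q^N$. Let $\mathbb C(0)\in\mathcal P(\mathcal P(\mathcal X))$ and assume the initial data are well-prepared: $$\frac1N\bm{\mathcal F}^N(\mathbf c^N(0))\to\mathbb F(\mathbb C(0))-\mathcal F_0\quad\text{and}\quad L^N_\#\mathbf c^N(0)\rightharpoonup\mathbb C(0)\quad\text{as }N\to\infty.$$ Then $L^N_\#\mathbf c^N(t)\rightharpoonup\mathbb C(t)$ for all $t\in(0,\infty)$, where $\mathbb C$ is a weak solution of the Liouville equation starting from $\mathbb C(0)$, and moreover $\frac1N\bm{\mathcal F}^N(\mathbf c^N(t))\to\mathbb F(\mathbb C(t))-\mathcal F_0$ for all $t\in(0,\infty)$.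
   Context: Let $\mathcal X=\{1,\dots,d\}$ be finite, $\mathcal P(\mathcal X)\subset\mathbb R^{\mathcal X}$ the probability measures on $\mathcal X$. Let $K:\mathcal P(\mathcal X)\times\mathcal X\to\mathbb R$ with each $K_x$ twice continuously differentiable on a neighbourhood of $\mathcal P(\mathcal X)$; $U(\mu)=\sum_x\mu_xK_x(\mu)$, $H_x=\partial_{\mu_x}U$, $\pi_x(\mu)=e^{-H_x(\mu)}/\sum_ze^{-H_z(\mu)}$. Free energy $\mathcal F(\mu)=\sum_x\mu_x\log\mu_x+U(\mu)$, $\mathcal F_0=\inf_{\mu\in\mathcal P(\mathcal X)}\mathcal F(\mu)$, and for $\mathbb M\in\mathcal P(\mathcal P(\mathcal X))$, $\mathbb F(\mathbb M)=\int\mathcal F\,d\mathbb M$. Particle system: for $\bm x=(x_1,\dots,x_N)\in\mathcal X^N$ let $L^N(\bm x)=\frac1N\sum_i\delta_{x_i}$, $\mathcal P_N(\mathcal X)=L^N(\mathcal X^N)$, and $\bm x^{i;y}$ the configuration with $x_i$ replaced by $y$. Let $\bm\pi^N_{\bm x}=\exp(-NU(L^N\bm x))/\bm Z^N$ with $\bm Z^N$ the normalization. Let $\{A(\mu)\}_{\mu\in\mathcal P(\mathcal X)}$ be irreducible symmetric matrices with nonnegative entries, depending Lipschitz continuously on $\mu$, and $\{A^N(\mu)\}$ irreducible symmetric nonnegative matrices with $A^N_{xy}\to A_{xy}$ uniformly on $\mathcal P(\mathcal X)$ for all $x,y$. For $\mu\in\mathcal P_N(\mathcal X)$ with $\mu_x>0$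 and $y\ne x$ set $Q^N_{xy}(\mu)=\exp\big(-\frac N2(U(\mu+\frac{\delta_y-\delta_x}{N})-U(\mu))\big)A^N_{xy}(\mu)$, and let $\bm Q^N\in\mathbb R^{\mathcal X^N\times\mathcal X^N}$ have off-diagonal entries $\bm Q^N_{\bm x,\bm x^{i;y}}=Q^N_{x_i,y}(L^N\bm x)$ ($y\ne x_i$), all other off-diagonal entries $0$, and rows summing to $0$. Relative entropy: $\bm{\mathcal F}^N(\bm\mu)=\sum_{\bm x}\bm\mu_{\bm x}\log(\bm\mu_{\bm x}/\bm\pi^N_{\bm x})$. $L^N_\#\bm\mu\in\mathcal P(\mathcal P(\mathcal X))$ is the push-forward; $\rightharpoonup$ is weak convergence. Limit rates: $Q_{xy}(\mu)=\sqrt{\pi_y(\mu)/\pi_x(\mu)}\,A_{xy}(\mu)$ for $x\ne y$, $Q_{xx}=-\sum_{y\ne x}Q_{xy}$. Weak solution of the Liouville equation $\partial_t\mathbb C+\mathrm{div}(\mathbb C\,b)=0$, $b_x(\nu)=\sum_y\nu_yQ_{yx}(\nu)$: a weakly continuous curve $t\mapsto\mathbb C(t)\in\mathcal P(\mathcal P(\mathcal X))$ with the given $\mathbb C(0)$ such that $\int\int(\partial_t\varphi(t,\nu)+\langle\nabla\varphi(t,\nu),b(\nu)\rangle)\mathbb C(t,d\nu)dt=0$ for all $\varphi\in C^1_c((0,\infty)\times\mathbb R^{\mathcal X})$. *)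

theory Defs
  imports "HOL-Probability.Probability"
begin

(* The finite state space X is a finite type 'x; R^X is real^'x. *)

definition PX :: "(real^'x::finite) set" where
  "PX = {\<mu>. (\<forall>x. 0 \<le> \<mu>$x) \<and> (\<Sum>x\<in>UNIV. \<mu>$x) = 1}"

(* twice continuously (Frechet) differentiable on an open set S *)
definition C2_on :: "(real^'x::finite) set \<Rightarrow> (real^'x \<Rightarrow> real) \<Rightarrow> bool" where
  "C2_on S f \<longleftrightarrow> (\<exists>(f' :: real^'x \<Rightarrow> ((real^'x) \<Rightarrow>\<^sub>L real))
       (f'' :: real^'x \<Rightarrow> ((real^'x) \<Rightarrow>\<^sub>L ((real^'x) \<Rightarrow>\<^sub>L real))).
       (\<forall>\<nu>\<in>S. (f has_derivative blinfun_apply (f' \<nu>)) (at \<nu>)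
              \<and> (f' has_derivative blinfun_apply (f'' \<nu>)) (at \<nu>))
       \<and> continuous_on S f'')"

(* U(mu) = sum_x mu_x K_x(mu) *)
definition UU :: "('x::finite \<Rightarrow> real^'x \<Rightarrow> real) \<Rightarrow> real^'x \<Rightarrow> real" where
  "UU K \<mu> = (\<Sum>x\<in>UNIV. \<mu>$x * K x \<mu>)"

(* H_x = partial derivative of U in direction mu_x *)
definition HH :: "('x::finite \<Rightarrow> real^'x \<Rightarrow> real) \<Rightarrow> 'x \<Rightarrow> real^'x \<Rightarrow> real" where
  "HH K x \<mu> = frechet_derivative (UU K) (at \<mu>) (axis x 1)"

definition piK :: "('x::finite \<Rightarrow> real^'x \<Rightarrow> real) \<Rightarrow> 'x \<Rightarrow> real^'x \<Rightarrow> real" where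
  "piK K x \<mu> = exp (- HH K x \<mu>) / (\<Sum>z\<in>UNIV. exp (- HH K z \<mu>))"

(* free energy; note 0 * ln 0 = 0 in Isabelle *)
definition FE :: "('x::finite \<Rightarrow> real^'x \<Rightarrow> real) \<Rightarrow> real^'x \<Rightarrow> real" where
  "FE K \<mu> = (\<Sum>x\<in>UNIV. \<mu>$x * ln (\<mu>$x)) + UU K \<mu>"

definition FE0 :: "('x::finite \<Rightarrow> real^'x \<Rightarrow> real) \<Rightarrow> real" where
  "FE0 K = (INF \<mu>\<in>(PX :: (real^'x) set). FE K \<mu>)"

(* probability measures on P(X): Borel probability measures on R^X concentrated on the PX *)
definition prob_on_simplex :: "(real^'x::finite) measure \<Rightarrow> bool" where
  "prob_on_simplex M \<longleftrightarrow> prob_space M \<and> sets M = sets borel \<and> emeasure M PX = 1"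

(* F(M) = integral of the free energy *)
definition FFbig :: "('x::finite \<Rightarrow> real^'x \<Rightarrow> real) \<Rightarrow> (real^'x) measure \<Rightarrow> real" where
  "FFbig K M = (LINT \<nu>:PX|M. FE K \<nu>)"

(* weak convergence of probability measures along a filter *)
definition weak_conv_along :: "'a filter \<Rightarrow> ('a \<Rightarrow> (real^'x::finite) measure) \<Rightarrow> (real^'x) measure \<Rightarrow> bool" where
  "weak_conv_along F Ms M \<longleftrightarrow>
     (\<forall>f :: real^'x \<Rightarrow> real. continuous_on UNIV f \<and> bounded (range f) \<longrightarrow>
        ((\<lambda>n. integral\<^sup>L (Ms n) f) \<longlongrightarrow> integral\<^sup>L M f) F)"

(* irreducible nonnegative matrix: the graph of positive entries is strongly connected *)
definition irreducible_mat :: "('x \<Rightarrow> 'x \<Rightarrow> real) \<Rightarrow> bool" where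
  "irreducible_mat A \<longleftrightarrow> (\<forall>x y. (x, y) \<in> {(a, b). 0 < A a b}\<^sup>*)"

definition good_mat :: "('x \<Rightarrow> 'x \<Rightarrow> real) \<Rightarrow> bool" where
  "good_mat A \<longleftrightarrow> irreducible_mat A \<and> (\<forall>x y. A x y = A y x) \<and> (\<forall>x y. 0 \<le> A x y)"

(* ---------- N-particle system ---------- *)

definition configs :: "nat \<Rightarrow> (nat \<Rightarrow> 'x::finite) set" where
  "configs N = PiE {..<N} (\<lambda>_. UNIV)"

definition LN :: "nat \<Rightarrow> (nat \<Rightarrow> 'x::finite) \<Rightarrow> real^'x" where
  "LN N c = (\<chi> y. real (card {i\<in>{..<N}. c i = y}) / real N)"

(* Q^N_{xy}(mu) *)
definition QsN :: "('x::finite \<Rightarrow> real^'x \<Rightarrow> real) \<Rightarrow> (nat \<Rightarrow> real^'x \<Rightarrow> 'x \<Rightarrow> 'x \<Rightarrow> real)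
                   \<Rightarrow> nat \<Rightarrow> 'x \<Rightarrow> 'x \<Rightarrow> real^'x \<Rightarrow> real" where
  "QsN K AN N x y \<mu> =
     exp (- (real N / 2) * (UU K (\<mu> + (1 / real N) *\<^sub>R (axis y 1 - axis x 1)) - UU K \<mu>)) * AN N \<mu> x y"

(* off-diagonal entries of the generator bold Q^N *)
definition QBoff :: "('x::finite \<Rightarrow> real^'x \<Rightarrow> real) \<Rightarrow> (nat \<Rightarrow> real^'x \<Rightarrow> 'x \<Rightarrow> 'x \<Rightarrow> real)
                   \<Rightarrow> nat \<Rightarrow> (nat \<Rightarrow> 'x) \<Rightarrow> (nat \<Rightarrow> 'x) \<Rightarrow> real" where
  "QBoff K AN N cx cy =
     (\<Sum>i<N. if cy i \<noteq> cx i \<and> cy = cx(i := cy i) then QsN K AN N (cx i) (cy i) (LN N cx) else 0)"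

definition QB :: "('x::finite \<Rightarrow> real^'x \<Rightarrow> real) \<Rightarrow> (nat \<Rightarrow> real^'x \<Rightarrow> 'x \<Rightarrow> 'x \<Rightarrow> real)
                   \<Rightarrow> nat \<Rightarrow> (nat \<Rightarrow> 'x) \<Rightarrow> (nat \<Rightarrow> 'x) \<Rightarrow> real" where
  "QB K AN N cx cy =
     (if cx = cy then - (\<Sum>cz\<in>configs N - {cx}. QBoff K AN N cx cz) else QBoff K AN N cx cy)"

definition ZN :: "('x::finite \<Rightarrow> real^'x \<Rightarrow> real) \<Rightarrow> nat \<Rightarrow> real" where
  "ZN K N = (\<Sum>c\<in>configs N. exp (- real N * UU K (LN N c)))"

definition piN :: "('x::finite \<Rightarrow> real^'x \<Rightarrow> real) \<Rightarrow> nat \<Rightarrow> (nat \<Rightarrow> 'x) \<Rightarrow> real" where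
  "piN K N c = exp (- real N * UU K (LN N c)) / ZN K N"

(* relative entropy w.r.t. bold pi^N; 0 * ln 0 = 0 *)
definition FN :: "('x::finite \<Rightarrow> real^'x \<Rightarrow> real) \<Rightarrow> nat \<Rightarrow> ((nat \<Rightarrow> 'x) \<Rightarrow> real) \<Rightarrow> real" where
  "FN K N m = (\<Sum>c\<in>configs N. m c * ln (m c / piN K N c))"

definition is_prob_configs :: "nat \<Rightarrow> ((nat \<Rightarrow> 'x::finite) \<Rightarrow> real) \<Rightarrow> bool" where
  "is_prob_configs N m \<longleftrightarrow> (\<forall>c\<in>configs N. 0 \<le> m c) \<and> (\<Sum>c\<in>configs N. m c) = 1"

(* push-forward L^N_# m *)
definition pushLN :: "nat \<Rightarrow> ((nat \<Rightarrow> 'x::finite) \<Rightarrow> real) \<Rightarrow> (real^'x) measure" where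
  "pushLN N m = distr (point_measure (configs N) (\<lambda>c. ennreal (m c))) borel (LN N)"

(* ---------- limit dynamics ---------- *)

definition Qlim :: "('x::finite \<Rightarrow> real^'x \<Rightarrow> real) \<Rightarrow> (real^'x \<Rightarrow> 'x \<Rightarrow> 'x \<Rightarrow> real)
                    \<Rightarrow> 'x \<Rightarrow> 'x \<Rightarrow> real^'x \<Rightarrow> real" where
  "Qlim K A x y \<mu> =
     (if x = y then - (\<Sum>z\<in>UNIV - {x}. sqrt (piK K z \<mu> / piK K x \<mu>) * A \<mu> x z)
      else sqrt (piK K y \<mu> / piK K x \<mu>) * A \<mu> x y)"

definition bfield :: "('x::finite \<Rightarrow> real^'x \<Rightarrow> real) \<Rightarrow> (real^'x \<Rightarrow> 'x \<Rightarrow> 'x \<Rightarrow> real)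
                    \<Rightarrow> real^'x \<Rightarrow> real^'x" where
  "bfield K A \<nu> = (\<chi> x. \<Sum>y\<in>UNIV. \<nu>$y * Qlim K A y x \<nu>)"

(* C^1_c((0,oo) x R^X), extended by zero *)
definition test_fun :: "(real \<times> (real^'x::finite) \<Rightarrow> real) \<Rightarrow> bool" where
  "test_fun \<phi> \<longleftrightarrow>
     (\<exists>\<phi>' :: real \<times> (real^'x) \<Rightarrow> ((real \<times> (real^'x)) \<Rightarrow>\<^sub>L real).
        (\<forall>p. (\<phi> has_derivative blinfun_apply (\<phi>' p)) (at p)) \<and> continuous_on UNIV \<phi>')
     \<and> (\<exists>Kc. compact Kc \<and> Kc \<subseteq> {0<..} \<times> UNIV \<and> (\<forall>p. p \<notin> Kc \<longrightarrow> \<phi> p = 0))"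

definition liouville_weak_sol :: "('x::finite \<Rightarrow> real^'x \<Rightarrow> real) \<Rightarrow> (real^'x \<Rightarrow> 'x \<Rightarrow> 'x \<Rightarrow> real)
        \<Rightarrow> (real \<Rightarrow> (real^'x) measure) \<Rightarrow> (real^'x) measure \<Rightarrow> bool" where
  "liouville_weak_sol K A C C0 \<longleftrightarrow>
     C 0 = C0
     \<and> (\<forall>t\<ge>0. prob_on_simplex (C t))
     \<and> (\<forall>s\<ge>0. weak_conv_along (at s within {0..}) C (C s))
     \<and> (\<forall>\<phi>. test_fun \<phi> \<longrightarrow>
          (LBINT t:{0<..}. (LINT \<nu>:PX|C t.
              frechet_derivative \<phi> (at (t, \<nu>)) (1, 0)
            + frechet_derivative \<phi> (at (t, \<nu>)) (0, bfield K A \<nu>))) = 0)"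

end

theory Submission
  imports Defs "HOL-Combinatorics.Multiset_Permutations" "HOL-Real_Asymp.Real_Asymp"
begin

text \<open>
  The limit curve is the push-forward of \<open>C0\<close> under the flow of the vector field \<open>b\<close>. Applying the
  generator to the squared distance between the empirical measure and the flow line started at the
  initial empirical measure, Gronwall's inequality shows that this distance vanishes in mean square,
  which gives the weak convergence.

  Detailed balance is not available, because \<open>AN\<close> is evaluated before the jump only. The entropy is
  controlled by exchangeability instead. By counting types, \<open>\<Sum> m ln m\<close> is up to \<open>O(ln N)\<close> at least \<open>- N\<close>
  times the mean Shannon entropy of the empirical measure, with equality up to \<open>O(ln N)\<close> if \<open>m\<close> is a
  function of the empirical measure. Well-preparedness says that initially the excess is \<open>o(N)\<close>. The
  excess is, up to \<open>O(ln N)\<close>, the relative entropy of the law with respect to its average over types; since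
  the evolution commutes with this averaging, the data processing inequality keeps the excess \<open>o(N)\<close>
  at all later times.
\<close>

subsection \<open>Finite Markov semigroups\<close>

text \<open>Since \<open>C0\<close> need not be a point mass, the empirical measure at time t has no
  deterministic limit; it is compared with the flow line issued from its own random initial value.
  This needs the joint law of the configurations at times 0 and t, hence transition probabilities
  and not only the solution of the forward equation. The square is a good test function because a
  jump moves the empirical measure by O(1/N) at total rate O(N): the first-order term reproduces the
  drift, the second-order term is O(1/N).

  The entropy argument splits \<open>FN / N\<close> into the sum of m ln m divided by N, the mean of
  \<open>UU\<close>, and \<open>ln ZN / N\<close>. The second part converges by weak convergence,
  the third tends to \<open>- FE0\<close> by Laplace asymptotics over the polynomially many types.
  Well-preparedness is thus a statement about the first part: its limit is the least value that the
  type counts permit. Averaging over types commutes with the evolution because the rates distinguish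
  sites only by their values and see the other particles only through the empirical measure.\<close>

locale finite_generator =
  fixes S :: "'a set" and Q :: "'a \<Rightarrow> 'a \<Rightarrow> real"
  assumes finite_S: "finite S"
    and off_diag_nonneg: "\<And>x y. x \<in> S \<Longrightarrow> y \<in> S \<Longrightarrow> x \<noteq> y \<Longrightarrow> 0 \<le> Q x y"
    and row_sum: "\<And>x. x \<in> S \<Longrightarrow> (\<Sum>y\<in>S. Q x y) = 0"
begin

text \<open>\<open>lam\<close> dominates every exit rate, which makes the diagonal of
  \<open>R\<close> nonnegative; the summand 1 keeps it positive when the diagonal of
  \<open>Q\<close> vanishes.\<close>

definition lam :: real where
  "lam = 1 + (\<Sum>x\<in>S. \<bar>Q x x\<bar>)"

definition R :: "'a \<Rightarrow> 'a \<Rightarrow> real" where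
  "R x y = (if x = y then 1 else 0) + Q x y / lam"

primrec Rpow :: "nat \<Rightarrow> 'a \<Rightarrow> 'a \<Rightarrow> real" where
  "Rpow 0 x y = (if x = y then 1 else 0)"
| "Rpow (Suc n) x y = (\<Sum>z\<in>S. R x z * Rpow n z y)"

definition jump_series :: "real \<Rightarrow> 'a \<Rightarrow> 'a \<Rightarrow> real" where
  "jump_series t x y = (\<Sum>n. Rpow n x y * lam ^ n / fact n * t ^ n)"

definition trans_prob :: "real \<Rightarrow> 'a \<Rightarrow> 'a \<Rightarrow> real" where
  "trans_prob t x y = exp (- lam * t) * jump_series t x y"

text \<open>Uniformisation: \<open>trans_prob t\<close> is the matrix exponential of \<open>t Q\<close>, written as a power series in the
  stochastic matrix \<open>R = 1 + Q / lam\<close>, so that nonnegativity is visible term by term.\<close>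

lemma lam_pos: "0 < lam"
  unfolding lam_def by (smt (verit) abs_ge_zero sum_nonneg)

lemma R_nonneg:
  assumes "x \<in> S" "y \<in> S"
  shows "0 \<le> R x y"
proof (cases "x = y")
  case True
  have "\<bar>Q x x\<bar> \<le> (\<Sum>x\<in>S. \<bar>Q x x\<bar>)"
    using finite_S assms by (intro member_le_sum) auto
  then have "- Q x x \<le> lam" unfolding lam_def by linarith
  then have "- Q x x / lam \<le> 1" using lam_pos by (simp add: field_simps)
  then show ?thesis using True by (simp add: R_def)
next
  case False
  then show ?thesis using off_diag_nonneg[OF assms] lam_pos by (simp add: R_def)
qed

lemma R_row_sum: "x \<in> S \<Longrightarrow> (\<Sum>y\<in>S. R x y) = 1"
  unfolding R_def using finite_S row_sum
  by (simp add: sum.distrib sum_divide_distrib[symmetric])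

lemma lam_R: "lam * R x y = (if x = y then lam else 0) + Q x y"
  using lam_pos by (simp add: R_def distrib_left)

text \<open>The recursion of \<open>Rpow\<close> splits off the first step; the forward equation
  needs the last one.\<close>

lemma Rpow_Suc_right:
  assumes "x \<in> S" "y \<in> S"
  shows "Rpow (Suc n) x y = (\<Sum>z\<in>S. Rpow n x z * R z y)"
  using assms
proof (induction n arbitrary: x)
  case 0
  have "(\<Sum>z\<in>S. R x z * (if z = y then 1 else 0)) = (\<Sum>z\<in>S. if z = y then R x z else 0)"
    by (intro sum.cong) auto
  moreover have "(\<Sum>z\<in>S. (if x = z then 1 else 0) * R z y) = (\<Sum>z\<in>S. if x = z then R z y else 0)"
    by (intro sum.cong) auto
  ultimately show ?case using 0 finite_S by simp
next
  case (Suc n)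
  have "Rpow (Suc (Suc n)) x y = (\<Sum>w\<in>S. R x w * (\<Sum>z\<in>S. Rpow n w z * R z y))"
    unfolding Rpow.simps(2)[of "Suc n" x y] using Suc by (intro sum.cong) auto
  also have "\<dots> = (\<Sum>w\<in>S. \<Sum>z\<in>S. R x w * Rpow n w z * R z y)"
    by (simp add: sum_distrib_left mult.assoc)
  also have "\<dots> = (\<Sum>z\<in>S. \<Sum>w\<in>S. R x w * Rpow n w z * R z y)"
    by (rule sum.swap)
  also have "\<dots> = (\<Sum>z\<in>S. Rpow (Suc n) x z * R z y)"
    by (simp add: sum_distrib_right)
  finally show ?case .
qed

lemma Rpow_nonneg: "x \<in> S \<Longrightarrow> y \<in> S \<Longrightarrow> 0 \<le> Rpow n x y"
  by (induction n arbitrary: x) (auto intro!: sum_nonneg mult_nonneg_nonneg R_nonneg)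

lemma Rpow_row_sum: "x \<in> S \<Longrightarrow> (\<Sum>y\<in>S. Rpow n x y) = 1"
proof (induction n arbitrary: x)
  case 0
  then show ?case using finite_S by simp
next
  case (Suc n)
  have "(\<Sum>y\<in>S. Rpow (Suc n) x y) = (\<Sum>z\<in>S. \<Sum>y\<in>S. R x z * Rpow n z y)"
    by (simp, rule sum.swap)
  also have "\<dots> = (\<Sum>z\<in>S. R x z)"
    using Suc by (simp add: sum_distrib_left[symmetric])
  finally show ?case using R_row_sum Suc by simp
qed

lemma Rpow_le_1:
  assumes "x \<in> S" "y \<in> S"
  shows "Rpow n x y \<le> 1"
proof -
  have "Rpow n x y \<le> (\<Sum>y\<in>S. Rpow n x y)"
    using finite_S assms by (intro member_le_sum) (auto intro: Rpow_nonneg)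
  then show ?thesis using Rpow_row_sum assms by simp
qed

text \<open>The entries of powers of a stochastic matrix lie in [0,1], so the exponential series is
  a majorant.\<close>

lemma jump_series_summable:
  assumes "x \<in> S" "y \<in> S"
  shows "summable (\<lambda>n. Rpow n x y * lam ^ n / fact n * t ^ n)"
proof (rule summable_comparison_test')
  show "summable (\<lambda>n. \<bar>lam * t\<bar> ^ n / fact n)"
    using summable_exp[of "\<bar>lam * t\<bar>"] by (simp add: field_simps)
next
  fix n
  have "\<bar>Rpow n x y\<bar> \<le> 1" using Rpow_nonneg[OF assms] Rpow_le_1[OF assms] by (simp add: abs_le_iff)
  then have "\<bar>Rpow n x y\<bar> * (\<bar>lam * t\<bar> ^ n / fact n) \<le> 1 * (\<bar>lam * t\<bar> ^ n / fact n)"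
    by (intro mult_right_mono) auto
  moreover have "norm (Rpow n x y * lam ^ n / fact n * t ^ n) = \<bar>Rpow n x y\<bar> * (\<bar>lam * t\<bar> ^ n / fact n)"
    by (simp add: abs_mult power_mult_distrib power_abs)
  ultimately show "norm (Rpow n x y * lam ^ n / fact n * t ^ n) \<le> \<bar>lam * t\<bar> ^ n / fact n"
    by simp
qed

text \<open>Termwise differentiation raises the power of \<open>R\<close> by one. The backward and
  forward equations differ only in the side on which this new factor is split off.\<close>

lemma jump_series_deriv_raw:
  assumes "x \<in> S" "y \<in> S"
  shows "((\<lambda>t. jump_series t x y) has_real_derivative
           (\<Sum>n. lam * (Rpow (Suc n) x y * lam ^ n / fact n * t ^ n))) (at t)"
proof -
  have "((\<lambda>t. jump_series t x y) has_real_derivative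
      (\<Sum>n. diffs (\<lambda>n. Rpow n x y * lam ^ n / fact n) n * t ^ n)) (at t)"
    unfolding jump_series_def
    by (rule termdiffs_strong_converges_everywhere) (rule jump_series_summable[OF assms])
  moreover have "diffs (\<lambda>n. Rpow n x y * lam ^ n / fact n) n * t ^ n
      = lam * (Rpow (Suc n) x y * lam ^ n / fact n * t ^ n)" for n
    unfolding diffs_def by (simp add: field_simps del: Rpow.simps of_nat_Suc)
  ultimately show "((\<lambda>t. jump_series t x y) has_real_derivative
           (\<Sum>n. lam * (Rpow (Suc n) x y * lam ^ n / fact n * t ^ n))) (at t)" by simp
qed

text \<open>The index maps \<open>p\<close> and \<open>q\<close> let one interchange of sum and
  series serve sums over the row index as well as over the column index.\<close>

lemma suminf_weighted_jump_series:
  assumes "\<And>z. z \<in> S \<Longrightarrow> p z \<in> S \<and> q z \<in> S"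
  shows "(\<Sum>n. (\<Sum>z\<in>S. w z * Rpow n (p z) (q z)) * lam ^ n / fact n * t ^ n)
      = (\<Sum>z\<in>S. w z * jump_series t (p z) (q z))"
proof -
  have s: "summable (\<lambda>n. w z * (Rpow n (p z) (q z) * lam ^ n / fact n * t ^ n))" if "z \<in> S" for z
    using assms[OF that] by (intro summable_mult jump_series_summable) auto
  have "(\<Sum>n. (\<Sum>z\<in>S. w z * Rpow n (p z) (q z)) * lam ^ n / fact n * t ^ n)
      = (\<Sum>n. (\<Sum>z\<in>S. w z * (Rpow n (p z) (q z) * lam ^ n / fact n * t ^ n)))"
    by (intro suminf_cong) (simp add: sum_distrib_right sum_divide_distrib mult.assoc)
  also have "\<dots> = (\<Sum>z\<in>S. \<Sum>n. w z * (Rpow n (p z) (q z) * lam ^ n / fact n * t ^ n))"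
    by (rule suminf_sum) (rule s)
  also have "\<dots> = (\<Sum>z\<in>S. w z * jump_series t (p z) (q z))"
    unfolding jump_series_def using assms
    by (intro sum.cong refl suminf_mult jump_series_summable) auto
  finally show ?thesis .
qed

lemma jump_series_deriv_backward:
  assumes "x \<in> S" "y \<in> S"
  shows "((\<lambda>t. jump_series t x y) has_real_derivative
           lam * (\<Sum>z\<in>S. R x z * jump_series t z y)) (at t)"
proof -
  have "summable (\<lambda>n. Rpow (Suc n) x y * lam ^ n / fact n * t ^ n)"
  proof -
    have "summable (\<lambda>n. \<Sum>z\<in>S. R x z * (Rpow n z y * lam ^ n / fact n * t ^ n))"
      using assms by (intro summable_sum summable_mult jump_series_summable) auto
    then show ?thesis by (simp add: sum_distrib_right sum_divide_distrib mult.assoc)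
  qed
  then have "(\<Sum>n. lam * (Rpow (Suc n) x y * lam ^ n / fact n * t ^ n))
     = lam * (\<Sum>n. (Rpow (Suc n) x y * lam ^ n / fact n * t ^ n))"
    by (rule suminf_mult)
  also have "\<dots> = lam * (\<Sum>z\<in>S. R x z * jump_series t z y)"
    using suminf_weighted_jump_series[of "\<lambda>z. z" "\<lambda>z. y" "R x" t] assms by simp
  finally show ?thesis using jump_series_deriv_raw[OF assms, of t] by simp
qed

lemma jump_series_deriv_forward:
  assumes "x \<in> S" "y \<in> S"
  shows "((\<lambda>t. jump_series t x y) has_real_derivative
           lam * (\<Sum>z\<in>S. jump_series t x z * R z y)) (at t)"
proof -
  have "(\<Sum>z\<in>S. R x z * jump_series t z y)
     = (\<Sum>n. Rpow (Suc n) x y * lam ^ n / fact n * t ^ n)"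
    using suminf_weighted_jump_series[of "\<lambda>z. z" "\<lambda>z. y" "R x" t] assms by simp
  also have "\<dots> = (\<Sum>n. (\<Sum>z\<in>S. R z y * Rpow n x z) * lam ^ n / fact n * t ^ n)"
    unfolding Rpow_Suc_right[OF assms] by (simp add: mult.commute)
  also have "\<dots> = (\<Sum>z\<in>S. R z y * jump_series t x z)"
    using suminf_weighted_jump_series[of "\<lambda>z. x" "\<lambda>z. z" "\<lambda>z. R z y" t] assms by simp
  finally show ?thesis using jump_series_deriv_backward[OF assms, of t] by (simp add: mult.commute)
qed

text \<open>The derivative of the prefactor \<open>exp (- lam * t)\<close> cancels the identity part
  of \<open>lam * R\<close>, so that only \<open>Q\<close> remains.\<close>

lemma trans_prob_deriv_forward:
  assumes "x \<in> S" "y \<in> S"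
  shows "((\<lambda>t. trans_prob t x y) has_real_derivative
           (\<Sum>z\<in>S. trans_prob t x z * Q z y)) (at t)"
proof -
  have "(\<Sum>z\<in>S. jump_series t x z * (lam * R z y))
      = (\<Sum>z\<in>S. (if z = y then lam * jump_series t x z else 0) + jump_series t x z * Q z y)"
    unfolding lam_R by (intro sum.cong) (auto simp: algebra_simps)
  then have e: "lam * (\<Sum>z\<in>S. jump_series t x z * R z y)
      = lam * jump_series t x y + (\<Sum>z\<in>S. jump_series t x z * Q z y)"
    using finite_S assms by (simp add: sum.distrib sum_distrib_left mult.left_commute)
  have "((\<lambda>t. exp (- lam * t) * jump_series t x y) has_real_derivative
     (exp (- lam * t) * - lam) * jump_series t x y
       + (lam * (\<Sum>z\<in>S. jump_series t x z * R z y)) * exp (- lam * t)) (at t)"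
    by (rule derivative_eq_intros jump_series_deriv_forward[OF assms] refl | simp)+
  then show ?thesis unfolding e trans_prob_def
    by (simp add: algebra_simps sum_distrib_left)
qed

lemma trans_prob_deriv_backward:
  assumes "x \<in> S" "y \<in> S"
  shows "((\<lambda>t. trans_prob t x y) has_real_derivative
           (\<Sum>z\<in>S. Q x z * trans_prob t z y)) (at t)"
proof -
  have "(\<Sum>z\<in>S. (lam * R x z) * jump_series t z y)
      = (\<Sum>z\<in>S. (if x = z then lam * jump_series t z y else 0) + Q x z * jump_series t z y)"
    unfolding lam_R by (intro sum.cong) (auto simp: algebra_simps)
  then have e: "lam * (\<Sum>z\<in>S. R x z * jump_series t z y)
      = lam * jump_series t x y + (\<Sum>z\<in>S. Q x z * jump_series t z y)"
    using finite_S assms by (simp add: sum.distrib sum_distrib_left mult.assoc)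
  have "((\<lambda>t. exp (- lam * t) * jump_series t x y) has_real_derivative
     (exp (- lam * t) * - lam) * jump_series t x y
       + (lam * (\<Sum>z\<in>S. R x z * jump_series t z y)) * exp (- lam * t)) (at t)"
    by (rule derivative_eq_intros jump_series_deriv_backward[OF assms] refl | simp)+
  then show ?thesis unfolding e trans_prob_def
    by (simp add: algebra_simps sum_distrib_left)
qed

lemma trans_prob_0: "trans_prob 0 x y = (if x = y then 1 else 0)"
proof -
  have "jump_series 0 x y = (\<Sum>n. if n = 0 then Rpow 0 x y else 0)"
    unfolding jump_series_def by (intro suminf_cong) auto
  also have "\<dots> = Rpow 0 x y"
    using suminf_finite[of "{0::nat}" "\<lambda>n. if n = 0 then Rpow 0 x y else 0"] by simp
  finally show ?thesis unfolding trans_prob_def by simp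
qed

lemma trans_prob_nonneg: "x \<in> S \<Longrightarrow> y \<in> S \<Longrightarrow> 0 \<le> t \<Longrightarrow> 0 \<le> trans_prob t x y"
  unfolding trans_prob_def jump_series_def using lam_pos
  by (intro mult_nonneg_nonneg suminf_nonneg jump_series_summable)
     (auto intro!: mult_nonneg_nonneg divide_nonneg_nonneg Rpow_nonneg)

lemma trans_prob_row_sum:
  assumes "x \<in> S"
  shows "(\<Sum>y\<in>S. trans_prob t x y) = 1"
proof -
  have "(\<Sum>y\<in>S. jump_series t x y) = (\<Sum>n. (\<Sum>y\<in>S. Rpow n x y) * lam ^ n / fact n * t ^ n)"
    using suminf_weighted_jump_series[of "\<lambda>_. x" "\<lambda>z. z" "\<lambda>_. 1" t] assms by simp
  also have "\<dots> = exp (lam * t)"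
    using assms by (simp add: Rpow_row_sum exp_def power_mult_distrib field_simps)
  finally show ?thesis unfolding trans_prob_def
    by (simp add: sum_distrib_left[symmetric] exp_add[symmetric])
qed

text \<open>Uniqueness by duality: \<open>g\<close> pairs the solution at time s with the remaining
  evolution over t - s. The equation of \<open>u\<close> and the backward equation of
  \<open>trans_prob\<close> cancel, so \<open>g\<close> is constant; its values at s = t and s = 0
  are the two sides.\<close>

lemma solution_eq_trans_prob:
  assumes ode: "\<And>t y. 0 \<le> t \<Longrightarrow> y \<in> S \<Longrightarrow>
      ((\<lambda>s. u s y) has_real_derivative (\<Sum>x\<in>S. u t x * Q x y)) (at t within {0..})"
    and "0 \<le> t" "y \<in> S"
  shows "u t y = (\<Sum>x\<in>S. u 0 x * trans_prob t x y)"
proof -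
  define g where "g s = (\<Sum>z\<in>S. u s z * trans_prob (t - s) z y)" for s
  have "(g has_real_derivative 0) (at s within {0..t})" if s: "s \<in> {0..t}" for s
  proof -
    have P: "((\<lambda>s. trans_prob (t - s) z y) has_real_derivative
         - (\<Sum>w\<in>S. Q z w * trans_prob (t - s) w y)) (at s within {0..t})" if "z \<in> S" for z
      by (rule DERIV_cong[OF DERIV_chain2[where f = "\<lambda>r. trans_prob r z y" and g = "\<lambda>s. t - s",
              OF trans_prob_deriv_backward[OF that \<open>y \<in> S\<close>]]])
        (auto intro!: derivative_eq_intros)
    have U: "((\<lambda>s. u s z) has_real_derivative (\<Sum>x\<in>S. u s x * Q x z)) (at s within {0..t})"
      if "z \<in> S" for z
      using ode[of s z] that s by (intro has_field_derivative_subset[OF ode]) auto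
    have "(g has_real_derivative (\<Sum>z\<in>S. (\<Sum>x\<in>S. u s x * Q x z) * trans_prob (t - s) z y
         + - (\<Sum>w\<in>S. Q z w * trans_prob (t - s) w y) * u s z)) (at s within {0..t})"
      unfolding g_def by (intro DERIV_sum DERIV_mult P U)
    moreover have "(\<Sum>z\<in>S. (\<Sum>x\<in>S. u s x * Q x z) * trans_prob (t - s) z y)
       = (\<Sum>z\<in>S. (\<Sum>w\<in>S. Q z w * trans_prob (t - s) w y) * u s z)"
      by (simp add: sum_distrib_right, subst sum.swap) (simp add: ac_simps)
    ultimately show ?thesis by (simp add: sum_subtractf)
  qed
  then have "\<exists>k. \<forall>s\<in>{0..t}. g s = k"
    by (intro has_field_derivative_zero_constant) auto
  then have "g t = g 0" using \<open>0 \<le> t\<close> by fastforce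
  moreover have "g t = (\<Sum>z\<in>S. if z = y then u t z else 0)"
    unfolding g_def by (intro sum.cong) (auto simp: trans_prob_0)
  ultimately show ?thesis using finite_S \<open>y \<in> S\<close> unfolding g_def by simp
qed

text \<open>Measures constant on the level sets of \<open>T\<close> form a linear space. If
  \<open>Q\<close> preserves it, so do \<open>R\<close>, its powers and the exponential series;
  \<open>step\<close> is therefore a condition on the generator alone.\<close>

lemma left_mult_invariant:
  assumes step: "\<And>v :: 'a \<Rightarrow> real. \<lbrakk>\<And>x y. x \<in> S \<Longrightarrow> y \<in> S \<Longrightarrow> T x = T y \<Longrightarrow> v x = v y\<rbrakk> \<Longrightarrow>
      (\<And>x y. x \<in> S \<Longrightarrow> y \<in> S \<Longrightarrow> T x = T y \<Longrightarrow> (\<Sum>z\<in>S. v z * Q z x) = (\<Sum>z\<in>S. v z * Q z y))"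
    and v: "\<And>x y. x \<in> S \<Longrightarrow> y \<in> S \<Longrightarrow> T x = T y \<Longrightarrow> v x = v y"
    and xy: "x \<in> S" "y \<in> S" "T x = T y"
  shows "(\<Sum>z\<in>S. v z * trans_prob t z x) = (\<Sum>z\<in>S. v z * trans_prob t z y)"
proof -
  have R: "(\<Sum>z\<in>S. v z * R z x) = v x + (\<Sum>z\<in>S. v z * Q z x) / lam" if "x \<in> S" for v :: "'a \<Rightarrow> real" and x
  proof -
    have "(\<Sum>z\<in>S. v z * R z x) = (\<Sum>z\<in>S. (if z = x then v z else 0) + v z * Q z x / lam)"
      unfolding R_def by (intro sum.cong) (auto simp: algebra_simps)
    then show ?thesis using finite_S that by (simp add: sum.distrib sum_divide_distrib)
  qed
  have Rp: "(\<Sum>z\<in>S. v z * Rpow n z x) = (\<Sum>z\<in>S. v z * Rpow n z y)"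
    if "x \<in> S" "y \<in> S" "T x = T y" for n x y
    using that
  proof (induction n arbitrary: x y)
    case 0
    have "(\<Sum>z\<in>S. v z * Rpow 0 z x) = (\<Sum>z\<in>S. if z = x then v z else 0)" for x
      by (intro sum.cong) auto
    then show ?case using finite_S 0 v[OF 0] by simp
  next
    case (Suc n)
    define w where "w x = (\<Sum>z\<in>S. v z * Rpow n z x)" for x
    have e: "(\<Sum>z\<in>S. v z * Rpow (Suc n) z x) = (\<Sum>u\<in>S. w u * R u x)" if "x \<in> S" for x
    proof -
      have "(\<Sum>z\<in>S. v z * Rpow (Suc n) z x) = (\<Sum>z\<in>S. v z * (\<Sum>u\<in>S. Rpow n z u * R u x))"
        using that by (intro sum.cong) (auto simp: Rpow_Suc_right simp del: Rpow.simps)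
      also have "\<dots> = (\<Sum>u\<in>S. \<Sum>z\<in>S. v z * Rpow n z u * R u x)"
        by (simp add: sum_distrib_left mult.assoc, rule sum.swap)
      finally show ?thesis unfolding w_def by (simp add: sum_distrib_right)
    qed
    have w: "w x = w y" if "x \<in> S" "y \<in> S" "T x = T y" for x y
      unfolding w_def using Suc.IH that by blast
    show ?case unfolding e[OF Suc.prems(1)] e[OF Suc.prems(2)] R[OF Suc.prems(1)] R[OF Suc.prems(2)]
      using w[OF Suc.prems] step[OF w Suc.prems] by simp
  qed
  have "(\<Sum>z\<in>S. v z * jump_series t z x) = (\<Sum>z\<in>S. v z * jump_series t z y)"
    using suminf_weighted_jump_series[of "\<lambda>z. z" "\<lambda>_. x" v t]
      suminf_weighted_jump_series[of "\<lambda>z. z" "\<lambda>_. y" v t] xy Rp[OF xy] by simp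
  then show ?thesis unfolding trans_prob_def
    by (simp add: mult.left_commute[of _ "exp (- (lam * t))"] sum_distrib_left[symmetric])
qed

text \<open>The same for observables, on which the matrix acts from the other side. Measures are
  needed for an averaged law to stay averaged, observables for it to keep the law of types of the
  original.\<close>

lemma right_mult_invariant:
  assumes step: "\<And>v :: 'a \<Rightarrow> real. \<lbrakk>\<And>x y. x \<in> S \<Longrightarrow> y \<in> S \<Longrightarrow> T x = T y \<Longrightarrow> v x = v y\<rbrakk> \<Longrightarrow>
      (\<And>x y. x \<in> S \<Longrightarrow> y \<in> S \<Longrightarrow> T x = T y \<Longrightarrow> (\<Sum>z\<in>S. Q x z * v z) = (\<Sum>z\<in>S. Q y z * v z))"
    and v: "\<And>x y. x \<in> S \<Longrightarrow> y \<in> S \<Longrightarrow> T x = T y \<Longrightarrow> v x = v y"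
    and xy: "x \<in> S" "y \<in> S" "T x = T y"
  shows "(\<Sum>z\<in>S. v z * trans_prob t x z) = (\<Sum>z\<in>S. v z * trans_prob t y z)"
proof -
  have R: "(\<Sum>z\<in>S. R x z * v z) = v x + (\<Sum>z\<in>S. Q x z * v z) / lam" if "x \<in> S" for v :: "'a \<Rightarrow> real" and x
  proof -
    have "(\<Sum>z\<in>S. R x z * v z) = (\<Sum>z\<in>S. (if x = z then v z else 0) + Q x z * v z / lam)"
      unfolding R_def by (intro sum.cong) (auto simp: algebra_simps)
    then show ?thesis using finite_S that by (simp add: sum.distrib sum_divide_distrib)
  qed
  have Rp: "(\<Sum>z\<in>S. v z * Rpow n x z) = (\<Sum>z\<in>S. v z * Rpow n y z)"
    if "x \<in> S" "y \<in> S" "T x = T y" for n x y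
    using that
  proof (induction n arbitrary: x y)
    case 0
    have "(\<Sum>z\<in>S. v z * Rpow 0 x z) = (\<Sum>z\<in>S. if x = z then v z else 0)" for x
      by (intro sum.cong) auto
    then show ?case using finite_S 0 v[OF 0] by simp
  next
    case (Suc n)
    define w where "w x = (\<Sum>z\<in>S. v z * Rpow n x z)" for x
    have e: "(\<Sum>z\<in>S. v z * Rpow (Suc n) x z) = (\<Sum>u\<in>S. R x u * w u)" for x
    proof -
      have "(\<Sum>z\<in>S. v z * Rpow (Suc n) x z) = (\<Sum>u\<in>S. \<Sum>z\<in>S. R x u * (v z * Rpow n u z))"
        by (simp add: sum_distrib_left mult.left_commute, rule sum.swap)
      then show ?thesis unfolding w_def by (simp add: sum_distrib_left)
    qed
    have w: "w x = w y" if "x \<in> S" "y \<in> S" "T x = T y" for x y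
      unfolding w_def using Suc.IH that by blast
    show ?case unfolding e R[OF Suc.prems(1)] R[OF Suc.prems(2)]
      using w[OF Suc.prems] step[OF w Suc.prems] by simp
  qed
  have "(\<Sum>z\<in>S. v z * jump_series t x z) = (\<Sum>z\<in>S. v z * jump_series t y z)"
    using suminf_weighted_jump_series[of "\<lambda>_. x" "\<lambda>z. z" v t]
      suminf_weighted_jump_series[of "\<lambda>_. y" "\<lambda>z. z" v t] xy Rp[OF xy] by simp
  then show ?thesis unfolding trans_prob_def
    by (simp add: mult.left_commute[of _ "exp (- (lam * t))"] sum_distrib_left[symmetric])
qed

end

subsection \<open>Relative entropy on finite sets\<close>

text \<open>This is ln r \<le> r - 1 at r = w k / u, the variational form of relative entropy: for
  positive u and w equality holds at k = u / w, but k may be chosen independently of a summation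
  index. The zero cases fit the conventions x / 0 = 0 and ln 0 = 0.\<close>

lemma log_sum_term:
  fixes u w k :: real
  assumes "0 \<le> u" "0 \<le> w" "0 \<le> k" "w = 0 \<Longrightarrow> u = 0" "k = 0 \<Longrightarrow> u = 0"
  shows "u * ln k + u - w * k \<le> u * ln (u / w)"
proof (cases "u = 0")
  case False
  then have pos: "0 < u" "0 < w" "0 < k" using assms by force+
  then have "ln (w * k / u) \<le> w * k / u - 1" by (intro ln_le_minus_one) simp
  then have "u * ln (w * k / u) \<le> u * (w * k / u - 1)" using pos by (intro mult_left_mono) auto
  also have "\<dots> = w * k - u" using pos by (simp add: field_simps)
  finally show ?thesis using pos by (simp add: ln_mult ln_div algebra_simps)
qed (use assms in auto)

lemma relative_entropy_nonneg:
  fixes a b :: "'a \<Rightarrow> real"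
  assumes "finite S" "\<And>x. x \<in> S \<Longrightarrow> 0 \<le> a x" "\<And>x. x \<in> S \<Longrightarrow> 0 \<le> b x"
    "\<And>x. x \<in> S \<Longrightarrow> b x = 0 \<Longrightarrow> a x = 0" "sum b S \<le> sum a S"
  shows "0 \<le> (\<Sum>x\<in>S. a x * ln (a x / b x))"
proof -
  \<comment> \<open>The slope k = 1 leaves a linear part that sums to
    \<open>sum a S - sum b S\<close>, which is nonnegative.\<close>
  have "(\<Sum>x\<in>S. a x * ln 1 + a x - b x * 1) \<le> (\<Sum>x\<in>S. a x * ln (a x / b x))"
    using assms by (intro sum_mono log_sum_term) auto
  then show ?thesis using assms(5) by (simp add: sum_subtractf)
qed

text \<open>For each target y all sources x get the same slope k = A / B, the density of the image
  measures at y. The weighted sum of the lower bounds is then exactly the y-term of the image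
  entropy, and the sum over y removes \<open>W\<close> on the other side.\<close>

lemma relative_entropy_data_processing:
  fixes a b :: "'a \<Rightarrow> real" and W :: "'a \<Rightarrow> 'b \<Rightarrow> real"
  assumes fin: "finite S" "finite S'"
    and a: "\<And>x. x \<in> S \<Longrightarrow> 0 \<le> a x" and b: "\<And>x. x \<in> S \<Longrightarrow> 0 \<le> b x"
    and ac: "\<And>x. x \<in> S \<Longrightarrow> b x = 0 \<Longrightarrow> a x = 0"
    and W: "\<And>x y. x \<in> S \<Longrightarrow> y \<in> S' \<Longrightarrow> 0 \<le> W x y"
    and W1: "\<And>x. x \<in> S \<Longrightarrow> (\<Sum>y\<in>S'. W x y) = 1"
  shows "(\<Sum>y\<in>S'. (\<Sum>x\<in>S. a x * W x y) * ln ((\<Sum>x\<in>S. a x * W x y) / (\<Sum>x\<in>S. b x * W x y)))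
    \<le> (\<Sum>x\<in>S. a x * ln (a x / b x))"
proof -
  have "(\<Sum>x\<in>S. a x * W x y) * ln ((\<Sum>x\<in>S. a x * W x y) / (\<Sum>x\<in>S. b x * W x y))
     \<le> (\<Sum>x\<in>S. a x * ln (a x / b x) * W x y)" if y: "y \<in> S'" for y
  proof -
    define A where "A = (\<Sum>x\<in>S. a x * W x y)"
    define B where "B = (\<Sum>x\<in>S. b x * W x y)"
    have nn: "0 \<le> A" "0 \<le> B" unfolding A_def B_def using a b W y by (auto intro!: sum_nonneg)
    have BA: "A = 0" if "B = 0"
    proof -
      have "b x * W x y = 0" if "x \<in> S" for x
        using \<open>B = 0\<close> that unfolding B_def
        by (subst (asm) sum_nonneg_eq_0_iff) (use fin b W y in auto)
      then have "a x * W x y = 0" if "x \<in> S" for x using ac that by fastforce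
      then show ?thesis unfolding A_def by (intro sum.neutral ballI)
    qed
    have A0: "a x * W x y = 0" if "A = 0" "x \<in> S" for x
      using that unfolding A_def
      by (subst (asm) sum_nonneg_eq_0_iff) (use fin a W y in auto)
    have "(a x * ln (A / B) + a x - b x * (A / B)) * W x y \<le> a x * ln (a x / b x) * W x y"
      if x: "x \<in> S" for x
    proof (cases "W x y = 0")
      case False
      have "A / B = 0 \<Longrightarrow> a x = 0" using A0[OF _ x] BA False by auto
      then show ?thesis
        using a b ac nn x W[OF x y] by (intro mult_right_mono log_sum_term) auto
    qed simp
    then have "(\<Sum>x\<in>S. (a x * ln (A / B) + a x - b x * (A / B)) * W x y)
        \<le> (\<Sum>x\<in>S. a x * ln (a x / b x) * W x y)"
      by (intro sum_mono)
    moreover have "(\<Sum>x\<in>S. (a x * ln (A / B) + a x - b x * (A / B)) * W x y)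
       = A * ln (A / B) + A - B * (A / B)"
    proof -
      have "(\<Sum>x\<in>S. (a x * ln k + a x - b x * k) * W x y) = A * ln k + A - B * k" for k
        unfolding A_def B_def
        by (simp add: algebra_simps sum.distrib sum_subtractf sum_distrib_left)
      then show ?thesis .
    qed
    \<comment> \<open>\<open>A - B * (A / B)\<close> vanishes for B = 0 too, because then A =
      0.\<close>
    ultimately show ?thesis using BA unfolding A_def[symmetric] B_def[symmetric]
      by (cases "B = 0") auto
  qed
  then have "(\<Sum>y\<in>S'. (\<Sum>x\<in>S. a x * W x y) * ln ((\<Sum>x\<in>S. a x * W x y) / (\<Sum>x\<in>S. b x * W x y)))
     \<le> (\<Sum>y\<in>S'. \<Sum>x\<in>S. a x * ln (a x / b x) * W x y)"
    by (rule sum_mono)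
  also have "\<dots> = (\<Sum>x\<in>S. \<Sum>y\<in>S'. a x * ln (a x / b x) * W x y)" by (rule sum.swap)
  also have "\<dots> = (\<Sum>x\<in>S. a x * ln (a x / b x))"
    using W1 by (simp add: sum_distrib_left[symmetric])
  finally show ?thesis .
qed

subsection \<open>Flows of globally Lipschitz vector fields\<close>

text \<open>Integrating factor applied to \<open>g + b / a\<close>. The rate \<open>a\<close> may be
  negative, which is how the invariance of the simplex uses it; \<open>0 \<le> b / a\<close> allows
  the shift to be dropped at the end.\<close>

lemma gronwall_differential:
  fixes g g' :: "real \<Rightarrow> real"
  assumes deriv: "\<And>t. 0 \<le> t \<Longrightarrow> (g has_real_derivative g' t) (at t within {0..})"
    and bound: "\<And>t. 0 \<le> t \<Longrightarrow> g' t \<le> a * g t + b"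
    and "a \<noteq> 0" "0 \<le> b / a" "0 \<le> t"
  shows "g t \<le> (g 0 + b / a) * exp (a * t)"
proof -
  define k where "k s = (g s + b / a) * exp (- a * s)" for s
  have kd: "(k has_real_derivative (g' s - a * g s - b) * exp (- a * s)) (at s within {0..})"
    if "0 \<le> s" for s
    unfolding k_def
    apply (rule derivative_eq_intros deriv[OF that] refl)+
    using \<open>a \<noteq> 0\<close> by (simp add: field_simps)
  have "k 0 \<ge> k t"
  proof (rule DERIV_nonpos_imp_decreasing_open[OF \<open>0 \<le> t\<close>])
    fix s assume s: "0 < s" "s < t"
    have "at s within {0..} = at s" using s by (intro at_within_interior) simp
    then have "DERIV k s :> (g' s - a * g s - b) * exp (- a * s)" using kd[of s] s by simp
    moreover have "(g' s - a * g s - b) * exp (- a * s) \<le> 0"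
      using bound[of s] s by (intro mult_nonpos_nonneg) auto
    ultimately show "\<exists>y. DERIV k s :> y \<and> y \<le> 0" by blast
  next
    show "continuous_on {0..t} k"
      by (rule continuous_on_subset[of "{0..}"]) (auto intro!: DERIV_continuous_on kd)
  qed
  then have "(g t + b / a) * exp (- a * t) \<le> g 0 + b / a" by (simp add: k_def)
  then have "g t + b / a \<le> (g 0 + b / a) * exp (a * t)"
    by (simp add: exp_minus pos_divide_le_eq[symmetric] divide_inverse[symmetric])
  then show ?thesis using \<open>0 \<le> b / a\<close> by simp
qed

lemma has_real_derivative_norm_square:
  fixes u :: "real \<Rightarrow> 'a::real_inner"
  assumes "(u has_vector_derivative u') (at t within S)"
  shows "((\<lambda>t. (norm (u t))\<^sup>2) has_real_derivative 2 * (u t \<bullet> u')) (at t within S)"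
proof -
  have "((\<lambda>t. u t \<bullet> u t) has_derivative (\<lambda>h. u t \<bullet> (h *\<^sub>R u') + (h *\<^sub>R u') \<bullet> u t)) (at t within S)"
    using assms unfolding has_vector_derivative_def by (intro has_derivative_inner)
  then show ?thesis unfolding has_field_derivative_def power2_norm_eq_inner
    by (rule has_derivative_eq_rhs) (auto simp: inner_commute fun_eq_iff)
qed

primrec picard :: "('a::euclidean_space \<Rightarrow> 'a) \<Rightarrow> 'a \<Rightarrow> nat \<Rightarrow> real \<Rightarrow> 'a" where
  "picard F x 0 = (\<lambda>t. x)"
| "picard F x (Suc k) = (\<lambda>t. x + integral {0..t} (\<lambda>s. F (picard F x k s)))"

lemma continuous_on_picard:
  assumes "continuous_on UNIV F"
  shows "continuous_on {0..T} (picard F x k)"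
proof (induction k)
  case (Suc k)
  have "continuous_on {0..T} (\<lambda>s. F (picard F x k s))"
    by (rule continuous_on_compose2[OF assms Suc]) auto
  then show ?case
    by (auto intro!: continuous_intros indefinite_integral_continuous_1 integrable_continuous_real)
qed simp

text \<open>The factorial makes the increments summable on every bounded time interval, so solutions
  exist globally without gluing local ones.\<close>

lemma picard_step_bound:
  fixes F :: "'a::euclidean_space \<Rightarrow> 'a"
  assumes L: "L-lipschitz_on UNIV F" and "0 \<le> t"
  shows "norm (picard F x (Suc k) t - picard F x k t) \<le> norm (F x) * L ^ k * t ^ Suc k / fact (Suc k)"
  using \<open>0 \<le> t\<close>
proof (induction k arbitrary: t)
  case 0
  then show ?case by simp
next
  case (Suc k)
  have cF: "continuous_on UNIV F" using L by (rule lipschitz_on_continuous_on)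
  have c: "continuous_on {0..t} (\<lambda>s. F (picard F x j s))" for j
    by (rule continuous_on_compose2[OF cF continuous_on_picard[OF cF]]) auto
  define G where "G s = norm (F x) * L ^ Suc k * s ^ Suc (Suc k) / fact (Suc (Suc k))" for s
  have hi: "((\<lambda>s. norm (F x) * L ^ Suc k * s ^ Suc k / fact (Suc k)) has_integral (G t - G 0)) {0..t}"
  proof (rule fundamental_theorem_of_calculus[OF Suc.prems])
    fix s assume "s \<in> {0..t}"
    have "(G has_real_derivative
       norm (F x) * L ^ Suc k * (real (Suc (Suc k)) * s ^ Suc k) / fact (Suc (Suc k))) (at s within {0..t})"
      unfolding G_def
      by (rule DERIV_cdivide DERIV_cmult DERIV_cong[OF DERIV_power[OF DERIV_ident]] | simp)+
    moreover have "norm (F x) * L ^ Suc k * (real (Suc (Suc k)) * s ^ Suc k) / fact (Suc (Suc k))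
        = norm (F x) * L ^ Suc k * s ^ Suc k / fact (Suc k)"
      unfolding fact_Suc[of "Suc k"] by (simp del: fact_Suc of_nat_Suc)
    ultimately show "(G has_vector_derivative norm (F x) * L ^ Suc k * s ^ Suc k / fact (Suc k)) (at s within {0..t})"
      by (simp only: has_real_derivative_iff_has_vector_derivative)
  qed
  have "picard F x (Suc (Suc k)) t - picard F x (Suc k) t
     = integral {0..t} (\<lambda>s. F (picard F x (Suc k) s)) - integral {0..t} (\<lambda>s. F (picard F x k s))"
    by (subst (1 2) picard.simps(2)) simp
  also have "\<dots> = integral {0..t} (\<lambda>s. F (picard F x (Suc k) s) - F (picard F x k s))"
    by (intro Henstock_Kurzweil_Integration.integral_diff[symmetric] integrable_continuous_real c)
  also have "norm \<dots> \<le> integral {0..t} (\<lambda>s. norm (F x) * L ^ Suc k * s ^ Suc k / fact (Suc k))"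
  proof (rule integral_norm_bound_integral)
    show "(\<lambda>s. F (picard F x (Suc k) s) - F (picard F x k s)) integrable_on {0..t}"
      by (intro integrable_continuous_real continuous_intros c)
    show "(\<lambda>s. norm (F x) * L ^ Suc k * s ^ Suc k / fact (Suc k)) integrable_on {0..t}"
      using hi by blast
    fix s assume s: "s \<in> {0..t}"
    have "norm (F (picard F x (Suc k) s) - F (picard F x k s)) \<le> L * norm (picard F x (Suc k) s - picard F x k s)"
      by (rule lipschitz_on_normD[OF L]) auto
    also have "\<dots> \<le> L * (norm (F x) * L ^ k * s ^ Suc k / fact (Suc k))"
      using s lipschitz_on_nonneg[OF L] by (intro mult_left_mono Suc.IH) auto
    finally show "norm (F (picard F x (Suc k) s) - F (picard F x k s))
      \<le> norm (F x) * L ^ Suc k * s ^ Suc k / fact (Suc k)" by (simp add: ac_simps)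
  qed
  also have "\<dots> = G t"
    using integral_unique[OF hi] unfolding G_def by simp
  finally show ?case unfolding G_def .
qed

lemma lipschitz_ode_solution_exists:
  fixes F :: "'a::euclidean_space \<Rightarrow> 'a"
  assumes L: "L-lipschitz_on UNIV F"
  shows "\<exists>y. y 0 = x \<and> (\<forall>t\<ge>0. (y has_vector_derivative F (y t)) (at t within {0..}))"
proof -
  have L0: "0 \<le> L" using L by (rule lipschitz_on_nonneg)
  have cF: "continuous_on UNIV F" using L by (rule lipschitz_on_continuous_on)
  define y where "y t = x + (\<Sum>i. picard F x (Suc i) t - picard F x i t)" for t
  have ul: "uniform_limit {0..T} (picard F x) y sequentially" if "0 \<le> T" for T
  proof -
    \<comment> \<open>The bound of \<open>picard_step_bound\<close> with \<open>fact (Suc n)\<close>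
      weakened to \<open>fact n\<close>, so that \<open>M\<close> is a multiple of the exponential
      series at \<open>L * T\<close>.\<close>
    define M where "M i = norm (F x) * T * ((L * T) ^ i / fact i)" for i
    have "uniform_limit {0..T} (\<lambda>n t. \<Sum>i<n. picard F x (Suc i) t - picard F x i t)
        (\<lambda>t. \<Sum>i. picard F x (Suc i) t - picard F x i t) sequentially"
    proof (rule Weierstrass_m_test_ev)
      show "summable M"
        unfolding M_def using summable_exp[of "L * T"]
        by (intro summable_mult) (simp add: field_simps)
      show "\<forall>\<^sub>F n in sequentially. \<forall>t\<in>{0..T}. norm (picard F x (Suc n) t - picard F x n t) \<le> M n"
      proof (intro always_eventually allI ballI)
        fix n t assume t: "t \<in> {0..T}"
        have "norm (picard F x (Suc n) t - picard F x n t) \<le> norm (F x) * L ^ n * t ^ Suc n / fact (Suc n)"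
          using t by (intro picard_step_bound[OF L]) auto
        also have "\<dots> \<le> norm (F x) * L ^ n * T ^ Suc n / fact n"
          using t L0 by (intro frac_le mult_left_mono power_mono fact_mono) auto
        finally show "norm (picard F x (Suc n) t - picard F x n t) \<le> M n"
          unfolding M_def by (simp add: power_mult_distrib ac_simps)
      qed
    qed
    then have "uniform_limit {0..T} (\<lambda>n t. x + (picard F x n t - picard F x 0 t)) y sequentially"
      unfolding y_def sum_lessThan_telescope[where f = "\<lambda>i. picard F x i t" for t]
      by (intro uniform_limit_add[OF uniform_limit_const])
    then show ?thesis by simp
  qed
  have cy: "continuous_on {0..T} y" if "0 \<le> T" for T
    using ul[OF that] by (rule uniform_limit_theorem[rotated]) (auto intro!: always_eventually continuous_on_picard[OF cF])
  have fix_eq: "y t = x + integral {0..t} (\<lambda>s. F (y s))" if t: "0 \<le> t" for t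
  proof -
    have "uniform_limit {0..t} (\<lambda>n s. F (picard F x n s)) (\<lambda>s. F (y s)) sequentially"
      by (rule uniform_limit_compose_uniformly_continuous_on[OF ul[OF t] lipschitz_on_uniformly_continuous[OF L]]) auto
    then obtain I J where I: "\<And>n. ((\<lambda>s. F (picard F x n s)) has_integral I n) {0..t}"
      and J: "((\<lambda>s. F (y s)) has_integral J) {0..t}" and IJ: "I \<longlonglongrightarrow> J"
      by (rule uniform_limit_integral)
        (auto intro!: continuous_on_compose2[OF cF continuous_on_picard[OF cF]])
    have "(\<lambda>n. x + I n) \<longlonglongrightarrow> x + J" by (intro tendsto_intros IJ)
    then have "(\<lambda>n. picard F x (Suc n) t) \<longlonglongrightarrow> x + J"
      by (simp add: integral_unique[OF I])
    moreover have "(\<lambda>n. picard F x (Suc n) t) \<longlonglongrightarrow> y t"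
      by (rule LIMSEQ_Suc[OF tendsto_uniform_limitI[OF ul[OF t]]]) (use t in simp)
    ultimately have "y t = x + J"
      by (intro LIMSEQ_unique)
    then show ?thesis using J by (simp add: integral_unique)
  qed
  have "(y has_vector_derivative F (y t)) (at t within {0..})" if t: "0 \<le> t" for t
  proof -
    have c: "continuous_on {0..t + 1} (\<lambda>s. F (y s))"
      using t by (intro continuous_on_compose2[OF cF cy]) auto
    have "((\<lambda>u. x + integral {0..u} (\<lambda>s. F (y s))) has_vector_derivative 0 + F (y t)) (at t within {0..t + 1})"
      using t by (intro has_vector_derivative_add has_vector_derivative_const integral_has_vector_derivative c) auto
    then have "(y has_vector_derivative F (y t)) (at t within {0..t + 1})"
      using t by (rule_tac has_vector_derivative_transform) (auto simp: fix_eq[symmetric])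
    moreover have "at t within {0..t + 1} = at t within {0..}"
      using t by (intro at_within_nhd[of _ "{..< t + 1}"]) auto
    ultimately show ?thesis by simp
  qed
  moreover have "y 0 = x" using fix_eq[of 0] by simp
  ultimately show ?thesis by blast
qed

text \<open>Dependence on the initial value is a Gronwall estimate for the squared distance of two
  solutions. Joint continuity later provides measurability on the product of time and space and the
  weak continuity of the limit curve.\<close>

lemma lipschitz_flow_exists:
  fixes F :: "'a::euclidean_space \<Rightarrow> 'a"
  assumes L: "L-lipschitz_on UNIV F"
  shows "\<exists>\<Phi> :: real \<Rightarrow> 'a \<Rightarrow> 'a. (\<forall>x. \<Phi> 0 x = x)
    \<and> (\<forall>x. \<forall>t\<ge>0. ((\<lambda>t. \<Phi> t x) has_vector_derivative F (\<Phi> t x)) (at t within {0..}))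
    \<and> continuous_on ({0..} \<times> UNIV) (\<lambda>(t, x). \<Phi> t x)"
proof -
  obtain Y where Y0: "\<And>x. Y x 0 = x"
    and Y: "\<And>x t. 0 \<le> t \<Longrightarrow> (Y x has_vector_derivative F (Y x t)) (at t within {0..})"
    using lipschitz_ode_solution_exists[OF L] by metis
  \<comment> \<open>2 L is the growth rate of the squared distance; the extra 1 excludes the
    forbidden value 0 when L = 0.\<close>
  define a where "a = 2 * L + 1"
  have L0: "0 \<le> L" using L by (rule lipschitz_on_nonneg)
  have lip: "norm (Y x t - Y z t) \<le> exp (a * t / 2) * norm (x - z)" if "0 \<le> t" for x z t
  proof -
    define g where "g t = (norm (Y x t - Y z t))\<^sup>2" for t
    have "g t \<le> (g 0 + 0 / a) * exp (a * t)"
    proof (rule gronwall_differential[OF _ _ _ _ that])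
      fix s :: real assume s: "0 \<le> s"
      show "(g has_real_derivative 2 * ((Y x s - Y z s) \<bullet> (F (Y x s) - F (Y z s)))) (at s within {0..})"
        unfolding g_def by (intro has_real_derivative_norm_square has_vector_derivative_diff Y s)
      have "(Y x s - Y z s) \<bullet> (F (Y x s) - F (Y z s)) \<le> norm (Y x s - Y z s) * norm (F (Y x s) - F (Y z s))"
        by (rule norm_cauchy_schwarz)
      also have "\<dots> \<le> norm (Y x s - Y z s) * (L * norm (Y x s - Y z s))"
        by (intro mult_left_mono lipschitz_on_normD[OF L]) auto
      also have "\<dots> = L * g s" unfolding g_def by (simp add: power2_eq_square)
      finally have "2 * ((Y x s - Y z s) \<bullet> (F (Y x s) - F (Y z s))) \<le> 2 * (L * g s)" by simp
      moreover have "0 \<le> g s" unfolding g_def by simp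
      ultimately show "2 * ((Y x s - Y z s) \<bullet> (F (Y x s) - F (Y z s))) \<le> a * g s + 0"
        unfolding a_def by (simp add: distrib_right)
    qed (use L0 a_def in simp_all)
    then have "(norm (Y x t - Y z t))\<^sup>2 \<le> (exp (a * t / 2) * norm (x - z))\<^sup>2"
      unfolding g_def power_mult_distrib exp_double[symmetric] by (simp add: Y0 mult.commute)
    then show ?thesis by (rule power2_le_imp_le) simp
  qed
  have "continuous_on ({0..} \<times> UNIV) (\<lambda>(t, x). Y x t)"
    unfolding continuous_on_def
  proof (intro ballI)
    fix p :: "real \<times> 'a" assume p: "p \<in> {0..} \<times> UNIV"
    obtain t0 x0 where p_eq: "p = (t0, x0)" by (cases p)
    have t0: "0 \<le> t0" using p p_eq by auto
    let ?A = "at (t0, x0) within {0..} \<times> UNIV"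
    have f: "((\<lambda>q. fst q) \<longlongrightarrow> t0) ?A" "((\<lambda>q. snd q) \<longlongrightarrow> x0) ?A"
      by (auto intro!: tendsto_eq_intros)
    have "continuous_on {0..} (Y x0)"
      using Y by (auto simp: continuous_on_eq_continuous_within intro: has_vector_derivative_continuous)
    then have cY: "(Y x0 \<longlongrightarrow> Y x0 t0) (at t0 within {0..})"
      using t0 by (auto simp: continuous_on_def)
    have Yf: "((\<lambda>q. Y x0 (fst q)) \<longlongrightarrow> Y x0 t0) ?A"
      by (rule continuous_on_tendsto_compose[OF \<open>continuous_on {0..} (Y x0)\<close> f(1)])
         (use t0 in \<open>auto simp: eventually_at_filter intro!: always_eventually\<close>)
    have "((\<lambda>q. (case q of (t, x) \<Rightarrow> Y x t) - Y x0 t0) \<longlongrightarrow> 0) ?A"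
    proof (rule Lim_null_comparison)
      show "\<forall>\<^sub>F q in ?A. norm ((case q of (t, x) \<Rightarrow> Y x t) - Y x0 t0)
         \<le> exp (a * fst q / 2) * norm (snd q - x0) + norm (Y x0 (fst q) - Y x0 t0)"
        unfolding eventually_at_filter
      proof (intro always_eventually allI impI)
        fix q :: "real \<times> 'a" assume q: "q \<in> {0..} \<times> UNIV"
        have "norm (Y (snd q) (fst q) - Y x0 t0)
          \<le> norm (Y (snd q) (fst q) - Y x0 (fst q)) + norm (Y x0 (fst q) - Y x0 t0)"
          using norm_triangle_ineq[of "Y (snd q) (fst q) - Y x0 (fst q)" "Y x0 (fst q) - Y x0 t0"] by simp
        also have "\<dots> \<le> exp (a * fst q / 2) * norm (snd q - x0) + norm (Y x0 (fst q) - Y x0 t0)"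
          using lip[of "fst q" "snd q" x0] q by auto
        finally show "norm ((case q of (t, x) \<Rightarrow> Y x t) - Y x0 t0)
         \<le> exp (a * fst q / 2) * norm (snd q - x0) + norm (Y x0 (fst q) - Y x0 t0)"
          by (simp add: case_prod_unfold)
      qed
      show "((\<lambda>q. exp (a * fst q / 2) * norm (snd q - x0) + norm (Y x0 (fst q) - Y x0 t0)) \<longlongrightarrow> 0) ?A"
        by (rule tendsto_eq_intros f Yf refl | simp)+
    qed
    then show "((\<lambda>(t, x). Y x t) \<longlongrightarrow> (case p of (t, x) \<Rightarrow> Y x t)) (at p within {0..} \<times> UNIV)"
      unfolding p_eq by (simp add: LIM_zero_iff)
  qed
  then show ?thesis using Y0 Y by (intro exI[of _ "\<lambda>t x. Y x t"]) auto
qed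

subsection \<open>Elementary bounds\<close>

text \<open>Stirling's formula up to a logarithmic error, which suffices since these errors are
  finally divided by N. The induction step is n (ln (n + 1) - ln n) \<le> 1; the upper bound rests
  on (n + 1) (ln (n + 1) - ln n) \<ge> 1.\<close>

lemma ln_fact_lower: "real n * ln (real n) - real n \<le> ln (fact n)"
proof (induction n)
  case (Suc n)
  show ?case
  proof (cases "n = 0")
    case False
    then have n: "0 < real n" by simp
    have "ln (1 + 1 / real n) \<le> 1 / real n" using n by (intro ln_add_one_self_le_self) simp
    moreover have "1 + 1 / real n = real (Suc n) / real n" using n by (simp add: field_simps)
    ultimately have "ln (real (Suc n)) - ln (real n) \<le> 1 / real n" using n by (simp add: ln_div)
    then have "real n * (ln (real (Suc n)) - ln (real n)) \<le> 1" using n by (simp add: field_simps)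
    moreover have "ln (fact (Suc n) :: real) = ln (real (Suc n)) + ln (fact n)"
      by (simp add: ln_mult del: of_nat_Suc)
    ultimately show ?thesis using Suc by (simp add: algebra_simps)
  qed simp
qed simp

lemma ln_fact_upper:
  assumes "n \<noteq> 0"
  shows "ln (fact n) \<le> (real n + 1) * ln (real n) - real n + 1"
proof -
  from assms have "1 \<le> n" by simp
  then show ?thesis
  proof (induction n rule: dec_induct)
    case (step n)
    then have n: "0 < real n" by simp
    have "ln (real n / real (Suc n)) \<le> real n / real (Suc n) - 1"
      using n by (intro ln_le_minus_one) simp
    then have "ln (real n) - ln (real (Suc n)) \<le> - 1 / real (Suc n)"
      using n by (simp add: ln_div field_simps)
    then have "(real n + 1) * (ln (real n) - ln (real (Suc n))) \<le> - 1"
      by (simp add: field_simps)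
    moreover have "ln (fact (Suc n) :: real) = ln (real (Suc n)) + ln (fact n)"
      by (simp add: ln_mult del: of_nat_Suc)
    ultimately show ?case using step by (simp add: algebra_simps)
  qed simp
qed

text \<open>An error uniform in n and valid at n = 0, so that one constant serves all factorials of
  a multinomial coefficient.\<close>

lemma ln_fact_upper_uniform:
  assumes "n \<le> N"
  shows "ln (fact n) \<le> real n * ln (real n) - real n + 1 + ln (real N + 1)"
proof (cases "n = 0")
  case False
  have "ln (real n) \<le> ln (real N + 1)" using False assms by (intro ln_mono) auto
  then show ?thesis using ln_fact_upper[OF False] by (simp add: algebra_simps)
qed simp

lemma continuous_on_x_ln_x: "continuous_on {0..} (\<lambda>x::real. x * ln x)"
  unfolding continuous_on_def
proof (intro ballI)
  fix x :: real assume x: "x \<in> {0..}"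
  show "((\<lambda>x. x * ln x) \<longlongrightarrow> x * ln x) (at x within {0..})"
  proof (cases "x = 0")
    case True
    have "((\<lambda>x::real. x * ln x) \<longlongrightarrow> 0) (at_right 0)" by real_asymp
    moreover have "at (0::real) within {0..} = at_right 0"
      unfolding at_within_def by (rule arg_cong[of _ _ "\<lambda>S. inf (nhds 0) (principal S)"]) auto
    ultimately show ?thesis using True by simp
  next
    case False
    with x have "isCont (\<lambda>x. x * ln x) x" by (auto intro!: continuous_intros)
    then show ?thesis unfolding isCont_def by (rule tendsto_within_subset) simp
  qed
qed

subsection \<open>Configurations and empirical measures\<close>

lemma finite_configs [simp]: "finite (configs N)"
  unfolding configs_def by (intro finite_PiE) auto

lemma configs_upd: "c \<in> configs N \<Longrightarrow> i < N \<Longrightarrow> c(i := y) \<in> configs N"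
  unfolding configs_def by (auto simp: PiE_def extensional_def)

lemma LN_nth_sum: "LN N c $ x = (\<Sum>j<N. if c j = x then 1 else 0) / real N"
proof -
  have "(\<Sum>j<N. if c j = x then 1 else 0) = real (card {i \<in> {..<N}. c i = x})"
    by (subst sum.inter_filter[symmetric]) simp_all
  then show ?thesis by (simp add: LN_def)
qed

text \<open>The way in which exchangeability is used: a sum over sites of a function of the site
  value is a function of the empirical measure.\<close>

lemma sum_sites_eq_LN:
  fixes f :: "'x::finite \<Rightarrow> real"
  assumes "0 < N"
  shows "(\<Sum>i<N. f (c i)) = real N * (\<Sum>x\<in>UNIV. LN N c $ x * f x)"
proof -
  have "real N * (\<Sum>x\<in>UNIV. LN N c $ x * f x) = (\<Sum>x\<in>UNIV. \<Sum>j<N. if c j = x then f x else 0)"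
    using assms
    by (simp add: LN_nth_sum sum_distrib_left sum_distrib_right sum_divide_distrib if_distrib[of "\<lambda>a. a * _"]
        cong: if_cong)
  also have "\<dots> = (\<Sum>j<N. \<Sum>x\<in>UNIV. if c j = x then f x else 0)" by (rule sum.swap)
  finally show ?thesis by simp
qed

lemma LN_in_PX:
  assumes "0 < N"
  shows "LN N c \<in> PX"
proof -
  have "real N * (\<Sum>x\<in>UNIV. LN N c $ x * 1) = (\<Sum>i<N. 1)"
    by (rule sum_sites_eq_LN[OF assms, symmetric])
  then show ?thesis using assms by (auto simp: PX_def LN_def)
qed

lemma LN_upd:
  assumes "i < N"
  shows "LN N (c(i := y)) = LN N c + (1 / real N) *\<^sub>R (axis y 1 - axis (c i) 1)"
proof (rule vec_eq_iff[THEN iffD2], rule)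
  fix x
  have "(\<Sum>j<N. if (c(i := y)) j = x then 1 else (0::real))
      = (if y = x then 1 else 0) + (\<Sum>j\<in>{..<N} - {i}. if (c(i := y)) j = x then 1 else 0)"
    using assms by (subst sum.remove[of _ i]) auto
  also have "(\<Sum>j\<in>{..<N} - {i}. if (c(i := y)) j = x then 1 else (0::real))
      = (\<Sum>j\<in>{..<N} - {i}. if c j = x then 1 else 0)"
    by (intro sum.cong) auto
  also have "\<dots> = (\<Sum>j<N. if c j = x then 1 else 0) - (if c i = x then 1 else 0)"
    using assms by (subst sum.remove[of "{..<N}" i]) auto
  finally have e: "(\<Sum>j<N. if (c(i := y)) j = x then 1 else (0::real))
      = (if y = x then 1 else 0) + ((\<Sum>j<N. if c j = x then 1 else 0) - (if c i = x then 1 else 0))" .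
  show "LN N (c(i := y)) $ x = (LN N c + (1 / real N) *\<^sub>R (axis y 1 - axis (c i) 1)) $ x"
    unfolding LN_nth_sum e vector_add_component
    by (auto simp: axis_def add_divide_distrib diff_divide_distrib)
qed

section \<open>The simplex and the Shannon entropy\<close>

lemma PX_convex: "convex (PX :: (real^'x::finite) set)"
  unfolding convex_def PX_def
  by (auto simp: sum.distrib sum_distrib_left[symmetric] intro!: add_nonneg_nonneg)

lemma PX_closed: "closed (PX :: (real^'x::finite) set)"
proof -
  have "PX = (\<Inter>x. {\<mu>::real^'x. 0 \<le> \<mu> $ x}) \<inter> {\<mu>. (\<Sum>x\<in>UNIV. \<mu> $ x) = 1}"
    by (auto simp: PX_def)
  also have "closed \<dots>"
    by (intro closed_Int closed_INT ballI closed_Collect_le closed_Collect_eq continuous_intros)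
  finally show ?thesis .
qed

lemma PX_nth_bounds:
  assumes "\<mu> \<in> PX"
  shows "0 \<le> \<mu> $ x" "\<mu> $ x \<le> 1"
proof -
  show "0 \<le> \<mu> $ x" using assms by (simp add: PX_def)
  have "\<mu> $ x \<le> (\<Sum>x\<in>UNIV. \<mu> $ x)" using assms by (intro member_le_sum) (auto simp: PX_def)
  then show "\<mu> $ x \<le> 1" using assms by (simp add: PX_def)
qed

lemma PX_norm_le_1:
  assumes "\<mu> \<in> PX"
  shows "norm \<mu> \<le> 1"
proof -
  have "norm \<mu> \<le> (\<Sum>x\<in>UNIV. \<bar>\<mu> $ x\<bar>)" by (rule norm_le_l1_cart)
  also have "\<dots> = (\<Sum>x\<in>UNIV. \<mu> $ x)" using assms by (intro sum.cong) (auto simp: PX_def)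
  also have "\<dots> = 1" using assms by (simp add: PX_def)
  finally show ?thesis .
qed

lemma PX_compact: "compact (PX :: (real^'x::finite) set)"
  unfolding compact_eq_bounded_closed
  using PX_closed PX_norm_le_1 by (auto simp: bounded_iff)

lemma PX_nonempty: "(PX :: (real^'x::finite) set) \<noteq> {}"
  using LN_in_PX[of 1] by auto

definition shannon :: "real^'x::finite \<Rightarrow> real" where
  "shannon \<mu> = - (\<Sum>x\<in>UNIV. \<mu> $ x * ln (\<mu> $ x))"

lemma FE_shannon: "FE K \<mu> = UU K \<mu> - shannon \<mu>"
  by (simp add: FE_def shannon_def)

lemma continuous_on_shannon: "continuous_on PX shannon"
  unfolding shannon_def
  by (intro continuous_intros continuous_on_compose2[OF continuous_on_x_ln_x])
     (auto simp: PX_nth_bounds)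

subsection \<open>Method of types\<close>

text \<open>A type class: for N > 0 and nonempty, it is an orbit of the permutations of sites. All
  entropy bounds come from counting it.\<close>

definition config_class :: "nat \<Rightarrow> real^'x::finite \<Rightarrow> (nat \<Rightarrow> 'x) set" where
  "config_class N \<mu> = {c \<in> configs N. LN N c = \<mu>}"

lemma finite_config_class: "finite (config_class N \<mu>)"
  unfolding config_class_def by simp

lemma card_config_class_pos: "c \<in> configs N \<Longrightarrow> 0 < card (config_class N (LN N c))"
  using finite_config_class by (auto simp: card_gt_0_iff config_class_def)

lemma count_mset_map_upt: "count (mset (map c [0..<N])) x = card {i \<in> {..<N}. c i = x}"
proof -
  have "count (mset (map c [0..<N])) x = card {i. i < N \<and> map c [0..<N] ! i = x}"
    unfolding count_mset count_list_eq_length_filter length_filter_conv_card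
    by (rule arg_cong[of _ _ card]) auto
  also have "{i. i < N \<and> map c [0..<N] ! i = x} = {i \<in> {..<N}. c i = x}" by auto
  finally show ?thesis .
qed

lemma LN_eq_iff_mset:
  assumes "0 < N"
  shows "LN N c = LN N c' \<longleftrightarrow> mset (map c [0..<N]) = mset (map c' [0..<N])"
  unfolding multiset_eq_iff count_mset_map_upt using assms by (simp add: LN_def vec_eq_iff)

lemma configs_of_list:
  assumes "length xs = N"
  shows "\<exists>c\<in>configs N. map c [0..<N] = xs"
proof
  show "restrict ((!) xs) {..<N} \<in> configs N" by (simp add: configs_def)
  show "map (restrict ((!) xs) {..<N}) [0..<N] = xs"
    using assms by (intro nth_equalityI) auto
qed

text \<open>A multinomial coefficient, written as a product to avoid division. Reading a
  configuration as the list of its values turns a type class into the permutations of a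
  multiset.\<close>

lemma card_config_class:
  fixes c :: "nat \<Rightarrow> 'x::finite"
  assumes "0 < N"
  shows "card (config_class N (LN N c)) * (\<Prod>x\<in>UNIV. fact (card {i \<in> {..<N}. c i = x})) = fact N"
proof -
  define A where "A = mset (map c [0..<N])"
  have "bij_betw (\<lambda>c. map c [0..<N]) (config_class N (LN N c)) (permutations_of_multiset A)"
  proof (rule bij_betwI')
    fix a b assume "a \<in> config_class N (LN N c)" "b \<in> config_class N (LN N c)"
    \<comment> \<open>Equal value lists give equal functions only because configurations are fixed
      outside \<open>{..<N}\<close>.\<close>
    then have "a \<in> extensional {..<N}" "b \<in> extensional {..<N}"
      by (auto simp: config_class_def configs_def PiE_def)
    then show "(map a [0..<N] = map b [0..<N]) = (a = b)"
      by (auto intro: extensionalityI)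
  next
    fix a assume "a \<in> config_class N (LN N c)"
    then show "map a [0..<N] \<in> permutations_of_multiset A"
      unfolding permutations_of_multiset_def A_def config_class_def using LN_eq_iff_mset[OF assms, of a c] by simp
  next
    fix xs assume xs: "xs \<in> permutations_of_multiset A"
    then have "mset xs = A" by (simp add: permutations_of_multiset_def)
    then have "length xs = N" unfolding A_def by (metis length_map length_upt minus_nat.diff_0 size_mset)
    then obtain a where a: "a \<in> configs N" "map a [0..<N] = xs" using configs_of_list by metis
    then have "LN N a = LN N c" using LN_eq_iff_mset[OF assms, of a c] \<open>mset xs = A\<close> A_def by simp
    then show "\<exists>a\<in>config_class N (LN N c). xs = map a [0..<N]" using a unfolding config_class_def by blast
  qed
  then have "card (config_class N (LN N c)) = card (permutations_of_multiset A)"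
    by (rule bij_betw_same_card)
  moreover have "(\<Prod>x\<in>set_mset A. fact (count A x)) = (\<Prod>x\<in>UNIV. fact (count A x) :: nat)"
    by (rule prod.mono_neutral_left) (auto simp: not_in_iff)
  moreover have "size A = N" by (simp add: A_def)
  ultimately show ?thesis
    using card_permutations_of_multiset_aux[of A] unfolding A_def count_mset_map_upt by simp
qed

text \<open>Stirling in the multinomial coefficient. The lower bound pays one error for each of the
  CARD('x) factorials in the denominator, the upper bound only the one of the numerator.\<close>

lemma ln_card_config_class:
  fixes c :: "nat \<Rightarrow> 'x::finite"
  assumes "0 < N" "c \<in> configs N"
  shows "real N * shannon (LN N c) - CARD('x) * (1 + ln (real N + 1)) \<le> ln (card (config_class N (LN N c)))"
    and "ln (card (config_class N (LN N c))) \<le> real N * shannon (LN N c) + 1 + ln (real N + 1)"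
proof -
  define n where "n x = card {i \<in> {..<N}. c i = x}" for x
  have nN: "n x \<le> N" for x
    unfolding n_def using card_mono[of "{..<N}" "{i \<in> {..<N}. c i = x}"] by auto
  have LNn: "LN N c $ x = real (n x) / real N" for x by (simp add: LN_def n_def)
  have sn: "(\<Sum>x\<in>UNIV. real (n x)) = real N"
    using LN_in_PX[OF assms(1), of c] assms(1) by (simp add: PX_def LNn sum_divide_distrib[symmetric])
  have "real (n x) * ln (real (n x)) = real (n x) * ln (real N) + real N * (LN N c $ x * ln (LN N c $ x))" for x
    using assms(1) by (cases "n x = 0") (simp_all add: LNn ln_div field_simps)
  then have "(\<Sum>x\<in>UNIV. real (n x) * ln (real (n x)))
     = (\<Sum>x\<in>UNIV. real (n x)) * ln (real N) + real N * (\<Sum>x\<in>UNIV. LN N c $ x * ln (LN N c $ x))"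
    by (simp add: sum.distrib sum_distrib_left sum_distrib_right)
  then have ent: "(\<Sum>x\<in>UNIV. real (n x) * ln (real (n x))) = real N * ln (real N) - real N * shannon (LN N c)"
    unfolding sn shannon_def by simp
  have "real (card (config_class N (LN N c))) * (\<Prod>x\<in>UNIV. fact (n x)) = fact N"
    using arg_cong[OF card_config_class[OF assms(1), of c], of real] unfolding n_def by simp
  then have "ln (real (card (config_class N (LN N c)))) + ln (\<Prod>x\<in>UNIV. fact (n x)) = ln (fact N :: real)"
    using card_config_class_pos[OF assms(2)] prod_pos[of UNIV "\<lambda>x. fact (n x) :: real"]
    by (metis fact_gt_zero ln_mult_pos of_nat_0_less_iff)
  moreover have "ln (\<Prod>x\<in>UNIV. fact (n x) :: real) = (\<Sum>x\<in>UNIV. ln (fact (n x)))"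
    by (rule ln_prod) auto
  ultimately have eq: "ln (card (config_class N (LN N c))) = ln (fact N) - (\<Sum>x\<in>UNIV. ln (fact (n x)))" by simp
  have "(\<Sum>x\<in>UNIV. ln (fact (n x)))
     \<le> (\<Sum>x\<in>UNIV. real (n x) * ln (real (n x)) - real (n x) + (1 + ln (real N + 1)))"
    using ln_fact_upper_uniform[OF nN] by (intro sum_mono) (simp add: add.assoc)
  also have "\<dots> = real N * ln (real N) - real N * shannon (LN N c) - real N + CARD('x) * (1 + ln (real N + 1))"
    unfolding sum.distrib sum_subtractf ent sn by (simp add: distrib_left)
  finally show "real N * shannon (LN N c) - CARD('x) * (1 + ln (real N + 1)) \<le> ln (card (config_class N (LN N c)))"
    unfolding eq using ln_fact_lower[of N] by simp
  have "(\<Sum>x\<in>UNIV. real (n x) * ln (real (n x)) - real (n x)) \<le> (\<Sum>x\<in>UNIV. ln (fact (n x)))"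
    by (intro sum_mono ln_fact_lower)
  then show "ln (card (config_class N (LN N c))) \<le> real N * shannon (LN N c) + 1 + ln (real N + 1)"
    unfolding eq sum_subtractf ent sn using ln_fact_upper_uniform[of N N] by simp
qed

text \<open>Each of the CARD('x) occupation numbers lies in {0..N}. That the number of types is
  polynomial in N is why the randomness of the type contributes only O(ln N) to an entropy.\<close>

lemma card_types_le:
  "card (LN N ` (configs N :: (nat \<Rightarrow> 'x::finite) set)) \<le> (N + 1) ^ CARD('x)"
proof -
  let ?F = "PiE (UNIV :: 'x set) (\<lambda>_. {..N})"
  have "LN N ` (configs N :: (nat \<Rightarrow> 'x) set) \<subseteq> (\<lambda>f. \<chi> y. real (f y) / real N) ` ?F"
  proof
    fix \<mu> assume "\<mu> \<in> LN N ` (configs N :: (nat \<Rightarrow> 'x) set)"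
    then obtain c :: "nat \<Rightarrow> 'x" where c: "\<mu> = LN N c" by blast
    have "(\<lambda>y. card {i \<in> {..<N}. c i = y}) \<in> ?F"
      using card_mono[of "{..<N}" "{i \<in> {..<N}. c i = y}" for y] by (auto simp: PiE_def)
    then show "\<mu> \<in> (\<lambda>f. \<chi> y. real (f y) / real N) ` ?F"
      unfolding c LN_def by (intro image_eqI) auto
  qed
  then have "card (LN N ` (configs N :: (nat \<Rightarrow> 'x) set)) \<le> card ?F"
    by (intro surj_card_le) (auto intro: finite_PiE)
  also have "\<dots> = (N + 1) ^ CARD('x)" by (simp add: card_PiE)
  finally show ?thesis .
qed

lemma sum_configs_by_type:
  fixes f :: "(nat \<Rightarrow> 'x::finite) \<Rightarrow> real"
  shows "(\<Sum>c\<in>configs N. f c) = (\<Sum>\<mu>\<in>LN N ` configs N. \<Sum>c\<in>config_class N \<mu>. f c)"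
  unfolding config_class_def
  by (rule sum.image_gen[OF finite_configs])

text \<open>Nonnegativity of the relative entropy with respect to the law that draws a type
  uniformly and then a configuration uniformly in its class. The number \<open>J\<close> of types
  accounts for CARD('x) ln (N + 1), the class sizes \<open>T c\<close> for the Shannon term and the
  remaining error.\<close>

lemma entropy_lower_bound:
  fixes m :: "(nat \<Rightarrow> 'x::finite) \<Rightarrow> real"
  assumes "0 < N" and m: "is_prob_configs N m"
  shows "- real N * (\<Sum>c\<in>configs N. m c * shannon (LN N c)) - (CARD('x) + 1) * ln (real N + 1) - 1
     \<le> (\<Sum>c\<in>configs N. m c * ln (m c))"
proof -
  define J where "J = real (card (LN N ` (configs N :: (nat \<Rightarrow> 'x) set)))"
  define T where "T c = real (card (config_class N (LN N c)))" for c :: "nat \<Rightarrow> 'x"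
  have m0: "\<And>c. c \<in> configs N \<Longrightarrow> 0 \<le> m c" and m1: "(\<Sum>c\<in>configs N. m c) = 1"
    using m by (auto simp: is_prob_configs_def)
  have ne: "(configs N :: (nat \<Rightarrow> 'x) set) \<noteq> {}" using m1 by auto
  have J: "0 < J" unfolding J_def using ne by (simp add: card_gt_0_iff)
  have T: "0 < T c" if "c \<in> configs N" for c unfolding T_def using card_config_class_pos[OF that] by simp
  have "(\<Sum>c\<in>configs N. 1 / (J * T c)) = (\<Sum>\<mu>\<in>LN N ` configs N. \<Sum>c\<in>config_class N \<mu>. 1 / (J * T c))"
    by (rule sum_configs_by_type)
  also have "\<dots> = (\<Sum>\<mu>\<in>LN N ` (configs N :: (nat \<Rightarrow> 'x) set). 1 / J)"
  proof (rule sum.cong[OF refl])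
    fix \<mu> assume "\<mu> \<in> LN N ` (configs N :: (nat \<Rightarrow> 'x) set)"
    then have pos: "0 < card (config_class N \<mu>)" using card_config_class_pos by blast
    have "(\<Sum>c\<in>config_class N \<mu>. 1 / (J * T c)) = (\<Sum>c\<in>config_class N \<mu>. 1 / (J * real (card (config_class N \<mu>))))"
      by (intro sum.cong) (auto simp: T_def config_class_def)
    then show "(\<Sum>c\<in>config_class N \<mu>. 1 / (J * T c)) = 1 / J" using pos by simp
  qed
  also have "\<dots> = J * (1 / J)" by (simp add: J_def)
  also have "\<dots> = 1" using J by simp
  finally have b1: "(\<Sum>c\<in>configs N. 1 / (J * T c)) = 1" .
  have "0 \<le> (\<Sum>c\<in>configs N. m c * ln (m c / (1 / (J * T c))))"
    using m0 J T b1 m1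
    by (intro relative_entropy_nonneg) (auto simp: less_imp_le dest: T)
  also have "\<dots> = (\<Sum>c\<in>configs N. m c * ln (m c) + m c * ln J + m c * ln (T c))"
  proof (rule sum.cong[OF refl])
    fix c :: "nat \<Rightarrow> 'x" assume c: "c \<in> configs N"
    show "m c * ln (m c / (1 / (J * T c))) = m c * ln (m c) + m c * ln J + m c * ln (T c)"
    proof (cases "m c = 0")
      case False
      then have "0 < m c" using m0[OF c] by simp
      then show ?thesis using J T[OF c] by (simp add: ln_mult algebra_simps)
    qed simp
  qed
  also have "\<dots> = (\<Sum>c\<in>configs N. m c * ln (m c)) + ln J + (\<Sum>c\<in>configs N. m c * ln (T c))"
    by (simp add: sum.distrib sum_distrib_right[symmetric] m1)
  finally have 1: "0 \<le> (\<Sum>c\<in>configs N. m c * ln (m c)) + ln J + (\<Sum>c\<in>configs N. m c * ln (T c))" .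
  have "J \<le> (real N + 1) ^ CARD('x)"
    using card_types_le[where 'x = 'x, of N] unfolding J_def
    by (metis of_nat_le_iff of_nat_power of_nat_Suc Suc_eq_plus1 add.commute)
  then have "ln J \<le> ln ((real N + 1) ^ CARD('x))" using J by (intro ln_mono) auto
  then have 2: "ln J \<le> CARD('x) * ln (real N + 1)" by (simp add: ln_realpow)
  have "(\<Sum>c\<in>configs N. m c * ln (T c)) \<le> (\<Sum>c\<in>configs N. m c * (real N * shannon (LN N c) + 1 + ln (real N + 1)))"
    unfolding T_def using ln_card_config_class(2)[OF assms(1)] m0 by (intro sum_mono mult_left_mono) auto
  also have "\<dots> = real N * (\<Sum>c\<in>configs N. m c * shannon (LN N c)) + (\<Sum>c\<in>configs N. m c) * (1 + ln (real N + 1))"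
    by (simp add: algebra_simps sum.distrib sum_distrib_left sum_distrib_right)
  finally show ?thesis using 1 2 unfolding m1 by (simp add: algebra_simps)
qed

text \<open>A law constant on type classes gives each configuration at most the inverse of its class
  size, so it attains the general lower bound up to O(ln N).\<close>

lemma entropy_upper_bound_type_function:
  fixes g :: "(nat \<Rightarrow> 'x::finite) \<Rightarrow> real"
  assumes "0 < N" and g: "is_prob_configs N g"
    and cls: "\<And>c c'. c \<in> configs N \<Longrightarrow> c' \<in> configs N \<Longrightarrow> LN N c = LN N c' \<Longrightarrow> g c = g c'"
  shows "(\<Sum>c\<in>configs N. g c * ln (g c))
    \<le> - real N * (\<Sum>c\<in>configs N. g c * shannon (LN N c)) + CARD('x) * (1 + ln (real N + 1))"
proof -
  have g0: "\<And>c. c \<in> configs N \<Longrightarrow> 0 \<le> g c" and g1: "(\<Sum>c\<in>configs N. g c) = 1"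
    using g by (auto simp: is_prob_configs_def)
  have "g c * ln (g c) \<le> g c * (CARD('x) * (1 + ln (real N + 1)) - real N * shannon (LN N c))"
    if c: "c \<in> configs N" for c
  proof (cases "g c = 0")
    case False
    then have pos: "0 < g c" using g0[OF c] by simp
    let ?T = "config_class N (LN N c)"
    have "(\<Sum>c'\<in>?T. g c') = (\<Sum>c'\<in>?T. g c)"
      by (intro sum.cong refl cls) (auto simp: config_class_def c)
    then have "real (card ?T) * g c = (\<Sum>c'\<in>?T. g c')" by simp
    also have "\<dots> \<le> (\<Sum>c\<in>configs N. g c)"
      using g0 by (intro sum_mono2 finite_configs) (auto simp: config_class_def)
    finally have "real (card ?T) * g c \<le> 1" using g1 by simp
    then have "ln (real (card ?T) * g c) \<le> ln 1"
      using pos card_config_class_pos[OF c] by (intro ln_mono) auto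
    then have "ln (g c) \<le> - ln (card ?T)"
      using pos card_config_class_pos[OF c] by (simp add: ln_mult)
    then have "ln (g c) \<le> CARD('x) * (1 + ln (real N + 1)) - real N * shannon (LN N c)"
      using ln_card_config_class(1)[OF assms(1) c] by linarith
    then show ?thesis using pos by (intro mult_left_mono) auto
  qed simp
  then have "(\<Sum>c\<in>configs N. g c * ln (g c))
     \<le> (\<Sum>c\<in>configs N. g c * (CARD('x) * (1 + ln (real N + 1)) - real N * shannon (LN N c)))"
    by (rule sum_mono)
  also have "\<dots> = (\<Sum>c\<in>configs N. g c) * (CARD('x) * (1 + ln (real N + 1))) - real N * (\<Sum>c\<in>configs N. g c * shannon (LN N c))"
    by (simp add: algebra_simps sum.distrib sum_subtractf sum_distrib_left sum_distrib_right)
  finally show ?thesis by (simp add: g1)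
qed

lemma empirical_approximation:
  fixes \<nu> :: "real^'x::finite"
  assumes \<nu>: "\<nu> \<in> PX" and "0 < N"
  shows "\<exists>c\<in>configs N. \<forall>x. \<bar>LN N c $ x - \<nu> $ x\<bar> \<le> CARD('x) / real N"
proof -
  obtain a0 :: 'x where True by blast
  define n where "n x = nat \<lfloor>real N * \<nu> $ x\<rfloor>" for x
  have n: "real (n x) \<le> real N * \<nu> $ x" "real N * \<nu> $ x \<le> real (n x) + 1" for x
    using PX_nth_bounds(1)[OF \<nu>, of x] unfolding n_def by (auto simp: of_nat_nat)
  have s: "(\<Sum>x\<in>UNIV. real N * \<nu> $ x) = real N"
    using \<nu> by (simp add: PX_def sum_distrib_left[symmetric])
  have sle: "real (\<Sum>x\<in>UNIV. n x) \<le> real N"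
    using sum_mono[of UNIV "\<lambda>x. real (n x)" "\<lambda>x. real N * \<nu> $ x"] n s by simp
  have sge: "real N \<le> real (\<Sum>x\<in>UNIV. n x) + CARD('x)"
  proof -
    have "real N \<le> (\<Sum>x\<in>UNIV. real (n x) + 1)"
      using sum_mono[of UNIV "\<lambda>x. real N * \<nu> $ x" "\<lambda>x. real (n x) + 1"] n s by simp
    then show ?thesis by (simp add: sum.distrib)
  qed
  \<comment> \<open>Rounding down loses at most one particle per state, hence at most CARD('x) in
    total; the \<open>r\<close> missing ones are all put into the arbitrary state
    \<open>a0\<close>.\<close>
  define r where "r = N - (\<Sum>x\<in>UNIV. n x)"
  have r: "real r = real N - real (\<Sum>x\<in>UNIV. n x)" unfolding r_def using sle by (simp add: of_nat_diff del: of_nat_sum)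
  define M where "M = (\<Sum>x\<in>UNIV. replicate_mset (n x) x) + replicate_mset r a0"
  have "size M = (\<Sum>x\<in>UNIV. n x) + r" unfolding M_def by (simp add: size_multiset_sum)
  then have "size M = N" using sle unfolding r_def by simp
  moreover obtain xs where xs: "mset xs = M" using ex_mset by blast
  ultimately have "length xs = N" by (metis size_mset)
  then obtain c where c: "c \<in> configs N" "map c [0..<N] = xs" using configs_of_list by metis
  have "card {i \<in> {..<N}. c i = x} = n x + (if x = a0 then r else 0)" for x
    using count_mset_map_upt[of c N x] unfolding c(2) xs M_def by (simp add: count_sum)
  then have LNx: "LN N c $ x = (real (n x) + (if x = a0 then real r else 0)) / real N" for x
    by (simp add: LN_def)
  have "\<bar>LN N c $ x - \<nu> $ x\<bar> \<le> CARD('x) / real N" for x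
  proof -
    have C1: "1 \<le> real (CARD('x))" by (simp add: Suc_leI)
    have "\<bar>real (n x) + (if x = a0 then real r else 0) - real N * \<nu> $ x\<bar> \<le> CARD('x)"
      unfolding abs_le_iff using n[of x] r sle sge C1
      by (cases "x = a0") (simp_all only: if_True if_False simp_thms, linarith+)
    moreover have "LN N c $ x - \<nu> $ x = (real (n x) + (if x = a0 then real r else 0) - real N * \<nu> $ x) / real N"
      using assms(2) by (simp add: LNx field_simps)
    ultimately show ?thesis using assms(2) by (simp add: abs_divide divide_right_mono)
  qed
  then show ?thesis using c by blast
qed

section \<open>Laplace asymptotics of the partition function\<close>

lemma ZN_pos: "0 < ZN K N"
proof -
  have "(\<lambda>i\<in>{..<N}. undefined) \<in> configs N" by (simp add: configs_def)
  then show ?thesis unfolding ZN_def by (intro sum_pos finite_configs) auto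
qed

lemma continuous_on_FE:
  assumes "continuous_on PX (UU K)"
  shows "continuous_on PX (FE K)"
  using continuous_on_diff[OF assms continuous_on_shannon] by (simp add: FE_shannon[abs_def])

text \<open>Grouped by types, \<open>ZN\<close> is a sum of terms exp (- N FE) up to factors
  polynomial in N. A single class close to a near-minimiser bounds it from below; the polynomial
  number of classes times the largest possible term bounds it from above.\<close>

lemma ln_ZN_tendsto:
  fixes K :: "'x::finite \<Rightarrow> real^'x \<Rightarrow> real"
  assumes U: "continuous_on PX (UU K)"
  shows "(\<lambda>N. ln (ZN K N) / real N) \<longlonglongrightarrow> - FE0 K"
proof -
  have FEc: "continuous_on PX (FE K)" by (rule continuous_on_FE[OF U])
  have bdd: "bdd_below (FE K ` PX)"
    by (intro bounded_imp_bdd_below compact_imp_bounded compact_continuous_image[OF FEc PX_compact])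
  have FE0_le: "FE0 K \<le> FE K \<mu>" if "\<mu> \<in> PX" for \<mu>
    unfolding FE0_def using that bdd by (intro cINF_lower)
  define D where "D = real CARD('x)"
  show ?thesis
  proof (rule order_tendstoI)
    fix a assume "a < - FE0 K"
    then have "(INF \<mu>\<in>(PX :: (real^'x) set). FE K \<mu>) < - a" unfolding FE0_def by simp
    then obtain \<nu> where \<nu>: "\<nu> \<in> PX" "FE K \<nu> < - a"
      using cINF_less_iff[OF PX_nonempty bdd] by blast
    \<comment> \<open>The index is shifted to \<open>Suc N\<close> so that an approximating
      configuration exists for every index; the shift is undone at the end of this half.\<close>
    have "\<forall>N. \<exists>c\<in>configs (Suc N). \<forall>x. \<bar>LN (Suc N) c $ x - \<nu> $ x\<bar> \<le> CARD('x) / real (Suc N)"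
      using empirical_approximation[OF \<nu>(1)] by blast
    then obtain c where c: "\<And>N. c N \<in> configs (Suc N)"
      "\<And>N x. \<bar>LN (Suc N) (c N) $ x - \<nu> $ x\<bar> \<le> CARD('x) / real (Suc N)"
      by metis
    have lim: "(\<lambda>N. LN (Suc N) (c N)) \<longlonglongrightarrow> \<nu>"
    proof (rule vec_tendstoI)
      fix x
      have "(\<lambda>N. LN (Suc N) (c N) $ x - \<nu> $ x) \<longlonglongrightarrow> 0"
      proof (rule Lim_null_comparison[of _ "\<lambda>N. CARD('x) / real (Suc N)"])
        show "(\<lambda>N. real CARD('x) / real (Suc N)) \<longlonglongrightarrow> 0"
          by (rule LIMSEQ_Suc[OF lim_const_over_n])
      qed (use c in auto)
      then show "(\<lambda>N. LN (Suc N) (c N) $ x) \<longlonglongrightarrow> \<nu> $ x" by (simp add: LIM_zero_iff)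
    qed
    have "(\<lambda>N. FE K (LN (Suc N) (c N))) \<longlonglongrightarrow> FE K \<nu>"
      by (rule continuous_on_tendsto_compose[OF FEc lim \<nu>(1)]) (simp add: LN_in_PX)
    moreover have "(\<lambda>N. D * ((1 + ln (real (Suc N) + 1)) / real (Suc N))) \<longlonglongrightarrow> D * 0"
      by (intro tendsto_mult tendsto_const) real_asymp
    ultimately have "(\<lambda>N. - FE K (LN (Suc N) (c N)) - D * ((1 + ln (real (Suc N) + 1)) / real (Suc N)))
      \<longlonglongrightarrow> - FE K \<nu> - D * 0"
      by (intro tendsto_diff tendsto_minus)
    then have "\<forall>\<^sub>F N in sequentially. a < - FE K (LN (Suc N) (c N)) - D * ((1 + ln (real (Suc N) + 1)) / real (Suc N))"
      using \<nu>(2) by (intro order_tendstoD(1)) auto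
    moreover have "- FE K (LN (Suc N) (c N)) - D * ((1 + ln (real (Suc N) + 1)) / real (Suc N))
        \<le> ln (ZN K (Suc N)) / real (Suc N)" for N
    proof -
      let ?M = "Suc N" let ?c = "c N"
      let ?T = "config_class ?M (LN ?M ?c)"
      have Tpos: "0 < card ?T" using c(1) by (rule card_config_class_pos)
      have "(\<Sum>c'\<in>?T. exp (- real ?M * UU K (LN ?M c'))) = (\<Sum>c'\<in>?T. exp (- real ?M * UU K (LN ?M ?c)))"
        by (intro sum.cong) (auto simp: config_class_def)
      then have "real (card ?T) * exp (- real ?M * UU K (LN ?M ?c)) = (\<Sum>c'\<in>?T. exp (- real ?M * UU K (LN ?M c')))"
        by simp
      also have "\<dots> \<le> ZN K ?M"
        unfolding ZN_def by (intro sum_mono2 finite_configs) (auto simp: config_class_def)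
      finally have "ln (real (card ?T) * exp (- real ?M * UU K (LN ?M ?c))) \<le> ln (ZN K ?M)"
        using Tpos by (intro ln_mono) auto
      then have "ln (card ?T) - real ?M * UU K (LN ?M ?c) \<le> ln (ZN K ?M)"
        using Tpos by (simp add: ln_mult del: of_nat_Suc)
      moreover have "real ?M * shannon (LN ?M ?c) - D * (1 + ln (real ?M + 1)) \<le> ln (card ?T)"
        unfolding D_def by (rule ln_card_config_class(1)) (auto simp: c)
      ultimately have "real ?M * (- FE K (LN ?M ?c)) - D * (1 + ln (real ?M + 1)) \<le> ln (ZN K ?M)"
        by (simp add: FE_shannon right_diff_distrib del: of_nat_Suc)
      then have "(real ?M * (- FE K (LN ?M ?c)) - D * (1 + ln (real ?M + 1))) / real ?M \<le> ln (ZN K ?M) / real ?M"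
        by (rule divide_right_mono) simp
      then show ?thesis by (simp add: diff_divide_distrib del: of_nat_Suc)
    qed
    ultimately have "\<forall>\<^sub>F N in sequentially. a < ln (ZN K (Suc N)) / real (Suc N)"
      by (auto elim!: eventually_mono intro: order_less_le_trans)
    then show "\<forall>\<^sub>F N in sequentially. a < ln (ZN K N) / real N"
      by (subst (asm) eventually_sequentially_Suc[where P = "\<lambda>N. a < ln (ZN K N) / real N"])
  next
    fix a assume a: "- FE0 K < a"
    have "(\<lambda>N. ((D + 1) * ln (real N + 1) + 1) / real N) \<longlonglongrightarrow> 0" by real_asymp
    then have "\<forall>\<^sub>F N in sequentially. ((D + 1) * ln (real N + 1) + 1) / real N < a + FE0 K"
      using a by (intro order_tendstoD(2)) auto
    then show "\<forall>\<^sub>F N in sequentially. ln (ZN K N) / real N < a"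
      using eventually_gt_at_top[of 0]
    proof eventually_elim
      case (elim N)
      have "ZN K N = (\<Sum>\<mu>\<in>LN N ` configs N. \<Sum>c\<in>config_class N \<mu>. exp (- real N * UU K (LN N c)))"
        unfolding ZN_def by (rule sum_configs_by_type)
      also have "\<dots> \<le> (\<Sum>\<mu>\<in>LN N ` (configs N :: (nat \<Rightarrow> 'x) set). exp (- real N * FE0 K + 1 + ln (real N + 1)))"
      proof (rule sum_mono)
        fix \<mu> assume "\<mu> \<in> LN N ` (configs N :: (nat \<Rightarrow> 'x) set)"
        then obtain c :: "nat \<Rightarrow> 'x" where c: "c \<in> configs N" "\<mu> = LN N c" by blast
        have T: "0 < card (config_class N \<mu>)" using card_config_class_pos[OF c(1)] c by simp
        have "(\<Sum>c\<in>config_class N \<mu>. exp (- real N * UU K (LN N c)))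
            = (\<Sum>c\<in>config_class N \<mu>. exp (- real N * UU K \<mu>))"
          by (intro sum.cong) (auto simp: config_class_def)
        also have "\<dots> = real (card (config_class N \<mu>)) * exp (- real N * UU K \<mu>)" by simp
        also have "\<dots> = exp (ln (card (config_class N \<mu>)) - real N * UU K \<mu>)"
          using T by (simp add: exp_diff exp_minus field_simps)
        also have "\<dots> \<le> exp (- real N * FE0 K + 1 + ln (real N + 1))"
        proof -
          have "real N * FE0 K \<le> real N * FE K \<mu>"
            using FE0_le[OF LN_in_PX, of N c] elim c by (intro mult_left_mono) auto
          then show ?thesis
            using ln_card_config_class(2)[OF _ c(1)] elim c
            by (simp add: FE_shannon algebra_simps)
        qed
        finally show "(\<Sum>c\<in>config_class N \<mu>. exp (- real N * UU K (LN N c))) \<le> exp (- real N * FE0 K + 1 + ln (real N + 1))" .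
      qed
      also have "\<dots> = real (card (LN N ` (configs N :: (nat \<Rightarrow> 'x) set))) * exp (- real N * FE0 K + 1 + ln (real N + 1))"
        by simp
      also have "\<dots> \<le> (real N + 1) ^ CARD('x) * exp (- real N * FE0 K + 1 + ln (real N + 1))"
        using card_types_le[where 'x = 'x, of N]
        by (intro mult_right_mono) (metis of_nat_le_iff of_nat_power of_nat_Suc Suc_eq_plus1 add.commute, simp)
      finally have "ln (ZN K N) \<le> ln ((real N + 1) ^ CARD('x) * exp (- real N * FE0 K + 1 + ln (real N + 1)))"
        using ZN_pos[of K N] by (intro ln_mono) auto
      also have "\<dots> = D * ln (real N + 1) + (- real N * FE0 K + 1 + ln (real N + 1))"
        by (subst ln_mult) (simp_all add: D_def ln_realpow)
      finally have "ln (ZN K N) / real N \<le> (D * ln (real N + 1) + (- real N * FE0 K + 1 + ln (real N + 1))) / real N"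
        by (rule divide_right_mono) simp
      also have "\<dots> = - FE0 K + ((D + 1) * ln (real N + 1) + 1) / real N"
        using elim by (simp add: field_simps)
      finally show ?case using elim by simp
    qed
  qed
qed

subsection \<open>The limiting vector field\<close>

text \<open>The constant is hidden because only its existence matters. On the compact simplex such
  functions are bounded, hence the class is closed under products and \<open>exp\<close>.\<close>

definition lip_PX :: "(real^'x::finite \<Rightarrow> real) \<Rightarrow> bool" where
  "lip_PX f \<longleftrightarrow> (\<exists>L. L-lipschitz_on PX f)"

lemma lip_PX_continuous: "lip_PX f \<Longrightarrow> continuous_on PX f"
  unfolding lip_PX_def using lipschitz_on_continuous_on by blast

lemma continuous_on_PX_bounded:
  fixes f :: "real^'x::finite \<Rightarrow> real"
  assumes "continuous_on PX f"
  shows "\<exists>B>0. \<forall>\<mu>\<in>PX. \<bar>f \<mu>\<bar> \<le> B"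
proof -
  have "bounded (f ` PX)"
    by (intro compact_imp_bounded compact_continuous_image assms PX_compact)
  then show ?thesis unfolding bounded_pos by auto
qed

lemma lip_PX_const: "lip_PX (\<lambda>\<mu>. c)"
  unfolding lip_PX_def using lipschitz_on_constant by blast

lemma lip_PX_nth: "lip_PX (\<lambda>\<mu>. \<mu> $ x)"
  unfolding lip_PX_def
  by (intro exI[of _ 1] lipschitz_onI) (auto simp: dist_vec_nth_le)

lemma lip_PX_add: "lip_PX f \<Longrightarrow> lip_PX g \<Longrightarrow> lip_PX (\<lambda>\<mu>. f \<mu> + g \<mu>)"
  unfolding lip_PX_def using lipschitz_on_add by blast

lemma lip_PX_minus: "lip_PX f \<Longrightarrow> lip_PX (\<lambda>\<mu>. - f \<mu>)"
  unfolding lip_PX_def by simp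

lemma lip_PX_diff: "lip_PX f \<Longrightarrow> lip_PX g \<Longrightarrow> lip_PX (\<lambda>\<mu>. f \<mu> - g \<mu>)"
  unfolding lip_PX_def using lipschitz_on_diff by blast

lemma lip_PX_sum: "(\<And>i. i \<in> I \<Longrightarrow> lip_PX (f i)) \<Longrightarrow> lip_PX (\<lambda>\<mu>. \<Sum>i\<in>I. f i \<mu>)"
  by (induction I rule: infinite_finite_induct) (auto intro: lip_PX_const lip_PX_add)

lemma lip_PX_mult:
  assumes "lip_PX f" "lip_PX g"
  shows "lip_PX (\<lambda>\<mu>. f \<mu> * g \<mu>)"
proof -
  obtain L M where L: "L-lipschitz_on PX f" and M: "M-lipschitz_on PX g"
    using assms unfolding lip_PX_def by blast
  obtain B C where B: "0 < B" "\<And>\<mu>. \<mu> \<in> PX \<Longrightarrow> \<bar>f \<mu>\<bar> \<le> B" and C: "0 < C" "\<And>\<mu>. \<mu> \<in> PX \<Longrightarrow> \<bar>g \<mu>\<bar> \<le> C"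
    using continuous_on_PX_bounded[OF lip_PX_continuous[OF assms(1)]]
      continuous_on_PX_bounded[OF lip_PX_continuous[OF assms(2)]] by blast
  have "(B * M + C * L)-lipschitz_on PX (\<lambda>\<mu>. f \<mu> * g \<mu>)"
  proof (rule lipschitz_onI)
    fix \<mu> \<nu> :: "real^'a" assume \<mu>\<nu>: "\<mu> \<in> PX" "\<nu> \<in> PX"
    have "dist (f \<mu> * g \<mu>) (f \<nu> * g \<nu>) = \<bar>f \<mu> * (g \<mu> - g \<nu>) + (f \<mu> - f \<nu>) * g \<nu>\<bar>"
      by (simp add: dist_real_def algebra_simps)
    also have "\<dots> \<le> \<bar>f \<mu>\<bar> * dist (g \<mu>) (g \<nu>) + dist (f \<mu>) (f \<nu>) * \<bar>g \<nu>\<bar>"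
      by (rule order_trans[OF abs_triangle_ineq]) (simp add: abs_mult dist_real_def)
    also have "\<dots> \<le> B * (M * dist \<mu> \<nu>) + (L * dist \<mu> \<nu>) * C"
      using \<mu>\<nu> B C lipschitz_onD[OF L] lipschitz_onD[OF M] lipschitz_on_nonneg[OF L]
      by (intro add_mono mult_mono) (auto intro: less_imp_le)
    finally show "dist (f \<mu> * g \<mu>) (f \<nu> * g \<nu>) \<le> (B * M + C * L) * dist \<mu> \<nu>"
      by (simp add: algebra_simps)
  qed (use B C lipschitz_on_nonneg[OF L] lipschitz_on_nonneg[OF M] in auto)
  then show ?thesis unfolding lip_PX_def by blast
qed

lemma lip_PX_exp:
  assumes "lip_PX f"
  shows "lip_PX (\<lambda>\<mu>. exp (f \<mu>))"
proof -
  obtain L where L: "L-lipschitz_on PX f" using assms unfolding lip_PX_def by blast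
  obtain B where B: "0 < B" "\<And>\<mu>. \<mu> \<in> PX \<Longrightarrow> \<bar>f \<mu>\<bar> \<le> B"
    using continuous_on_PX_bounded[OF lip_PX_continuous[OF assms(1)]] by blast
  \<comment> \<open>One-sided, from 1 + x \<le> exp x; used in both orders it gives the Lipschitz
    bound.\<close>
  have e: "exp a - exp b \<le> exp B * \<bar>a - b\<bar>" if "a \<le> B" for a b :: real
  proof -
    have "1 + (b - a) \<le> exp (b - a)" by (rule exp_ge_add_one_self)
    then have "exp a * (1 + (b - a)) \<le> exp a * exp (b - a)" by (intro mult_left_mono) auto
    also have "exp a * exp (b - a) = exp b" by (simp add: exp_add[symmetric])
    finally have "exp a - exp b \<le> exp a * (a - b)" by (simp add: algebra_simps)
    also have "\<dots> \<le> exp a * \<bar>a - b\<bar>" by (intro mult_left_mono) auto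
    also have "\<dots> \<le> exp B * \<bar>a - b\<bar>" using that by (intro mult_right_mono) auto
    finally show ?thesis .
  qed
  have "(exp B * L)-lipschitz_on PX (\<lambda>\<mu>. exp (f \<mu>))"
  proof (rule lipschitz_onI)
    fix \<mu> \<nu> :: "real^'a" assume \<mu>\<nu>: "\<mu> \<in> PX" "\<nu> \<in> PX"
    have "dist (exp (f \<mu>)) (exp (f \<nu>)) \<le> exp B * dist (f \<mu>) (f \<nu>)"
      using e[of "f \<mu>" "f \<nu>"] e[of "f \<nu>" "f \<mu>"] B(2)[OF \<mu>\<nu>(1)] B(2)[OF \<mu>\<nu>(2)]
      by (auto simp: dist_real_def abs_le_iff abs_minus_commute)
    also have "\<dots> \<le> exp B * (L * dist \<mu> \<nu>)"
      using lipschitz_onD[OF L \<mu>\<nu>] by (intro mult_left_mono) auto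
    finally show "dist (exp (f \<mu>)) (exp (f \<nu>)) \<le> exp B * L * dist \<mu> \<nu>" by simp
  qed (use lipschitz_on_nonneg[OF L] in auto)
  then show ?thesis unfolding lip_PX_def by blast
qed

lemma lip_PX_C1:
  fixes f :: "real^'x::finite \<Rightarrow> real" and f' :: "real^'x \<Rightarrow> (real^'x) \<Rightarrow>\<^sub>L real"
  assumes d: "\<And>\<mu>. \<mu> \<in> PX \<Longrightarrow> (f has_derivative blinfun_apply (f' \<mu>)) (at \<mu>)"
    and c: "continuous_on PX f'"
  shows "lip_PX f"
proof -
  have "bounded (f' ` PX)"
    by (intro compact_imp_bounded compact_continuous_image c PX_compact)
  then obtain C where C: "0 < C" "\<And>\<mu>. \<mu> \<in> PX \<Longrightarrow> norm (f' \<mu>) \<le> C"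
    unfolding bounded_pos by auto
  have "C-lipschitz_on PX f"
  proof (rule bounded_derivative_imp_lipschitz)
    fix \<mu> :: "real^'x" assume \<mu>: "\<mu> \<in> PX"
    show "(f has_derivative blinfun_apply (f' \<mu>)) (at \<mu> within PX)"
      using d[OF \<mu>] by (rule has_derivative_at_withinI)
    show "onorm (blinfun_apply (f' \<mu>)) \<le> C" using C(2)[OF \<mu>] by (simp add: norm_blinfun.rep_eq)
  qed (use C PX_convex in auto)
  then show ?thesis unfolding lip_PX_def by blast
qed

text \<open>On the simplex \<open>HH K x\<close> is \<open>K x\<close> plus the mean over z of the
  x-derivative of \<open>K z\<close>, so bounded second derivatives of \<open>K\<close> make it
  Lipschitz. The derivative is taken in the full space, as in the definition of \<open>HH\<close>;
  this uses differentiability of \<open>K\<close> on an open neighbourhood.\<close>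

lemma UU_smooth:
  fixes K :: "'x::finite \<Rightarrow> real^'x \<Rightarrow> real"
  assumes "\<exists>S. open S \<and> PX \<subseteq> S \<and> (\<forall>x. C2_on S (K x))"
  shows "lip_PX (HH K x)"
    and "\<mu> \<in> PX \<Longrightarrow> (UU K has_derivative (\<lambda>h. \<Sum>x\<in>UNIV. h $ x * HH K x \<mu>)) (at \<mu>)"
proof -
  obtain S where S: "open S" "PX \<subseteq> S" "\<And>x. C2_on S (K x)" using assms by blast
  obtain K' K'' where K': "\<And>x \<nu>. \<nu> \<in> S \<Longrightarrow> (K x has_derivative blinfun_apply (K' x \<nu>)) (at \<nu>)"
    and K'': "\<And>x \<nu>. \<nu> \<in> S \<Longrightarrow> (K' x has_derivative blinfun_apply (K'' x \<nu>)) (at \<nu>)"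
    and cK'': "\<And>x. continuous_on S (K'' x)"
  proof -
    have "\<forall>x. \<exists>f' f''. (\<forall>\<nu>\<in>S. (K x has_derivative blinfun_apply (f' \<nu>)) (at \<nu>)
              \<and> (f' has_derivative blinfun_apply (f'' \<nu>)) (at \<nu>)) \<and> continuous_on S f''"
      using S(3) unfolding C2_on_def by blast
    then show ?thesis using that by metis
  qed
  have cK': "continuous_on PX (K' x)" for x
  proof -
    have "isCont (K' x) \<nu>" if "\<nu> \<in> PX" for \<nu>
      using K''[of \<nu> x] that S(2) by (auto intro: has_derivative_continuous)
    then show ?thesis by (simp add: continuous_at_imp_continuous_on)
  qed
  have lK: "lip_PX (K x)" for x
    using S(2) by (intro lip_PX_C1[of "K x" "K' x"] K' cK') auto
  have lK': "lip_PX (\<lambda>\<nu>. blinfun_apply (K' z \<nu>) v)" for z v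
  proof -
    have d: "((\<lambda>\<nu>. blinfun_apply (K' z \<nu>) v) has_derivative (\<lambda>h. blinfun_apply (blinfun_apply (K'' z \<nu>) h) v)) (at \<nu>)"
      if "\<nu> \<in> PX" for \<nu>
      using K''[of \<nu> z] that S(2)
      by (intro bounded_linear.has_derivative[OF blinfun.bounded_linear_left]) auto
    have "bounded (K'' z ` PX)"
      using continuous_on_subset[OF cK'' S(2)]
      by (intro compact_imp_bounded compact_continuous_image PX_compact)
    then obtain C where C: "0 < C" "\<And>\<mu>. \<mu> \<in> PX \<Longrightarrow> norm (K'' z \<mu>) \<le> C"
      unfolding bounded_pos by auto
    have "(C * norm v)-lipschitz_on PX (\<lambda>\<nu>. blinfun_apply (K' z \<nu>) v)"
    proof (rule bounded_derivative_imp_lipschitz)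
      fix \<mu> :: "real^'x" assume \<mu>: "\<mu> \<in> PX"
      show "((\<lambda>\<nu>. blinfun_apply (K' z \<nu>) v) has_derivative (\<lambda>h. blinfun_apply (blinfun_apply (K'' z \<mu>) h) v)) (at \<mu> within PX)"
        using d[OF \<mu>] by (rule has_derivative_at_withinI)
      show "onorm (\<lambda>h. blinfun_apply (blinfun_apply (K'' z \<mu>) h) v) \<le> C * norm v"
      proof (rule onorm_bound)
        fix h
        have "norm (blinfun_apply (blinfun_apply (K'' z \<mu>) h) v) \<le> norm (blinfun_apply (K'' z \<mu>) h) * norm v"
          by (rule norm_blinfun)
        also have "\<dots> \<le> (norm (K'' z \<mu>) * norm h) * norm v"
          by (intro mult_right_mono norm_blinfun) auto
        also have "\<dots> \<le> (C * norm h) * norm v"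
          using C(2)[OF \<mu>] by (intro mult_right_mono) auto
        finally show "norm (blinfun_apply (blinfun_apply (K'' z \<mu>) h) v) \<le> C * norm v * norm h"
          by (simp add: ac_simps)
      qed (use C in auto)
    qed (use C PX_convex in auto)
    then show ?thesis unfolding lip_PX_def by blast
  qed
  have dU: "(UU K has_derivative (\<lambda>h. \<Sum>z\<in>UNIV. \<nu> $ z * blinfun_apply (K' z \<nu>) h + h $ z * K z \<nu>)) (at \<nu>)"
    if "\<nu> \<in> PX" for \<nu>
    unfolding UU_def[abs_def] using that S(2)
    by (intro has_derivative_sum has_derivative_mult K' bounded_linear_imp_has_derivative bounded_linear_vec_nth) auto
  have H: "HH K x \<nu> = (\<Sum>z\<in>UNIV. \<nu> $ z * blinfun_apply (K' z \<nu>) (axis x 1) + axis x 1 $ z * K z \<nu>)"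
    if "\<nu> \<in> PX" for x \<nu>
    unfolding HH_def frechet_derivative_at[OF dU[OF that], symmetric] ..
  have "lip_PX (\<lambda>\<nu>. \<Sum>z\<in>UNIV. \<nu> $ z * blinfun_apply (K' z \<nu>) (axis x 1) + axis x 1 $ z * K z \<nu>)"
    by (intro lip_PX_sum lip_PX_add lip_PX_mult lip_PX_nth lip_PX_const lK lK')
  then obtain L where L: "L-lipschitz_on PX (\<lambda>\<nu>. \<Sum>z\<in>UNIV. \<nu> $ z * blinfun_apply (K' z \<nu>) (axis x 1) + axis x 1 $ z * K z \<nu>)"
    unfolding lip_PX_def by blast
  have "L-lipschitz_on PX (HH K x)" by (rule lipschitz_on_transform[OF L]) (rule H)
  then show "lip_PX (HH K x)" unfolding lip_PX_def by blast
  show "(UU K has_derivative (\<lambda>h. \<Sum>x\<in>UNIV. h $ x * HH K x \<mu>)) (at \<mu>)" if \<mu>: "\<mu> \<in> PX"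
  proof (rule has_derivative_eq_rhs[OF dU[OF \<mu>]], rule)
    fix h :: "real^'x"
    let ?D = "\<lambda>h. \<Sum>z\<in>UNIV. \<mu> $ z * blinfun_apply (K' z \<mu>) h + h $ z * K z \<mu>"
    have lin: "linear ?D" using dU[OF \<mu>] has_derivative_linear by blast
    have "?D h = ?D (\<Sum>x\<in>UNIV. h $ x *\<^sub>R axis x 1)"
      using basis_expansion[of h] by (simp add: scalar_mult_eq_scaleR)
    also have "\<dots> = (\<Sum>x\<in>UNIV. h $ x *\<^sub>R ?D (axis x 1))"
      by (simp only: linear_sum[OF lin] linear_scale[OF lin])
    finally show "?D h = (\<Sum>x\<in>UNIV. h $ x * HH K x \<mu>)" using H[OF \<mu>] by simp
  qed
qed

text \<open>The normalisation cancels in the quotient and the square root halves the exponent. This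
  is the shape of the particle rates once N times the increment of \<open>UU\<close> is replaced by
  a difference of \<open>HH\<close>.\<close>

lemma Qlim_off_diag:
  assumes "x \<noteq> y"
  shows "Qlim K A x y \<mu> = exp (- (HH K y \<mu> - HH K x \<mu>) / 2) * A \<mu> x y"
proof -
  have Z: "0 < (\<Sum>z\<in>UNIV. exp (- HH K z \<mu>))" by (intro sum_pos) auto
  have "piK K y \<mu> / piK K x \<mu> = exp (- (HH K y \<mu> - HH K x \<mu>))"
    unfolding piK_def using Z by (simp add: exp_diff[symmetric] field_simps)
  moreover have "sqrt (exp (- (HH K y \<mu> - HH K x \<mu>))) = exp (- (HH K y \<mu> - HH K x \<mu>) / 2)"
    by (rule real_sqrt_unique) (simp_all add: exp_double[symmetric])
  ultimately show ?thesis using assms by (simp add: Qlim_def)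
qed

lemma Qlim_diag: "Qlim K A x x \<mu> = - (\<Sum>z\<in>UNIV - {x}. Qlim K A x z \<mu>)"
  unfolding Qlim_def by simp

text \<open>The drift in generator form, rates times increments of w; in this form it is recognised
  in the first-order part of the particle generator.\<close>

lemma inner_bfield:
  "w \<bullet> bfield K A \<nu> = (\<Sum>a\<in>UNIV. \<nu> $ a * (\<Sum>y\<in>UNIV - {a}. Qlim K A a y \<nu> * (w $ y - w $ a)))"
proof -
  have row: "(\<Sum>x\<in>UNIV. Qlim K A a x \<nu> * w $ x) = (\<Sum>y\<in>UNIV - {a}. Qlim K A a y \<nu> * (w $ y - w $ a))" for a
  proof -
    have "(\<Sum>x\<in>UNIV. Qlim K A a x \<nu> * w $ x)
        = Qlim K A a a \<nu> * w $ a + (\<Sum>x\<in>UNIV - {a}. Qlim K A a x \<nu> * w $ x)"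
      by (rule sum.remove) auto
    then show ?thesis
      by (simp add: Qlim_diag right_diff_distrib sum_subtractf sum_distrib_right)
  qed
  have "w \<bullet> bfield K A \<nu> = (\<Sum>x\<in>UNIV. \<Sum>y\<in>UNIV. w $ x * (\<nu> $ y * Qlim K A y x \<nu>))"
    by (simp add: inner_vec_def bfield_def sum_distrib_left)
  also have "\<dots> = (\<Sum>y\<in>UNIV. \<nu> $ y * (\<Sum>x\<in>UNIV. Qlim K A y x \<nu> * w $ x))"
    by (subst sum.swap) (simp add: sum_distrib_left ac_simps)
  also have "\<dots> = (\<Sum>a\<in>UNIV. \<nu> $ a * (\<Sum>y\<in>UNIV - {a}. Qlim K A a y \<nu> * (w $ y - w $ a)))"
    unfolding row ..
  finally show ?thesis .
qed

text \<open>Composing with the nearest-point projection extends a continuous function on the simplex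
  to a bounded continuous one on the whole space, as weak convergence requires, and a Lipschitz
  field to a Lipschitz field.\<close>

definition proj_PX :: "real^'x::finite \<Rightarrow> real^'x" where
  "proj_PX = closest_point PX"

lemma proj_PX_in [simp]: "proj_PX \<nu> \<in> PX"
  unfolding proj_PX_def by (rule closest_point_in_set[OF PX_closed PX_nonempty])

lemma proj_PX_id: "\<nu> \<in> PX \<Longrightarrow> proj_PX \<nu> = \<nu>"
  unfolding proj_PX_def by (rule closest_point_self)

lemma continuous_on_proj_PX: "continuous_on S proj_PX"
  unfolding proj_PX_def by (rule continuous_on_closest_point[OF PX_convex PX_closed PX_nonempty])

lemma continuous_comp_proj_PX:
  fixes f :: "real^'x::finite \<Rightarrow> 'b::topological_space"
  assumes "continuous_on PX f"
  shows "continuous_on UNIV (\<lambda>\<nu>. f (proj_PX \<nu>))"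
  by (rule continuous_on_compose2[OF assms continuous_on_proj_PX]) auto

section \<open>Mean-field coefficients and the flow of the limit equation\<close>

locale mean_field =
  fixes K :: "'x::finite \<Rightarrow> real^'x \<Rightarrow> real"
    and A :: "real^'x \<Rightarrow> 'x \<Rightarrow> 'x \<Rightarrow> real"
    and AN :: "nat \<Rightarrow> real^'x \<Rightarrow> 'x \<Rightarrow> 'x \<Rightarrow> real"
  assumes K_C2: "\<exists>S. open S \<and> PX \<subseteq> S \<and> (\<forall>x. C2_on S (K x))"
    and A_good: "\<forall>\<mu>\<in>PX. good_mat (A \<mu>)"
    and A_lip: "\<forall>x y. \<exists>L. L-lipschitz_on PX (\<lambda>\<mu>. A \<mu> x y)"
    and AN_good: "\<forall>N. \<forall>\<mu>\<in>PX. good_mat (AN N \<mu>)"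
    and AN_conv: "\<forall>x y. uniform_limit PX (\<lambda>N \<mu>. AN N \<mu> x y) (\<lambda>\<mu>. A \<mu> x y) sequentially"
begin

lemma UU_continuous: "continuous_on PX (UU K)"
  by (intro continuous_at_imp_continuous_on ballI has_derivative_continuous[OF UU_smooth(2)[OF K_C2]])

lemma lip_PX_A: "lip_PX (\<lambda>\<mu>. A \<mu> x y)"
  using A_lip unfolding lip_PX_def by blast

lemma lip_PX_exp_HH: "lip_PX (\<lambda>\<mu>. exp (- (HH K y \<mu> - HH K x \<mu>) / 2))"
proof -
  have "lip_PX (\<lambda>\<mu>. exp ((-1/2) * (HH K y \<mu> - HH K x \<mu>)))"
    by (intro lip_PX_exp lip_PX_mult lip_PX_const lip_PX_diff UU_smooth(1)[OF K_C2])
  moreover have "(-1/2) * r = - r / 2" for r :: real by simp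
  ultimately show ?thesis by (simp only:)
qed

lemma lip_PX_Qlim: "lip_PX (Qlim K A x y)"
proof -
  have off: "lip_PX (Qlim K A x y)" if "x \<noteq> y" for x y
    unfolding Qlim_off_diag[OF that, abs_def]
    by (intro lip_PX_mult lip_PX_exp_HH lip_PX_A)
  show ?thesis
  proof (cases "x = y")
    case True
    have "Qlim K A x y = (\<lambda>\<mu>. - (\<Sum>z\<in>UNIV - {x}. Qlim K A x z \<mu>))"
      unfolding True[symmetric] by (rule ext) (rule Qlim_diag)
    moreover have "lip_PX (\<lambda>\<mu>. - (\<Sum>z\<in>UNIV - {x}. Qlim K A x z \<mu>))"
      by (intro lip_PX_minus lip_PX_sum off) auto
    ultimately show ?thesis by simp
  qed (rule off)
qed

lemma Qlim_bound: "\<exists>B>0. \<forall>x y. \<forall>\<mu>\<in>PX. \<bar>Qlim K A x y \<mu>\<bar> \<le> B"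
proof -
  have "\<forall>x y. \<exists>B>0. \<forall>\<mu>\<in>PX. \<bar>Qlim K A x y \<mu>\<bar> \<le> B"
    using continuous_on_PX_bounded[OF lip_PX_continuous[OF lip_PX_Qlim]] by blast
  then obtain B where B: "\<And>x y. 0 < B x y" "\<And>x y \<mu>. \<mu> \<in> PX \<Longrightarrow> \<bar>Qlim K A x y \<mu>\<bar> \<le> B x y" by metis
  have le: "B x y \<le> (\<Sum>x\<in>UNIV. \<Sum>y\<in>UNIV. B x y)" for x y
  proof -
    have "B x y \<le> (\<Sum>y\<in>UNIV. B x y)" using B(1) by (intro member_le_sum) (auto intro: less_imp_le)
    also have "\<dots> \<le> (\<Sum>x\<in>UNIV. \<Sum>y\<in>UNIV. B x y)"
      using B(1) by (intro member_le_sum) (auto intro: sum_nonneg less_imp_le[OF B(1)])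
    finally show ?thesis .
  qed
  show ?thesis
    by (rule exI[of _ "\<Sum>x\<in>UNIV. \<Sum>y\<in>UNIV. B x y"])
       (use le B in \<open>meson order_less_le_trans order_trans\<close>)
qed

lemma bfield_lipschitz: "\<exists>L. L-lipschitz_on PX (bfield K A)"
proof -
  have "lip_PX (\<lambda>\<nu>. bfield K A \<nu> $ x)" for x
    unfolding bfield_def by (simp, intro lip_PX_sum lip_PX_mult lip_PX_nth lip_PX_Qlim)
  then obtain L where L: "\<And>x. (L x)-lipschitz_on PX (\<lambda>\<nu>. bfield K A \<nu> $ x)"
    unfolding lip_PX_def by metis
  have "(\<Sum>x\<in>UNIV. L x)-lipschitz_on PX (bfield K A)"
  proof (rule lipschitz_onI)
    fix \<mu> \<nu> :: "real^'x" assume \<mu>\<nu>: "\<mu> \<in> PX" "\<nu> \<in> PX"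
    have "dist (bfield K A \<mu>) (bfield K A \<nu>) \<le> (\<Sum>x\<in>UNIV. \<bar>(bfield K A \<mu> - bfield K A \<nu>) $ x\<bar>)"
      unfolding dist_norm by (rule norm_le_l1_cart)
    also have "\<dots> \<le> (\<Sum>x\<in>UNIV. L x * dist \<mu> \<nu>)"
      using lipschitz_onD[OF L \<mu>\<nu>] by (intro sum_mono) (simp add: dist_real_def)
    finally show "dist (bfield K A \<mu>) (bfield K A \<nu>) \<le> (\<Sum>x\<in>UNIV. L x) * dist \<mu> \<nu>"
      by (simp add: sum_distrib_right)
  qed (auto intro!: sum_nonneg lipschitz_on_nonneg[OF L])
  then show ?thesis by blast
qed

text \<open>Pairing with the constant vector: all increments in \<open>inner_bfield\<close>
  vanish.\<close>

lemma bfield_sum: "(\<Sum>x\<in>UNIV. bfield K A \<nu> $ x) = 0"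
  using inner_bfield[of "\<chi> x. 1" K A \<nu>] by (simp add: inner_vec_def)

lemma Qlim_nonneg: "\<mu> \<in> PX \<Longrightarrow> x \<noteq> y \<Longrightarrow> 0 \<le> Qlim K A x y \<mu>"
  using A_good unfolding Qlim_off_diag good_mat_def by simp

text \<open>The inflow into x is nonnegative and the outflow is proportional to the mass at x. This
  is the quantitative reason why the flow does not cross the faces of the simplex.\<close>

lemma bfield_lower: "\<exists>B>0. \<forall>\<nu>\<in>PX. \<forall>x. - B * \<nu> $ x \<le> bfield K A \<nu> $ x"
proof -
  obtain B where B: "0 < B" "\<And>x y \<mu>. \<mu> \<in> PX \<Longrightarrow> \<bar>Qlim K A x y \<mu>\<bar> \<le> B" using Qlim_bound by blast
  have "- B * \<nu> $ x \<le> bfield K A \<nu> $ x" if \<nu>: "\<nu> \<in> PX" for \<nu> x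
  proof -
    have "- B * \<nu> $ x \<le> \<nu> $ x * Qlim K A x x \<nu>"
      using B(2)[OF \<nu>, of x x] PX_nth_bounds(1)[OF \<nu>, of x]
      by (subst mult.commute, intro mult_left_mono) auto
    also have "\<dots> \<le> \<nu> $ x * Qlim K A x x \<nu> + (\<Sum>y\<in>UNIV - {x}. \<nu> $ y * Qlim K A y x \<nu>)"
    proof -
      have "0 \<le> (\<Sum>y\<in>UNIV - {x}. \<nu> $ y * Qlim K A y x \<nu>)"
        by (intro sum_nonneg mult_nonneg_nonneg Qlim_nonneg[OF \<nu>] PX_nth_bounds(1)[OF \<nu>]) auto
      then show ?thesis by simp
    qed
    also have "\<dots> = bfield K A \<nu> $ x"
      unfolding bfield_def by (simp add: sum.remove[of UNIV x])
    finally show ?thesis .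
  qed
  then show ?thesis using B(1) by blast
qed

text \<open>The field is controlled only on the simplex, while \<open>lipschitz_flow_exists\<close>
  asks for a Lipschitz field on the whole space; it is extended through the projection in a way that
  keeps the simplex invariant.\<close>

lemma flow_exists:
  "\<exists>\<Phi> :: real \<Rightarrow> real^'x \<Rightarrow> real^'x. (\<forall>\<nu>. \<Phi> 0 \<nu> = \<nu>)
    \<and> continuous_on ({0..} \<times> UNIV) (\<lambda>(t, \<nu>). \<Phi> t \<nu>)
    \<and> (\<forall>\<nu>\<in>PX. \<forall>t\<ge>0. \<Phi> t \<nu> \<in> PX
        \<and> ((\<lambda>t. \<Phi> t \<nu>) has_vector_derivative bfield K A (\<Phi> t \<nu>)) (at t within {0..}))"
proof -
  obtain L where L: "L-lipschitz_on PX (bfield K A)" using bfield_lipschitz by blast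
  obtain B where B: "0 < B" "\<And>\<nu> x. \<nu> \<in> PX \<Longrightarrow> - B * \<nu> $ x \<le> bfield K A \<nu> $ x" using bfield_lower by blast
  define p :: "real^'x \<Rightarrow> real^'x" where "p = proj_PX"
  have p: "p \<nu> \<in> PX" for \<nu> unfolding p_def by (rule proj_PX_in)
  have p_id: "p \<nu> = \<nu>" if "\<nu> \<in> PX" for \<nu> unfolding p_def using that by (rule proj_PX_id)
  have lp: "1-lipschitz_on UNIV p"
    unfolding p_def proj_PX_def using closest_point_lipschitz[OF PX_convex PX_closed PX_nonempty]
    by (intro lipschitz_onI) auto
  text \<open>The extra term \<open>B (p \<nu> - \<nu>)\<close> vanishes on the simplex and, by the choice of \<open>B\<close>,
    makes the nonnegativity of the coordinates a Gronwall estimate.\<close>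
  define F where "F \<nu> = bfield K A (p \<nu>) + B *\<^sub>R (p \<nu> - \<nu>)" for \<nu>
  have "(L * 1 + B * (1 + 1))-lipschitz_on UNIV F"
    unfolding F_def using B(1)
    by (intro lipschitz_on_add lipschitz_on_compose2[OF lp] lipschitz_on_subset[OF L]
          lipschitz_on_cmult_nonneg lipschitz_on_diff lp lipschitz_on_id) (auto simp: p)
  then obtain \<Phi> :: "real \<Rightarrow> real^'x \<Rightarrow> real^'x" where \<Phi>0: "\<And>\<nu>. \<Phi> 0 \<nu> = \<nu>"
    and \<Phi>d: "\<And>\<nu> t. 0 \<le> t \<Longrightarrow> ((\<lambda>t. \<Phi> t \<nu>) has_vector_derivative F (\<Phi> t \<nu>)) (at t within {0..})"
    and \<Phi>c: "continuous_on ({0..} \<times> UNIV) (\<lambda>(t, \<nu>). \<Phi> t \<nu>)"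
    using lipschitz_flow_exists by blast
  have comp: "((\<lambda>t. \<Phi> t \<nu> $ x) has_real_derivative F (\<Phi> t \<nu>) $ x) (at t within {0..})"
    if "0 \<le> t" for t \<nu> x
    unfolding has_real_derivative_iff_has_vector_derivative
    by (rule bounded_linear.has_vector_derivative[OF bounded_linear_vec_nth \<Phi>d[OF that]])
  \<comment> \<open>The choice of \<open>B\<close> bounds the drift at \<open>p \<nu>\<close> below
    by \<open>- B * p \<nu> $ x\<close>; the added term replaces the projected coordinate by the
    actual one.\<close>
  have Fx: "- F \<nu> $ x \<le> - B * - \<nu> $ x + 0" for \<nu> x
    using B(2)[OF p, of \<nu> x] by (simp add: F_def right_diff_distrib)
  have inv: "\<Phi> t \<nu> \<in> PX" if \<nu>: "\<nu> \<in> PX" and t: "0 \<le> t" for t \<nu>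
  proof -
    have "- (\<Phi> t \<nu> $ x) \<le> (- (\<Phi> 0 \<nu> $ x) + 0 / - B) * exp (- B * t)" for x
      using B(1) by (intro gronwall_differential[OF DERIV_minus[OF comp] Fx _ _ t]) auto
    moreover have "0 \<le> \<Phi> 0 \<nu> $ x * exp (- B * t)" for x
      using PX_nth_bounds(1)[OF \<nu>] by (simp add: \<Phi>0)
    ultimately have nonneg: "0 \<le> \<Phi> t \<nu> $ x" for x by (smt (verit) divide_eq_0_iff mult_minus_left)
    \<comment> \<open>The defect of total mass solves s' = - B s with s 0 = 0; Gronwall for s and
      for - s forces it to vanish.\<close>
    define s where "s r = (\<Sum>x\<in>UNIV. \<Phi> r \<nu> $ x) - 1" for r
    have s0: "s 0 = 0" using \<nu> by (simp add: s_def \<Phi>0 PX_def)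
    have sd: "(s has_real_derivative - B * s r) (at r within {0..})" if "0 \<le> r" for r
    proof -
      have "(\<Sum>x\<in>UNIV. F (\<Phi> r \<nu>) $ x) = B * ((\<Sum>x\<in>UNIV. p (\<Phi> r \<nu>) $ x) - (\<Sum>x\<in>UNIV. \<Phi> r \<nu> $ x))"
        by (simp add: F_def sum.distrib bfield_sum sum_distrib_left[symmetric] sum_subtractf)
      also have "\<dots> = - B * s r" using p[of "\<Phi> r \<nu>"] by (simp add: s_def PX_def algebra_simps)
      finally show ?thesis unfolding s_def
        by (auto intro!: derivative_eq_intros comp[OF that])
    qed
    have "s t \<le> (s 0 + 0 / - B) * exp (- B * t)"
      using B(1) by (intro gronwall_differential[OF sd _ _ _ t]) auto
    moreover have "- s t \<le> (- s 0 + 0 / - B) * exp (- B * t)"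
      using B(1) by (intro gronwall_differential[OF DERIV_minus[OF sd] _ _ _ t]) auto
    ultimately have "s t = 0" using s0 by simp
    then show ?thesis using nonneg by (simp add: PX_def s_def)
  qed
  have "F \<nu> = bfield K A \<nu>" if "\<nu> \<in> PX" for \<nu> by (simp add: F_def p_id[OF that])
  then have "((\<lambda>t. \<Phi> t \<nu>) has_vector_derivative bfield K A (\<Phi> t \<nu>)) (at t within {0..})"
    if "\<nu> \<in> PX" "0 \<le> t" for \<nu> t
    using \<Phi>d[OF that(2), of \<nu>] inv[OF that] by simp
  then show ?thesis using \<Phi>0 \<Phi>c inv by (intro exI[of _ \<Phi>]) auto
qed

end

subsection \<open>The particle generator\<close>

lemma sum_single_site_changes:
  fixes g :: "(nat \<Rightarrow> 'x::finite) \<Rightarrow> real"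
  assumes c: "c \<in> configs N" and i: "i < N"
  shows "(\<Sum>c'\<in>configs N. if c' i \<noteq> c i \<and> c' = c(i := c' i) then g c' else 0)
    = (\<Sum>y\<in>UNIV - {c i}. g (c(i := y)))"
proof -
  have "(\<Sum>c'\<in>configs N. if c' i \<noteq> c i \<and> c' = c(i := c' i) then g c' else 0)
     = (\<Sum>c'\<in>{c' \<in> configs N. c' i \<noteq> c i \<and> c' = c(i := c' i)}. g c')"
    by (rule sum.inter_filter[symmetric]) simp
  also have "{c' \<in> configs N. c' i \<noteq> c i \<and> c' = c(i := c' i)} = (\<lambda>y. c(i := y)) ` (UNIV - {c i})"
  proof (intro equalityI subsetI)
    fix c' assume "c' \<in> {c' \<in> configs N. c' i \<noteq> c i \<and> c' = c(i := c' i)}"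
    then show "c' \<in> (\<lambda>y. c(i := y)) ` (UNIV - {c i})" by (intro image_eqI[of _ _ "c' i"]) auto
  qed (use configs_upd[OF c i] in auto)
  also have "(\<Sum>c'\<in>(\<lambda>y. c(i := y)) ` (UNIV - {c i}). g c') = (\<Sum>y\<in>UNIV - {c i}. g (c(i := y)))"
    by (subst sum.reindex) (auto intro!: inj_onI dest: fun_upd_eqD)
  finally show ?thesis .
qed

lemma QBoff_right_sum:
  assumes "cx \<in> configs N"
  shows "(\<Sum>cy\<in>configs N. QBoff K AN N cx cy * f cy)
    = (\<Sum>i<N. \<Sum>y\<in>UNIV - {cx i}. QsN K AN N (cx i) y (LN N cx) * f (cx(i := y)))"
proof -
  have "(\<Sum>cy\<in>configs N. QBoff K AN N cx cy * f cy)
    = (\<Sum>cy\<in>configs N. \<Sum>i<N. if cy i \<noteq> cx i \<and> cy = cx(i := cy i)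
          then QsN K AN N (cx i) (cy i) (LN N cx) * f cy else 0)"
    unfolding QBoff_def sum_distrib_right by (intro sum.cong) auto
  also have "\<dots> = (\<Sum>i<N. \<Sum>cy\<in>configs N. if cy i \<noteq> cx i \<and> cy = cx(i := cy i)
          then QsN K AN N (cx i) (cy i) (LN N cx) * f cy else 0)"
    by (rule sum.swap)
  also have "\<dots> = (\<Sum>i<N. \<Sum>y\<in>UNIV - {cx i}. QsN K AN N (cx i) y (LN N cx) * f (cx(i := y)))"
    using sum_single_site_changes[OF assms, where g = "\<lambda>cy. QsN K AN N (cx i) (cy i) (LN N cx) * f cy" and i = i for i]
    by (intro sum.cong) auto
  finally show ?thesis .
qed

lemma QBoff_left_sum:
  assumes "cy \<in> configs N"
  shows "(\<Sum>cx\<in>configs N. v cx * QBoff K AN N cx cy)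
    = (\<Sum>i<N. \<Sum>z\<in>UNIV - {cy i}. v (cy(i := z)) * QsN K AN N z (cy i) (LN N (cy(i := z))))"
proof -
  \<comment> \<open>Being a change at site i is a symmetric relation, so column sums run over the
    same modifications as row sums.\<close>
  have sym: "(cy i \<noteq> cx i \<and> cy = cx(i := cy i)) = (cx i \<noteq> cy i \<and> cx = cy(i := cx i))" for cx i
    by (metis fun_upd_triv fun_upd_upd)
  have "(\<Sum>cx\<in>configs N. v cx * QBoff K AN N cx cy)
    = (\<Sum>cx\<in>configs N. \<Sum>i<N. if cx i \<noteq> cy i \<and> cx = cy(i := cx i)
          then v cx * QsN K AN N (cx i) (cy i) (LN N cx) else 0)"
    unfolding QBoff_def sum_distrib_left sym by (intro sum.cong) auto
  also have "\<dots> = (\<Sum>i<N. \<Sum>cx\<in>configs N. if cx i \<noteq> cy i \<and> cx = cy(i := cx i)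
          then v cx * QsN K AN N (cx i) (cy i) (LN N cx) else 0)"
    by (rule sum.swap)
  also have "\<dots> = (\<Sum>i<N. \<Sum>z\<in>UNIV - {cy i}. v (cy(i := z)) * QsN K AN N z (cy i) (LN N (cy(i := z))))"
    using sum_single_site_changes[OF assms, where g = "\<lambda>cx. v cx * QsN K AN N (cx i) (cy i) (LN N cx)" and i = i for i]
    by (intro sum.cong) auto
  finally show ?thesis .
qed

lemma QBoff_self: "QBoff K AN N cx cx = 0"
  unfolding QBoff_def by simp

lemma QB_self:
  assumes "cx \<in> configs N"
  shows "QB K AN N cx cx = - (\<Sum>i<N. \<Sum>y\<in>UNIV - {cx i}. QsN K AN N (cx i) y (LN N cx))"
proof -
  have "(\<Sum>cz\<in>configs N - {cx}. QBoff K AN N cx cz) = (\<Sum>cz\<in>configs N. QBoff K AN N cx cz)"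
    using assms by (simp add: sum.remove[of "configs N" cx] QBoff_self)
  then show ?thesis using QBoff_right_sum[OF assms, of K AN "\<lambda>_. 1"] by (simp add: QB_def)
qed

text \<open>The generator on observables: the diagonal entry is minus the total jump rate, which
  turns values into increments.\<close>

lemma QB_right_sum:
  assumes cx: "cx \<in> configs N"
  shows "(\<Sum>cy\<in>configs N. QB K AN N cx cy * f cy)
    = (\<Sum>i<N. \<Sum>y\<in>UNIV - {cx i}. QsN K AN N (cx i) y (LN N cx) * (f (cx(i := y)) - f cx))"
proof -
  have "(\<Sum>cy\<in>configs N. QB K AN N cx cy * f cy)
     = (\<Sum>cy\<in>configs N. QBoff K AN N cx cy * f cy + (if cx = cy then QB K AN N cx cx * f cx else 0))"
    by (intro sum.cong) (auto simp: QB_def QBoff_self)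
  also have "\<dots> = (\<Sum>cy\<in>configs N. QBoff K AN N cx cy * f cy) + QB K AN N cx cx * f cx"
    using cx by (simp add: sum.distrib)
  finally show ?thesis
    unfolding QBoff_right_sum[OF cx] QB_self[OF cx]
    by (simp add: right_diff_distrib sum_subtractf sum_distrib_right)
qed

text \<open>The dual side, the master equation: gain by jumps into \<open>cy\<close> minus loss by
  jumps out of it.\<close>

lemma QB_left_sum:
  assumes cy: "cy \<in> configs N"
  shows "(\<Sum>cx\<in>configs N. v cx * QB K AN N cx cy)
    = (\<Sum>i<N. \<Sum>z\<in>UNIV - {cy i}. v (cy(i := z)) * QsN K AN N z (cy i) (LN N (cy(i := z)))
          - v cy * QsN K AN N (cy i) z (LN N cy))"
proof -
  have "(\<Sum>cx\<in>configs N. v cx * QB K AN N cx cy)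
     = (\<Sum>cx\<in>configs N. v cx * QBoff K AN N cx cy + (if cx = cy then v cy * QB K AN N cy cy else 0))"
    by (intro sum.cong) (auto simp: QB_def QBoff_self)
  also have "\<dots> = (\<Sum>cx\<in>configs N. v cx * QBoff K AN N cx cy) + v cy * QB K AN N cy cy"
    using cy by (simp add: sum.distrib)
  finally show ?thesis
    unfolding QBoff_left_sum[OF cy] QB_self[OF cy]
    by (simp add: sum_subtractf sum_distrib_left)
qed

lemma type_function_factors:
  fixes v :: "(nat \<Rightarrow> 'x::finite) \<Rightarrow> 'b"
  assumes "\<And>c c'. c \<in> configs N \<Longrightarrow> c' \<in> configs N \<Longrightarrow> LN N c = LN N c' \<Longrightarrow> v c = v c'"
  shows "\<exists>w. \<forall>c\<in>configs N. v c = w (LN N c)"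
proof (intro exI ballI)
  fix c :: "nat \<Rightarrow> 'x" assume c: "c \<in> configs N"
  let ?P = "\<lambda>c'. c' \<in> configs N \<and> LN N c' = LN N c"
  have "?P (SOME c'. ?P c')" using c by (intro someI[of ?P c]) auto
  then show "v c = (\<lambda>\<mu>. v (SOME c'. c' \<in> configs N \<and> LN N c' = \<mu>)) (LN N c)"
    using assms[OF c] by auto
qed

text \<open>Under a jump an observable of the type changes by an amount that depends on the type and
  on the old and new value at the site. Summation over sites leaves a function of the type.\<close>

lemma QB_right_type_function:
  assumes v: "\<And>c c'. c \<in> configs N \<Longrightarrow> c' \<in> configs N \<Longrightarrow> LN N c = LN N c' \<Longrightarrow> v c = v c'"
    and "c \<in> configs N" "c' \<in> configs N" "LN N c = LN N c'" "0 < N"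
  shows "(\<Sum>z\<in>configs N. QB K AN N c z * v z) = (\<Sum>z\<in>configs N. QB K AN N c' z * v z)"
proof -
  have "\<exists>w. \<forall>c\<in>configs N. v c = w (LN N c)" by (rule type_function_factors) (rule v)
  then obtain w where w: "\<And>c. c \<in> configs N \<Longrightarrow> v c = w (LN N c)" by blast
  define F where "F \<mu> a = (\<Sum>y\<in>UNIV - {a}. QsN K AN N a y \<mu> *
      (w (\<mu> + (1 / real N) *\<^sub>R (axis y 1 - axis a 1)) - w \<mu>))" for \<mu> a
  have "(\<Sum>z\<in>configs N. QB K AN N c z * v z) = real N * (\<Sum>a\<in>UNIV. LN N c $ a * F (LN N c) a)"
    if c: "c \<in> configs N" for c
  proof -
    have "(\<Sum>z\<in>configs N. QB K AN N c z * v z) = (\<Sum>i<N. F (LN N c) (c i))"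
      unfolding QB_right_sum[OF c] F_def
      using w[OF c] w[OF configs_upd[OF c]] by (intro sum.cong) (auto simp: LN_upd)
    then show ?thesis using sum_sites_eq_LN[OF \<open>0 < N\<close>] by metis
  qed
  then show ?thesis using assms(2-4) by simp
qed

text \<open>The gain term also qualifies: the type before the jump, \<open>\<mu>'\<close> in the
  proof, is determined by the present type and by the present and former value at the site.\<close>

lemma QB_left_type_function:
  assumes v: "\<And>c c'. c \<in> configs N \<Longrightarrow> c' \<in> configs N \<Longrightarrow> LN N c = LN N c' \<Longrightarrow> v c = v c'"
    and "c \<in> configs N" "c' \<in> configs N" "LN N c = LN N c'" "0 < N"
  shows "(\<Sum>z\<in>configs N. v z * QB K AN N z c) = (\<Sum>z\<in>configs N. v z * QB K AN N z c')"
proof -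
  have "\<exists>w. \<forall>c\<in>configs N. v c = w (LN N c)" by (rule type_function_factors) (rule v)
  then obtain w where w: "\<And>c. c \<in> configs N \<Longrightarrow> v c = w (LN N c)" by blast
  define F where "F \<mu> a = (\<Sum>z\<in>UNIV - {a}. (let \<mu>' = \<mu> + (1 / real N) *\<^sub>R (axis z 1 - axis a 1)
      in w \<mu>' * QsN K AN N z a \<mu>') - w \<mu> * QsN K AN N a z \<mu>)" for \<mu> a
  have "(\<Sum>z\<in>configs N. v z * QB K AN N z c) = real N * (\<Sum>a\<in>UNIV. LN N c $ a * F (LN N c) a)"
    if c: "c \<in> configs N" for c
  proof -
    have "(\<Sum>z\<in>configs N. v z * QB K AN N z c) = (\<Sum>i<N. F (LN N c) (c i))"
      unfolding QB_left_sum[OF c] F_def Let_def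
      using w[OF c] w[OF configs_upd[OF c]] by (intro sum.cong) (auto simp: LN_upd)
    then show ?thesis using sum_sites_eq_LN[OF \<open>0 < N\<close>] by metis
  qed
  then show ?thesis using assms(2-4) by simp
qed

section \<open>Consistency of the rates and the mean-square estimate\<close>

context mean_field
begin

lemma generator:
  assumes "0 < N"
  shows "finite_generator (configs N) (QB K AN N)"
proof
  fix cx cy :: "nat \<Rightarrow> 'x" assume "cx \<noteq> cy"
  have "0 \<le> AN N (LN N cx) x y" for x y
    using AN_good LN_in_PX[OF assms] unfolding good_mat_def by blast
  then show "0 \<le> QB K AN N cx cy" using \<open>cx \<noteq> cy\<close>
    unfolding QB_def QBoff_def QsN_def by (auto intro!: sum_nonneg)
next
  fix cx :: "nat \<Rightarrow> 'x" assume "cx \<in> configs N"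
  then show "(\<Sum>cy\<in>configs N. QB K AN N cx cy) = 0"
    using QB_right_sum[of cx N K AN "\<lambda>_. 1"] by simp
qed simp

text \<open>Mean value theorem on the segment between the types before and after the jump, which
  lies in the simplex by convexity. The jump direction has norm at most 2, hence the distance 2 /
  N.\<close>

lemma UU_difference_quotient:
  assumes N: "0 < N" and i: "i < N"
  shows "\<exists>\<xi>\<in>PX. dist \<xi> (LN N c) \<le> 2 / real N
    \<and> real N * (UU K (LN N c + (1 / real N) *\<^sub>R (axis y 1 - axis (c i) 1)) - UU K (LN N c))
      = HH K y \<xi> - HH K (c i) \<xi>"
proof -
  define \<mu> where "\<mu> = LN N c"
  define d :: "real^'x" where "d = axis y 1 - axis (c i) 1"
  have \<mu>: "\<mu> \<in> PX" unfolding \<mu>_def by (rule LN_in_PX[OF N])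
  have \<mu>': "\<mu> + (1 / real N) *\<^sub>R d \<in> PX"
    unfolding \<mu>_def d_def LN_upd[OF i, symmetric] by (rule LN_in_PX[OF N])
  have seg: "\<mu> + r *\<^sub>R d \<in> PX" if "r \<in> {0..1 / real N}" for r
  proof -
    have "(1 - real N * r) *\<^sub>R \<mu> + (real N * r) *\<^sub>R (\<mu> + (1 / real N) *\<^sub>R d) \<in> PX"
      using that N by (intro convexD_alt[OF PX_convex \<mu> \<mu>']) (auto simp: field_simps)
    moreover have "(1 - real N * r) *\<^sub>R \<mu> + (real N * r) *\<^sub>R (\<mu> + (1 / real N) *\<^sub>R d) = \<mu> + r *\<^sub>R d"
      using N by (simp add: algebra_simps)
    ultimately show ?thesis by simp
  qed
  have dH: "(\<Sum>x\<in>UNIV. d $ x * f x) = f y - f (c i)" for f :: "'x \<Rightarrow> real"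
    by (simp add: d_def axis_def left_diff_distrib sum_subtractf if_distrib[of "\<lambda>a. a * _"] cong: if_cong)
  have "\<exists>r\<in>{0<..<1 / real N}. UU K (\<mu> + (1 / real N) *\<^sub>R d) - UU K (\<mu> + 0 *\<^sub>R d)
     = (1 / real N - 0) * (HH K y (\<mu> + r *\<^sub>R d) - HH K (c i) (\<mu> + r *\<^sub>R d))"
  proof (rule mvt_simple[of 0 "1 / real N" "\<lambda>r. UU K (\<mu> + r *\<^sub>R d)"
        "\<lambda>r h. h * (HH K y (\<mu> + r *\<^sub>R d) - HH K (c i) (\<mu> + r *\<^sub>R d))"])
    fix r assume "0 \<le> r" "r \<le> 1 / real N"
    then have r: "r \<in> {0..1 / real N}" by simp
    let ?\<xi> = "\<mu> + r *\<^sub>R d"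
    have "((\<lambda>r. \<mu> + r *\<^sub>R d) has_derivative (\<lambda>h. h *\<^sub>R d)) (at r within {0..1 / real N})"
      by (auto intro!: derivative_eq_intros)
    then have "((\<lambda>r. UU K (\<mu> + r *\<^sub>R d)) has_derivative (\<lambda>h. \<Sum>x\<in>UNIV. (h *\<^sub>R d) $ x * HH K x ?\<xi>)) (at r within {0..1 / real N})"
      by (rule has_derivative_compose[where f = "\<lambda>r. \<mu> + r *\<^sub>R d", OF _ UU_smooth(2)[OF K_C2 seg[OF r]]])
    moreover have "(\<lambda>h. \<Sum>x\<in>UNIV. (h *\<^sub>R d) $ x * HH K x ?\<xi>) = (\<lambda>h. h * (HH K y ?\<xi> - HH K (c i) ?\<xi>))"
      by (simp add: mult.assoc sum_distrib_left[symmetric] dH)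
    ultimately show "((\<lambda>r. UU K (\<mu> + r *\<^sub>R d)) has_derivative
        (\<lambda>h. h * (HH K y (\<mu> + r *\<^sub>R d) - HH K (c i) (\<mu> + r *\<^sub>R d)))) (at r within {0..1 / real N})"
      by simp
  qed (use N in auto)
  then obtain r where r: "0 < r" "r < 1 / real N"
    "UU K (\<mu> + (1 / real N) *\<^sub>R d) - UU K \<mu> = (1 / real N) * (HH K y (\<mu> + r *\<^sub>R d) - HH K (c i) (\<mu> + r *\<^sub>R d))"
    by auto
  have "norm d \<le> norm (axis y 1 :: real^'x) + norm (axis (c i) 1 :: real^'x)"
    unfolding d_def by (rule norm_triangle_ineq4)
  then have "r * norm d \<le> (1 / real N) * 2" using r by (intro mult_mono) auto
  then have "dist (\<mu> + r *\<^sub>R d) \<mu> \<le> 2 / real N" using r by (simp add: dist_norm)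
  moreover have "real N * (UU K (\<mu> + (1 / real N) *\<^sub>R d) - UU K \<mu>) = HH K y (\<mu> + r *\<^sub>R d) - HH K (c i) (\<mu> + r *\<^sub>R d)"
    unfolding r(3) using N by simp
  ultimately show ?thesis using seg[of r] r unfolding \<mu>_def d_def by (intro bexI[of _ "LN N c + r *\<^sub>R (axis y 1 - axis (c i) 1)"]) auto
qed

text \<open>Uniform over configurations and their sites rather than over all points of the simplex:
  a jump is sure to end inside the simplex, where \<open>UU\<close> is controlled, only if a
  particle sits at the departing state.\<close>

lemma rates_consistent:
  assumes "0 < e"
  shows "\<forall>\<^sub>F N in sequentially. \<forall>c. \<forall>i<N. \<forall>y. y \<noteq> c i \<longrightarrow>
    \<bar>QsN K AN N (c i) y (LN N c) - Qlim K A (c i) y (LN N c)\<bar> \<le> e"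
proof -
  have "\<forall>\<^sub>F N in sequentially. \<forall>c. \<forall>i<N. c i = a \<longrightarrow> y \<noteq> a \<longrightarrow>
    \<bar>QsN K AN N (c i) y (LN N c) - Qlim K A (c i) y (LN N c)\<bar> \<le> e" for a y
  proof -
    define w where "w \<mu> = exp (- (HH K y \<mu> - HH K a \<mu>) / 2)" for \<mu>
    have lw: "lip_PX w" unfolding w_def by (rule lip_PX_exp_HH)
    obtain L where L: "L-lipschitz_on PX w" using lw unfolding lip_PX_def by blast
    obtain E where E: "0 < E" "\<And>\<mu>. \<mu> \<in> PX \<Longrightarrow> \<bar>w \<mu>\<bar> \<le> E"
      using continuous_on_PX_bounded[OF lip_PX_continuous[OF lw]] by blast
    obtain B where B: "0 < B" "\<And>\<mu>. \<mu> \<in> PX \<Longrightarrow> \<bar>A \<mu> a y\<bar> \<le> B"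
      using continuous_on_PX_bounded[OF lip_PX_continuous[OF lip_PX_A]] by blast
    have L0: "0 \<le> L" using L by (rule lipschitz_on_nonneg)
    \<comment> \<open>Half of \<open>e\<close> pays for replacing \<open>AN\<close> by
      \<open>A\<close>, weighted by the bound \<open>E\<close> of \<open>w\<close>; the other half
      for evaluating \<open>w\<close> at distance up to 2 / N from the empirical measure, weighted
      by \<open>L\<close> and by the bound \<open>B\<close> of \<open>A\<close>.\<close>
    have "\<forall>\<^sub>F N in sequentially. \<forall>\<mu>\<in>PX. dist (AN N \<mu> a y) (A \<mu> a y) < e / (2 * E)"
      using AN_conv assms E(1) by (intro uniform_limitD) auto
    moreover have "\<forall>\<^sub>F N in sequentially. (L * 2 * B) / real N < e / 2"
      using assms by (intro order_tendstoD(2)[OF lim_const_over_n]) auto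
    ultimately show ?thesis
    proof eventually_elim
      case (elim N)
      show ?case
      proof (intro allI impI)
        fix c :: "nat \<Rightarrow> 'x" and i assume i: "i < N" and ci: "c i = a" and ya: "y \<noteq> a"
        have N: "0 < N" using i by simp
        define \<mu> where "\<mu> = LN N c"
        have \<mu>: "\<mu> \<in> PX" unfolding \<mu>_def by (rule LN_in_PX[OF N])
        obtain \<xi> where \<xi>: "\<xi> \<in> PX" "dist \<xi> \<mu> \<le> 2 / real N"
          "real N * (UU K (\<mu> + (1 / real N) *\<^sub>R (axis y 1 - axis a 1)) - UU K \<mu>) = HH K y \<xi> - HH K a \<xi>"
          using UU_difference_quotient[OF N i, of c y] unfolding \<mu>_def ci by blast
        have q: "QsN K AN N a y \<mu> = w \<xi> * AN N \<mu> a y"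
          unfolding QsN_def w_def \<xi>(3)[symmetric] by simp
        have Q: "Qlim K A a y \<mu> = w \<mu> * A \<mu> a y"
          unfolding w_def by (rule Qlim_off_diag) (use ya in auto)
        have "\<bar>QsN K AN N a y \<mu> - Qlim K A a y \<mu>\<bar>
           = \<bar>w \<xi> * (AN N \<mu> a y - A \<mu> a y) + (w \<xi> - w \<mu>) * A \<mu> a y\<bar>"
          unfolding q Q by (simp add: algebra_simps)
        also have "\<dots> \<le> \<bar>w \<xi>\<bar> * \<bar>AN N \<mu> a y - A \<mu> a y\<bar> + \<bar>w \<xi> - w \<mu>\<bar> * \<bar>A \<mu> a y\<bar>"
          by (rule order_trans[OF abs_triangle_ineq]) (simp add: abs_mult)
        also have "\<dots> \<le> E * (e / (2 * E)) + (L * (2 / real N)) * B"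
        proof (intro add_mono mult_mono)
          show "\<bar>AN N \<mu> a y - A \<mu> a y\<bar> \<le> e / (2 * E)" using elim(1) \<mu> by (auto simp: dist_real_def less_imp_le)
          have "\<bar>w \<xi> - w \<mu>\<bar> \<le> L * dist \<xi> \<mu>" using lipschitz_onD[OF L \<xi>(1) \<mu>] by (simp add: dist_real_def)
          also have "\<dots> \<le> L * (2 / real N)" using \<xi>(2) L0 by (rule mult_left_mono)
          finally show "\<bar>w \<xi> - w \<mu>\<bar> \<le> L * (2 / real N)" .
        qed (use E B \<xi> \<mu> L0 in auto)
        also have "\<dots> \<le> e" using elim(2) E(1) by simp
        finally show "\<bar>QsN K AN N (c i) y (LN N c) - Qlim K A (c i) y (LN N c)\<bar> \<le> e"
          unfolding ci \<mu>_def .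
      qed
    qed
  qed
  then have "\<forall>\<^sub>F N in sequentially. \<forall>a y. \<forall>c. \<forall>i<N. c i = a \<longrightarrow> y \<noteq> a \<longrightarrow>
    \<bar>QsN K AN N (c i) y (LN N c) - Qlim K A (c i) y (LN N c)\<bar> \<le> e"
    by (intro eventually_all_finite)
  then show ?thesis by (rule eventually_mono) blast
qed

text \<open>With deviation u and jump direction d, the square changes by 2 u.d / N + |d|^2 / N^2,
  where |d|^2 = 2. Coordinates of u differ by at most 2, so replacing a rate costs 4 e; the
  quadratic term costs 2 (B + e) / N; each site has at most CARD('x) targets, and the sum over N
  sites absorbs the remaining 1 / N. What is left is the drift, by
  \<open>inner_bfield\<close>.\<close>

lemma generator_square_distance:
  assumes N: "0 < N" and cx: "cx \<in> configs N" and v: "v \<in> PX"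
    and e: "\<And>i y. i < N \<Longrightarrow> y \<noteq> cx i \<Longrightarrow> \<bar>QsN K AN N (cx i) y (LN N cx) - Qlim K A (cx i) y (LN N cx)\<bar> \<le> e"
    and B: "\<And>x y. \<bar>Qlim K A x y (LN N cx)\<bar> \<le> B" and "0 \<le> e"
  shows "(\<Sum>cy\<in>configs N. QB K AN N cx cy * (norm (LN N cy - v))\<^sup>2)
    \<le> 2 * ((LN N cx - v) \<bullet> bfield K A (LN N cx)) + CARD('x) * (4 * e + 2 * (B + e) / real N)"
proof -
  define \<mu> where "\<mu> = LN N cx"
  define u where "u = \<mu> - v"
  define \<eta> where "\<eta> = 4 * e + 2 * (B + e) / real N"
  have \<mu>: "\<mu> \<in> PX" unfolding \<mu>_def by (rule LN_in_PX[OF N])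
  have "\<bar>Qlim K A a a \<mu>\<bar> \<le> B" for a unfolding \<mu>_def by (rule B)
  then have "0 \<le> B" by (meson abs_ge_zero order_trans)
  then have \<eta>0: "0 \<le> \<eta>" unfolding \<eta>_def using \<open>0 \<le> e\<close> by simp
  have ub: "\<bar>u $ y - u $ a\<bar> \<le> 2" for y a
    using PX_nth_bounds[OF \<mu>, of y] PX_nth_bounds[OF \<mu>, of a] PX_nth_bounds[OF v, of y] PX_nth_bounds[OF v, of a]
    unfolding u_def by (simp add: abs_le_iff)
  have sq: "(norm (LN N (cx(i := y)) - v))\<^sup>2 - (norm (\<mu> - v))\<^sup>2
      = (2 * (u $ y - u $ (cx i)) + 2 / real N) / real N" if i: "i < N" and y: "y \<noteq> cx i" for i y
  proof -
    define d :: "real^'x" where "d = axis y 1 - axis (cx i) 1"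
    have "LN N (cx(i := y)) - v = u + (1 / real N) *\<^sub>R d"
      unfolding LN_upd[OF i] u_def \<mu>_def d_def by simp
    then have "(norm (LN N (cx(i := y)) - v))\<^sup>2 = (norm u)\<^sup>2 + 2 * (u \<bullet> d) / real N + (d \<bullet> d) / (real N)\<^sup>2"
      unfolding power2_norm_eq_inner
      by (simp add: inner_add_left inner_add_right inner_commute power2_eq_square)
    moreover have "u \<bullet> d = u $ y - u $ cx i" unfolding d_def by (simp add: inner_diff_right inner_axis)
    moreover have "d \<bullet> d = 2" unfolding d_def using y by (simp add: inner_diff_left inner_diff_right inner_axis_axis)
    ultimately show ?thesis unfolding u_def by (simp add: add_divide_distrib power2_eq_square)
  qed
  have site: "QsN K AN N (cx i) y \<mu> * ((2 * (u $ y - u $ (cx i)) + 2 / real N) / real N)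
      \<le> (Qlim K A (cx i) y \<mu> * (2 * (u $ y - u $ (cx i))) + \<eta>) / real N" if i: "i < N" and y: "y \<noteq> cx i" for i y
  proof -
    define q where "q = QsN K AN N (cx i) y \<mu>"
    define Q where "Q = Qlim K A (cx i) y \<mu>"
    define z where "z = u $ y - u $ (cx i)"
    have qQ: "\<bar>q - Q\<bar> \<le> e" unfolding q_def Q_def \<mu>_def using e[OF i y] .
    have QB: "\<bar>Q\<bar> \<le> B" unfolding Q_def \<mu>_def by (rule B)
    have "(q - Q) * (2 * z) \<le> \<bar>q - Q\<bar> * \<bar>2 * z\<bar>" by (metis abs_ge_self abs_mult)
    also have "\<dots> \<le> e * 4" using qQ ub[of y "cx i"] unfolding z_def by (intro mult_mono) auto
    finally have 1: "(q - Q) * (2 * z) \<le> 4 * e" by simp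
    have "q * (2 / real N) \<le> (B + e) * (2 / real N)"
      using qQ QB by (intro mult_right_mono) auto
    then have 2: "q * (2 / real N) \<le> 2 * (B + e) / real N" by (simp add: mult.commute)
    have "q * (2 * z + 2 / real N) = Q * (2 * z) + (q - Q) * (2 * z) + q * (2 / real N)"
      by (simp add: algebra_simps)
    also have "\<dots> \<le> Q * (2 * z) + \<eta>" using 1 2 unfolding \<eta>_def by linarith
    finally show ?thesis unfolding q_def Q_def z_def by (simp add: divide_right_mono)
  qed
  define G where "G a = (\<Sum>y\<in>UNIV - {a}. Qlim K A a y \<mu> * (2 * (u $ y - u $ a)))" for a
  have "(\<Sum>cy\<in>configs N. QB K AN N cx cy * (norm (LN N cy - v))\<^sup>2)
    = (\<Sum>i<N. \<Sum>y\<in>UNIV - {cx i}. QsN K AN N (cx i) y \<mu> * ((2 * (u $ y - u $ (cx i)) + 2 / real N) / real N))"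
    unfolding QB_right_sum[OF cx] by (intro sum.cong) (auto simp: sq \<mu>_def[symmetric])
  also have "\<dots> \<le> (\<Sum>i<N. \<Sum>y\<in>UNIV - {cx i}. (Qlim K A (cx i) y \<mu> * (2 * (u $ y - u $ (cx i))) + \<eta>) / real N)"
    by (intro sum_mono site) auto
  also have "\<dots> = (\<Sum>i<N. G (cx i) / real N + real (card (UNIV - {cx i})) * (\<eta> / real N))"
    unfolding G_def by (simp add: add_divide_distrib sum.distrib sum_divide_distrib)
  also have "\<dots> \<le> (\<Sum>i<N. G (cx i) / real N + real CARD('x) * (\<eta> / real N))"
    using \<eta>0 by (intro sum_mono add_left_mono mult_right_mono) (auto intro: card_mono)
  also have "\<dots> = (\<Sum>i<N. G (cx i)) / real N + real CARD('x) * \<eta>"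
    using N by (simp add: sum.distrib sum_divide_distrib)
  also have "(\<Sum>i<N. G (cx i)) = real N * (\<Sum>a\<in>UNIV. \<mu> $ a * G a)"
    unfolding \<mu>_def by (rule sum_sites_eq_LN[OF N])
  also have "(\<Sum>a\<in>UNIV. \<mu> $ a * G a) = 2 * (u \<bullet> bfield K A \<mu>)"
    unfolding inner_bfield G_def sum_distrib_left by (intro sum.cong) (auto simp: algebra_simps)
  finally show ?thesis using N unfolding \<eta>_def u_def \<mu>_def by simp
qed

text \<open>The left side is the mean square, under the joint law at times 0 and t, of the distance
  between the empirical measure at time t and the flow line from the initial one. It vanishes at
  time 0, and the generator bound together with the Lipschitz drift feeds Gronwall.\<close>

lemma propagation_estimate:
  assumes N: "0 < N" and m: "is_prob_configs N m"
    and e: "\<And>c i y. i < N \<Longrightarrow> y \<noteq> c i \<Longrightarrow> \<bar>QsN K AN N (c i) y (LN N c) - Qlim K A (c i) y (LN N c)\<bar> \<le> e" and "0 \<le> e"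
    and B: "\<And>x y \<mu>. \<mu> \<in> PX \<Longrightarrow> \<bar>Qlim K A x y \<mu>\<bar> \<le> B" "0 \<le> B"
    and L: "L-lipschitz_on PX (bfield K A)"
    and \<Phi>0: "\<And>\<nu>. \<Phi> 0 \<nu> = \<nu>"
    and \<Phi>: "\<And>\<nu> t. \<nu> \<in> PX \<Longrightarrow> 0 \<le> t \<Longrightarrow> \<Phi> t \<nu> \<in> PX
        \<and> ((\<lambda>t. \<Phi> t \<nu>) has_vector_derivative bfield K A (\<Phi> t \<nu>)) (at t within {0..})"
    and t: "0 \<le> t"
  shows "(\<Sum>x\<in>configs N. \<Sum>y\<in>configs N. m x * finite_generator.trans_prob (configs N) (QB K AN N) t x y
      * (norm (LN N y - \<Phi> t (LN N x)))\<^sup>2)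
    \<le> CARD('x) * (4 * e + 2 * (B + e) / real N) / (2 * L + 1) * exp ((2 * L + 1) * t)"
proof -
  interpret G: finite_generator "configs N" "QB K AN N" by (rule generator[OF N])
  define \<eta> where "\<eta> = CARD('x) * (4 * e + 2 * (B + e) / real N)"
  define a where "a = 2 * L + 1"
  have L0: "0 \<le> L" using L by (rule lipschitz_on_nonneg)
  have m0: "\<And>c. c \<in> configs N \<Longrightarrow> 0 \<le> m c" and m1: "(\<Sum>c\<in>configs N. m c) = 1"
    using m by (auto simp: is_prob_configs_def)
  define n where "n s x y = (norm (LN N y - \<Phi> s (LN N x)))\<^sup>2" for s x y
  define P where "P = G.trans_prob"
  define g where "g s = (\<Sum>x\<in>configs N. \<Sum>y\<in>configs N. m x * (P s x y * n s x y))" for s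
  define g' where "g' s = (\<Sum>x\<in>configs N. \<Sum>y\<in>configs N. m x * ((\<Sum>z\<in>configs N. P s x z * QB K AN N z y) * n s x y
        + 2 * ((LN N y - \<Phi> s (LN N x)) \<bullet> (0 - bfield K A (\<Phi> s (LN N x)))) * P s x y))" for s
  have PX: "LN N x \<in> PX" for x :: "nat \<Rightarrow> 'x" by (rule LN_in_PX[OF N])
  have "g t \<le> (g 0 + \<eta> / a) * exp (a * t)"
  proof (rule gronwall_differential[OF _ _ _ _ t])
    fix s :: real assume s: "0 \<le> s"
    show "(g has_real_derivative g' s) (at s within {0..})"
      unfolding g_def g'_def n_def P_def
      by (intro DERIV_sum DERIV_cmult DERIV_mult has_real_derivative_norm_square has_vector_derivative_diff
          has_vector_derivative_const \<Phi>[OF PX s, THEN conjunct2]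
          has_field_derivative_at_within[OF G.trans_prob_deriv_forward])
    have row: "(\<Sum>y\<in>configs N. (\<Sum>z\<in>configs N. P s x z * QB K AN N z y) * n s x y
        + 2 * ((LN N y - \<Phi> s (LN N x)) \<bullet> (0 - bfield K A (\<Phi> s (LN N x)))) * P s x y)
       \<le> 2 * L * (\<Sum>z\<in>configs N. P s x z * n s x z) + \<eta>" if x: "x \<in> configs N" for x
    proof -
      define \<nu> where "\<nu> = \<Phi> s (LN N x)"
      have \<nu>: "\<nu> \<in> PX" unfolding \<nu>_def using \<Phi>[OF PX s] by blast
      have P0: "0 \<le> P s x z" if "z \<in> configs N" for z
        unfolding P_def by (rule G.trans_prob_nonneg[OF x that s])
      \<comment> \<open>The forward equation is moved onto the observable \<open>n s x\<close>,
        where it becomes the generator.\<close>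
      have "(\<Sum>y\<in>configs N. (\<Sum>z\<in>configs N. P s x z * QB K AN N z y) * n s x y)
         = (\<Sum>z\<in>configs N. P s x z * (\<Sum>y\<in>configs N. QB K AN N z y * n s x y))"
        by (simp add: sum_distrib_right sum_distrib_left mult.assoc, rule sum.swap)
      then have "(\<Sum>y\<in>configs N. (\<Sum>z\<in>configs N. P s x z * QB K AN N z y) * n s x y
        + 2 * ((LN N y - \<nu>) \<bullet> (0 - bfield K A \<nu>)) * P s x y)
       = (\<Sum>z\<in>configs N. P s x z * ((\<Sum>y\<in>configs N. QB K AN N z y * n s x y)
            - 2 * ((LN N z - \<nu>) \<bullet> bfield K A \<nu>)))"
        by (simp add: sum.distrib right_diff_distrib sum_subtractf sum_negf ac_simps)
      also have "\<dots> \<le> (\<Sum>z\<in>configs N. P s x z * (2 * L * n s x z + \<eta>))"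
      proof (intro sum_mono mult_left_mono P0)
        fix z :: "nat \<Rightarrow> 'x" assume z: "z \<in> configs N"
        have "(\<Sum>y\<in>configs N. QB K AN N z y * n s x y) \<le> 2 * ((LN N z - \<nu>) \<bullet> bfield K A (LN N z)) + \<eta>"
          unfolding n_def \<nu>_def[symmetric] \<eta>_def
          by (rule generator_square_distance[OF N z \<nu> e B(1)[OF PX] \<open>0 \<le> e\<close>])
        moreover have "(LN N z - \<nu>) \<bullet> (bfield K A (LN N z) - bfield K A \<nu>) \<le> L * n s x z"
        proof -
          have "(LN N z - \<nu>) \<bullet> (bfield K A (LN N z) - bfield K A \<nu>)
             \<le> norm (LN N z - \<nu>) * norm (bfield K A (LN N z) - bfield K A \<nu>)" by (rule norm_cauchy_schwarz)
          also have "\<dots> \<le> norm (LN N z - \<nu>) * (L * norm (LN N z - \<nu>))"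
            by (intro mult_left_mono lipschitz_on_normD[OF L PX \<nu>]) auto
          finally show ?thesis unfolding n_def \<nu>_def[symmetric] by (simp add: power2_eq_square ac_simps)
        qed
        ultimately show "(\<Sum>y\<in>configs N. QB K AN N z y * n s x y) - 2 * ((LN N z - \<nu>) \<bullet> bfield K A \<nu>)
           \<le> 2 * L * n s x z + \<eta>"
          by (simp add: inner_diff_right)
      qed
      also have "\<dots> = (\<Sum>z\<in>configs N. 2 * L * (P s x z * n s x z)) + (\<Sum>z\<in>configs N. P s x z) * \<eta>"
        unfolding sum_distrib_right sum.distrib[symmetric] by (intro sum.cong) (auto simp: algebra_simps)
      also have "(\<Sum>z\<in>configs N. P s x z) = 1" unfolding P_def by (rule G.trans_prob_row_sum[OF x])
      finally show ?thesis unfolding \<nu>_def by (simp add: sum_distrib_left)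
    qed
    have "g' s \<le> (\<Sum>x\<in>configs N. m x * (2 * L * (\<Sum>z\<in>configs N. P s x z * n s x z) + \<eta>))"
      unfolding g'_def sum_distrib_left[symmetric] by (intro sum_mono mult_left_mono row m0)
    also have "\<dots> = (\<Sum>x\<in>configs N. m x * (2 * L * (\<Sum>z\<in>configs N. P s x z * n s x z))) + (\<Sum>x\<in>configs N. m x) * \<eta>"
      by (simp add: distrib_left sum.distrib sum_distrib_right sum_distrib_left)
    also have "(\<Sum>x\<in>configs N. m x * (2 * L * (\<Sum>z\<in>configs N. P s x z * n s x z))) = 2 * L * g s"
      unfolding g_def sum_distrib_left by (simp add: ac_simps)
    finally have "g' s \<le> 2 * L * g s + \<eta>" using m1 by simp
    \<comment> \<open>Nonnegativity of \<open>g\<close> lets the rate 2 L be raised to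
      \<open>a\<close>, which is never 0.\<close>
    moreover have "0 \<le> g s"
      unfolding g_def n_def P_def using m0 G.trans_prob_nonneg s by (intro sum_nonneg mult_nonneg_nonneg) auto
    ultimately show "g' s \<le> a * g s + \<eta>" unfolding a_def by (simp add: distrib_right)
  next
    show "a \<noteq> 0" unfolding a_def using L0 by simp
    show "0 \<le> \<eta> / a" unfolding a_def \<eta>_def using L0 \<open>0 \<le> e\<close> B(2) by simp
  qed
  moreover have "g 0 = 0"
    unfolding g_def P_def n_def by (intro sum.neutral ballI) (auto simp: G.trans_prob_0 \<Phi>0)
  ultimately show ?thesis unfolding g_def n_def P_def \<eta>_def a_def by (simp add: mult.assoc)
qed

end

subsection \<open>Propagation of the entropy\<close>

text \<open>Conditional expectation given the type: the mass of each class is spread evenly over its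
  configurations.\<close>

definition type_average :: "nat \<Rightarrow> ((nat \<Rightarrow> 'x::finite) \<Rightarrow> real) \<Rightarrow> (nat \<Rightarrow> 'x) \<Rightarrow> real" where
  "type_average N m c = (\<Sum>c'\<in>config_class N (LN N c). m c') / card (config_class N (LN N c))"

lemma type_average_cong: "LN N c = LN N c' \<Longrightarrow> type_average N m c = type_average N m c'"
  by (simp add: type_average_def)

text \<open>Averaging is invisible to observables of the type. This makes the cross terms of the
  relative entropies computable.\<close>

lemma sum_type_average:
  fixes m v :: "(nat \<Rightarrow> 'x::finite) \<Rightarrow> real"
  assumes v: "\<And>c c'. c \<in> configs N \<Longrightarrow> c' \<in> configs N \<Longrightarrow> LN N c = LN N c' \<Longrightarrow> v c = v c'"
  shows "(\<Sum>c\<in>configs N. type_average N m c * v c) = (\<Sum>c\<in>configs N. m c * v c)"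
proof -
  have "(\<Sum>c\<in>config_class N \<mu>. type_average N m c * v c) = (\<Sum>c\<in>config_class N \<mu>. m c * v c)"
    if "\<mu> \<in> LN N ` configs N" for \<mu>
  proof -
    obtain c0 where c0: "c0 \<in> configs N" "\<mu> = LN N c0" using \<open>\<mu> \<in> LN N ` configs N\<close> by blast
    let ?T = "config_class N \<mu>"
    have pos: "0 < card ?T" using card_config_class_pos[OF c0(1)] c0(2) by simp
    have vc: "v c = v c0" if "c \<in> ?T" for c
      using that c0 by (intro v) (auto simp: config_class_def)
    have "(\<Sum>c\<in>?T. type_average N m c * v c) = (\<Sum>c\<in>?T. (\<Sum>c'\<in>?T. m c') / card ?T * v c0)"
      by (intro sum.cong refl arg_cong2[where f = "(*)"] vc)
         (auto simp: type_average_def config_class_def)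
    also have "\<dots> = (\<Sum>c'\<in>?T. m c') * v c0" using pos by simp
    also have "\<dots> = (\<Sum>c\<in>?T. m c * v c)"
      unfolding sum_distrib_right by (intro sum.cong refl arg_cong2[where f = "(*)"] vc[symmetric])
    finally show ?thesis .
  qed
  then show ?thesis unfolding sum_configs_by_type[where N = N and f = "\<lambda>c. type_average N m c * v c"]
      sum_configs_by_type[where N = N and f = "\<lambda>c. m c * v c"]
    by (rule sum.cong[OF refl])
qed

lemma type_average_nonneg:
  assumes "\<And>c. c \<in> configs N \<Longrightarrow> 0 \<le> m c"
  shows "0 \<le> type_average N m c"
  unfolding type_average_def using assms
  by (intro divide_nonneg_nonneg sum_nonneg) (auto simp: config_class_def)

text \<open>Absolute continuity of a law with respect to its average; without it the convention x /
  0 = 0 would distort the relative entropy.\<close>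

lemma type_average_eq_0:
  assumes m: "\<And>c. c \<in> configs N \<Longrightarrow> 0 \<le> m c" and c: "c \<in> configs N" and 0: "type_average N m c = 0"
  shows "m c = 0"
proof -
  have "(\<Sum>c'\<in>config_class N (LN N c). m c') = 0"
    using 0 card_config_class_pos[OF c] by (simp add: type_average_def)
  then show ?thesis
    using c by (subst (asm) sum_nonneg_eq_0_iff[OF finite_config_class]) (auto simp: config_class_def m)
qed

context mean_field
begin

text \<open>The type average \<open>b\<close> of the initial law is transported to the type average of the law
  at time \<open>t\<close>, so the entropy lost by averaging is a relative entropy at both times and can only
  decrease.\<close>

lemma entropy_propagation:
  assumes N: "0 < N" and m: "is_prob_configs N m" and t: "0 \<le> t"
    and mt: "\<And>y. y \<in> configs N \<Longrightarrow>
      mt y = (\<Sum>x\<in>configs N. m x * finite_generator.trans_prob (configs N) (QB K AN N) t x y)"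
  shows "(\<Sum>c\<in>configs N. mt c * ln (mt c)) \<le> (\<Sum>c\<in>configs N. m c * ln (m c))
     + real N * ((\<Sum>c\<in>configs N. m c * shannon (LN N c)) - (\<Sum>c\<in>configs N. mt c * shannon (LN N c)))
     + ((2 * CARD('x) + 1) * ln (real N + 1) + CARD('x) + 1)"
proof -
  interpret G: finite_generator "configs N" "QB K AN N" by (rule generator[OF N])
  define P where "P = G.trans_prob t"
  have mt: "mt y = (\<Sum>x\<in>configs N. m x * P x y)" if "y \<in> configs N" for y using mt[OF that] by (simp add: P_def)
  have P0: "0 \<le> P x y" if "x \<in> configs N" "y \<in> configs N" for x y
    unfolding P_def using G.trans_prob_nonneg[OF that t] .
  have P1: "(\<Sum>y\<in>configs N. P x y) = 1" if "x \<in> configs N" for x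
    unfolding P_def by (rule G.trans_prob_row_sum[OF that])
  have m0: "\<And>c. c \<in> configs N \<Longrightarrow> 0 \<le> m c" and m1: "(\<Sum>c\<in>configs N. m c) = 1"
    using m by (auto simp: is_prob_configs_def)
  define b where "b = type_average N m"
  define bt where "bt y = (\<Sum>x\<in>configs N. b x * P x y)" for y
  have b_cls: "b c = b c'" if "LN N c = LN N c'" for c c'
    unfolding b_def by (rule type_average_cong[OF that])
  have b0: "0 \<le> b c" for c unfolding b_def by (rule type_average_nonneg[OF m0])
  have b_ac: "m c = 0" if "c \<in> configs N" "b c = 0" for c
    by (rule type_average_eq_0[of N m]) (use m0 that in \<open>auto simp: b_def\<close>)
  have b_sum: "(\<Sum>c\<in>configs N. b c * v c) = (\<Sum>c\<in>configs N. m c * v c)"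
    if "\<And>c c'. c \<in> configs N \<Longrightarrow> c' \<in> configs N \<Longrightarrow> LN N c = LN N c' \<Longrightarrow> v c = v c'" for v
    unfolding b_def by (rule sum_type_average) (rule that)
  \<comment> \<open>The evolved average stays constant on type classes, by the action of the
    semigroup on measures.\<close>
  have bt_cls: "bt c = bt c'" if "c \<in> configs N" "c' \<in> configs N" "LN N c = LN N c'" for c c'
    unfolding bt_def P_def
  proof (rule G.left_mult_invariant[where T = "LN N" and v = b])
    fix u :: "(nat \<Rightarrow> 'x) \<Rightarrow> real" and x y :: "nat \<Rightarrow> 'x"
    assume "\<And>x y. x \<in> configs N \<Longrightarrow> y \<in> configs N \<Longrightarrow> LN N x = LN N y \<Longrightarrow> u x = u y"
      and "x \<in> configs N" "y \<in> configs N" "LN N x = LN N y"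
    then show "(\<Sum>z\<in>configs N. u z * QB K AN N z x) = (\<Sum>z\<in>configs N. u z * QB K AN N z y)"
      by (rule QB_left_type_function[OF _ _ _ _ N])
  qed (rule that | erule b_cls)+
  \<comment> \<open>The evolved law and the evolved average agree on observables of the type: the
    semigroup is moved to the observable, which remains one of the type, and the comparison is made
    at time 0.\<close>
  have bt_sum: "(\<Sum>c\<in>configs N. bt c * v c) = (\<Sum>c\<in>configs N. mt c * v c)"
    if v: "\<And>c c'. c \<in> configs N \<Longrightarrow> c' \<in> configs N \<Longrightarrow> LN N c = LN N c' \<Longrightarrow> v c = v c'" for v
  proof -
    define w where "w x = (\<Sum>y\<in>configs N. v y * P x y)" for x
    have w: "w c = w c'" if "c \<in> configs N" "c' \<in> configs N" "LN N c = LN N c'" for c c'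
      unfolding w_def P_def
    proof (rule G.right_mult_invariant[where T = "LN N" and v = v])
    fix u :: "(nat \<Rightarrow> 'x) \<Rightarrow> real" and x y :: "nat \<Rightarrow> 'x"
    assume "\<And>x y. x \<in> configs N \<Longrightarrow> y \<in> configs N \<Longrightarrow> LN N x = LN N y \<Longrightarrow> u x = u y"
      and "x \<in> configs N" "y \<in> configs N" "LN N x = LN N y"
    then show "(\<Sum>z\<in>configs N. QB K AN N x z * u z) = (\<Sum>z\<in>configs N. QB K AN N y z * u z)"
      by (rule QB_right_type_function[OF _ _ _ _ N])
  qed (rule that | erule (2) v)+
    have e: "(\<Sum>y\<in>configs N. (\<Sum>x\<in>configs N. u x * P x y) * v y) = (\<Sum>x\<in>configs N. u x * w x)" for u
      unfolding w_def sum_distrib_left sum_distrib_right by (subst sum.swap) (simp add: ac_simps)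
    have "(\<Sum>c\<in>configs N. bt c * v c) = (\<Sum>x\<in>configs N. b x * w x)" unfolding bt_def by (rule e)
    also have "\<dots> = (\<Sum>x\<in>configs N. m x * w x)" by (rule b_sum) (rule w)
    also have "\<dots> = (\<Sum>c\<in>configs N. mt c * v c)" unfolding e[symmetric] using mt by simp
    finally show ?thesis .
  qed
  have bt0: "0 \<le> bt c" if "c \<in> configs N" for c
    unfolding bt_def using b0 P0 that by (intro sum_nonneg mult_nonneg_nonneg) auto
  have bt_ac: "mt y = 0" if y: "y \<in> configs N" and 0: "bt y = 0" for y
  proof -
    have "b x * P x y = 0" if "x \<in> configs N" for x
      using 0 that unfolding bt_def
      by (subst (asm) sum_nonneg_eq_0_iff) (use b0 P0 y in auto)
    then have "m x * P x y = 0" if "x \<in> configs N" for x using b_ac that by fastforce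
    then show ?thesis unfolding mt[OF y] by (intro sum.neutral ballI)
  qed
  have mt0: "0 \<le> mt c" if "c \<in> configs N" for c
    unfolding mt[OF that] using m0 P0 that by (intro sum_nonneg mult_nonneg_nonneg) auto
  have b_prob: "is_prob_configs N b" using b0 b_sum[of "\<lambda>_. 1"] m1 by (simp add: is_prob_configs_def)
  have mt1: "(\<Sum>c\<in>configs N. mt c) = 1"
  proof -
    have "(\<Sum>c\<in>configs N. mt c) = (\<Sum>y\<in>configs N. \<Sum>x\<in>configs N. m x * P x y)" using mt by simp
    also have "\<dots> = (\<Sum>x\<in>configs N. m x * (\<Sum>y\<in>configs N. P x y))"
      by (subst sum.swap) (simp add: sum_distrib_left)
    finally show ?thesis using P1 m1 by simp
  qed
  have bt_prob: "is_prob_configs N bt" using bt0 bt_sum[of "\<lambda>_. 1"] mt1 by (simp add: is_prob_configs_def)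
  have split: "(\<Sum>c\<in>configs N. p c * ln (p c / q c)) = (\<Sum>c\<in>configs N. p c * ln (p c)) - (\<Sum>c\<in>configs N. p c * ln (q c))"
    if "\<And>c. c \<in> configs N \<Longrightarrow> 0 \<le> p c" "\<And>c. c \<in> configs N \<Longrightarrow> 0 \<le> q c" "\<And>c. c \<in> configs N \<Longrightarrow> q c = 0 \<Longrightarrow> p c = 0"
    for p q :: "(nat \<Rightarrow> 'x) \<Rightarrow> real"
    unfolding sum_subtractf[symmetric]
  proof (intro sum.cong refl)
    fix c :: "nat \<Rightarrow> 'x" assume c: "c \<in> configs N"
    show "p c * ln (p c / q c) = p c * ln (p c) - p c * ln (q c)"
    proof (cases "p c = 0")
      case False
      then have "0 < p c" "0 < q c" using that(1)[OF c] that(2)[OF c] that(3)[OF c] by (auto simp: less_le)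
      then show ?thesis by (simp add: ln_div algebra_simps)
    qed simp
  qed
  have "(\<Sum>c\<in>configs N. mt c * ln (mt c / bt c)) \<le> (\<Sum>c\<in>configs N. m c * ln (m c / b c))"
  proof -
    have "(\<Sum>c\<in>configs N. mt c * ln (mt c / bt c)) = (\<Sum>y\<in>configs N. (\<Sum>x\<in>configs N. m x * P x y) *
        ln ((\<Sum>x\<in>configs N. m x * P x y) / (\<Sum>x\<in>configs N. b x * P x y)))"
      using mt by (intro sum.cong) (auto simp: bt_def)
    also have "\<dots> \<le> (\<Sum>c\<in>configs N. m c * ln (m c / b c))"
      by (rule relative_entropy_data_processing) (use m0 b0 b_ac P0 P1 in auto)
    finally show ?thesis .
  qed
  \<comment> \<open>Since \<open>ln (bt c)\<close> depends only on the type, the cross term may be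
    taken under \<open>bt\<close> instead of \<open>mt\<close>; the relative entropy becomes a
    difference of two entropies. The same happens at time 0.\<close>
  moreover have "(\<Sum>c\<in>configs N. mt c * ln (mt c / bt c))
      = (\<Sum>c\<in>configs N. mt c * ln (mt c)) - (\<Sum>c\<in>configs N. bt c * ln (bt c))"
  proof -
    have "(\<Sum>c\<in>configs N. bt c * ln (bt c)) = (\<Sum>c\<in>configs N. mt c * ln (bt c))"
      by (rule bt_sum) (rule arg_cong[of _ _ ln], erule (2) bt_cls)
    moreover have "(\<Sum>c\<in>configs N. mt c * ln (mt c / bt c)) = (\<Sum>c\<in>configs N. mt c * ln (mt c)) - (\<Sum>c\<in>configs N. mt c * ln (bt c))"
      by (rule split) (erule mt0 bt0 | erule (1) bt_ac)+
    ultimately show ?thesis by simp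
  qed
  moreover have "(\<Sum>c\<in>configs N. m c * ln (m c / b c))
      = (\<Sum>c\<in>configs N. m c * ln (m c)) - (\<Sum>c\<in>configs N. b c * ln (b c))"
  proof -
    have "(\<Sum>c\<in>configs N. b c * ln (b c)) = (\<Sum>c\<in>configs N. m c * ln (b c))"
      by (rule b_sum) (rule arg_cong[of _ _ ln], erule b_cls)
    moreover have "(\<Sum>c\<in>configs N. m c * ln (m c / b c)) = (\<Sum>c\<in>configs N. m c * ln (m c)) - (\<Sum>c\<in>configs N. m c * ln (b c))"
      by (rule split) (erule m0 | rule b0 | erule (1) b_ac)+
    ultimately show ?thesis by simp
  qed
  \<comment> \<open>The average is bounded above at time t and below at time 0. The errors CARD('x)
    (1 + ln (N + 1)) and (CARD('x) + 1) ln (N + 1) + 1 add up to the claimed one.\<close>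
  moreover have "(\<Sum>c\<in>configs N. bt c * ln (bt c))
     \<le> - real N * (\<Sum>c\<in>configs N. bt c * shannon (LN N c)) + CARD('x) * (1 + ln (real N + 1))"
    by (rule entropy_upper_bound_type_function[OF N bt_prob]) (rule bt_cls)
  moreover have "- real N * (\<Sum>c\<in>configs N. b c * shannon (LN N c)) - (CARD('x) + 1) * ln (real N + 1) - 1
     \<le> (\<Sum>c\<in>configs N. b c * ln (b c))"
    by (rule entropy_lower_bound[OF N b_prob])
  moreover have "(\<Sum>c\<in>configs N. bt c * shannon (LN N c)) = (\<Sum>c\<in>configs N. mt c * shannon (LN N c))"
    by (rule bt_sum) simp
  moreover have "(\<Sum>c\<in>configs N. b c * shannon (LN N c)) = (\<Sum>c\<in>configs N. m c * shannon (LN N c))"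
    by (rule b_sum) simp
  ultimately show ?thesis by (simp add: algebra_simps)
qed

end

section \<open>Entropies and integrals of observables as sums over configurations\<close>

lemma FN_eq:
  fixes m :: "(nat \<Rightarrow> 'x::finite) \<Rightarrow> real"
  assumes m: "is_prob_configs N m"
  shows "FN K N m = (\<Sum>c\<in>configs N. m c * ln (m c)) + real N * (\<Sum>c\<in>configs N. m c * UU K (LN N c)) + ln (ZN K N)"
proof -
  have m0: "\<And>c. c \<in> configs N \<Longrightarrow> 0 \<le> m c" and m1: "(\<Sum>c\<in>configs N. m c) = 1"
    using m by (auto simp: is_prob_configs_def)
  have "m c * ln (m c / piN K N c) = m c * ln (m c) + real N * (m c * UU K (LN N c)) + m c * ln (ZN K N)"
    if c: "c \<in> configs N" for c
  proof (cases "m c = 0")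
    case False
    then have "0 < m c" using m0[OF c] by simp
    then show ?thesis using ZN_pos[of K N] unfolding piN_def by (simp add: ln_div ln_mult algebra_simps)
  qed simp
  then have "FN K N m = (\<Sum>c\<in>configs N. m c * ln (m c) + real N * (m c * UU K (LN N c)) + m c * ln (ZN K N))"
    unfolding FN_def by (intro sum.cong refl)
  then show ?thesis by (simp add: sum.distrib sum_distrib_left[symmetric] sum_distrib_right[symmetric] m1)
qed

lemma integral_pushLN:
  fixes f :: "real^'x::finite \<Rightarrow> real"
  assumes m: "is_prob_configs N m" and f: "f \<in> borel_measurable borel"
  shows "integral\<^sup>L (pushLN N m) f = (\<Sum>c\<in>configs N. m c * f (LN N c))"
proof -
  have "integral\<^sup>L (pushLN N m) f = integral\<^sup>L (point_measure (configs N) (\<lambda>c. ennreal (m c))) (\<lambda>c. f (LN N c))"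
    unfolding pushLN_def by (rule integral_distr) (use f in auto)
  also have "\<dots> = (\<Sum>c\<in>configs N. m c *\<^sub>R f (LN N c))"
    using m by (intro lebesgue_integral_point_measure_finite) (auto simp: is_prob_configs_def)
  finally show ?thesis by simp
qed

text \<open>Close pairs are handled by uniform continuity, pairs at distance at least d by
  boundedness, whence M = 2 B / d^2. Thus mean-square convergence controls every continuous
  observable.\<close>

lemma continuous_on_PX_modulus:
  fixes f :: "real^'x::finite \<Rightarrow> real"
  assumes f: "continuous_on PX f" and e: "0 < e"
  shows "\<exists>M\<ge>0. \<forall>a\<in>PX. \<forall>b\<in>PX. \<bar>f a - f b\<bar> \<le> e + M * (norm (a - b))\<^sup>2"
proof -
  have "uniformly_continuous_on PX f" by (rule compact_uniformly_continuous[OF f PX_compact])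
  then obtain d where d: "0 < d" "\<And>a b. a \<in> PX \<Longrightarrow> b \<in> PX \<Longrightarrow> dist b a < d \<Longrightarrow> dist (f b) (f a) < e"
    using e unfolding uniformly_continuous_on_def by metis
  obtain B where B: "0 < B" "\<And>a. a \<in> PX \<Longrightarrow> \<bar>f a\<bar> \<le> B" using continuous_on_PX_bounded[OF f] by blast
  have "\<bar>f a - f b\<bar> \<le> e + (2 * B / d\<^sup>2) * (norm (a - b))\<^sup>2" if ab: "a \<in> PX" "b \<in> PX" for a b
  proof (cases "norm (a - b) < d")
    case True
    then have "\<bar>f a - f b\<bar> < e" using d(2)[OF ab(2,1)] by (simp add: dist_norm)
    moreover have "0 \<le> (2 * B / d\<^sup>2) * (norm (a - b))\<^sup>2" using B by simp
    ultimately show ?thesis by linarith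
  next
    case False
    then have "d\<^sup>2 \<le> (norm (a - b))\<^sup>2" using d(1) by (intro power_mono) auto
    then have "(2 * B / d\<^sup>2) * d\<^sup>2 \<le> (2 * B / d\<^sup>2) * (norm (a - b))\<^sup>2" using B by (intro mult_left_mono) auto
    moreover have "(2 * B / d\<^sup>2) * d\<^sup>2 = 2 * B" using d(1) by simp
    moreover have "\<bar>f a - f b\<bar> \<le> 2 * B" using B(2)[OF ab(1)] B(2)[OF ab(2)] by linarith
    ultimately show ?thesis using e by linarith
  qed
  then show ?thesis using B(1) by (intro exI[of _ "2 * B / d\<^sup>2"]) auto
qed

lemma prob_on_simplex_AE:
  assumes "prob_on_simplex M"
  shows "AE \<nu> in M. \<nu> \<in> PX"
proof -
  interpret prob_space M using assms by (simp add: prob_on_simplex_def)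
  have "prob PX = 1" using assms by (simp add: prob_on_simplex_def measure_def)
  then show ?thesis by (rule AE_prob_1)
qed

text \<open>The measure charges only the simplex, where the projection is the identity; the right
  side has a globally continuous integrand.\<close>

lemma set_integral_PX:
  fixes f :: "real^'x::finite \<Rightarrow> real"
  assumes M: "prob_on_simplex M" and f: "continuous_on PX f"
  shows "(LINT \<nu>:PX|M. f \<nu>) = (LINT \<nu>|M. f (proj_PX \<nu>))"
proof -
  have s: "sets M = sets borel" using M by (simp add: prob_on_simplex_def)
  have "(\<lambda>\<nu>. indicator PX \<nu> *\<^sub>R f \<nu>) \<in> borel_measurable borel"
    by (rule borel_measurable_continuous_on_indicator[OF _ f]) (simp add: PX_closed borel_closed)
  moreover have "(\<lambda>\<nu>. f (proj_PX \<nu>)) \<in> borel_measurable borel"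
    by (rule borel_measurable_continuous_onI[OF continuous_comp_proj_PX[OF f]])
  moreover have "AE \<nu> in M. indicator PX \<nu> *\<^sub>R f \<nu> = f (proj_PX \<nu>)"
    using prob_on_simplex_AE[OF M] by (rule AE_mp) (simp add: proj_PX_id)
  ultimately show ?thesis unfolding set_lebesgue_integral_def
    by (intro integral_cong_AE) (simp_all add: measurable_cong_sets[OF s refl])
qed

subsection \<open>Passage to the limit\<close>

text \<open>The flow is a parameter because \<open>flow_exists\<close> only asserts that one exists;
  the final proof chooses it and instantiates the locale.\<close>

locale mean_field_limit = mean_field K A AN
  for K :: "'x::finite \<Rightarrow> real^'x \<Rightarrow> real"
    and A :: "real^'x \<Rightarrow> 'x \<Rightarrow> 'x \<Rightarrow> real"
    and AN :: "nat \<Rightarrow> real^'x \<Rightarrow> 'x \<Rightarrow> 'x \<Rightarrow> real" +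
  fixes \<Phi> :: "real \<Rightarrow> real^'x \<Rightarrow> real^'x"
    and c :: "nat \<Rightarrow> real \<Rightarrow> (nat \<Rightarrow> 'x) \<Rightarrow> real"
    and C0 :: "(real^'x) measure"
  assumes flow_0: "\<And>\<nu>. \<Phi> 0 \<nu> = \<nu>"
    and flow_continuous: "continuous_on ({0..} \<times> UNIV) (\<lambda>(t, \<nu>). \<Phi> t \<nu>)"
    and flow_PX: "\<And>\<nu> t. \<nu> \<in> PX \<Longrightarrow> 0 \<le> t \<Longrightarrow> \<Phi> t \<nu> \<in> PX"
    and flow_ode: "\<And>\<nu> t. \<nu> \<in> PX \<Longrightarrow> 0 \<le> t \<Longrightarrow>
        ((\<lambda>t. \<Phi> t \<nu>) has_vector_derivative bfield K A (\<Phi> t \<nu>)) (at t within {0..})"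
    and c_prob: "\<forall>N\<ge>1. \<forall>t\<ge>0. is_prob_configs N (c N t)"
    and c_ode: "\<forall>N\<ge>1. \<forall>t\<ge>0. \<forall>cy\<in>configs N.
          ((\<lambda>s. c N s cy) has_real_derivative (\<Sum>cx\<in>configs N. c N t cx * QB K AN N cx cy))
            (at t within {0..})"
    and C0_prob: "prob_on_simplex C0"
    and wp_entropy: "(\<lambda>N. FN K N (c N 0) / real N) \<longlonglongrightarrow> FFbig K C0 - FE0 K"
    and wp_weak: "weak_conv_along sequentially (\<lambda>N. pushLN N (c N 0)) C0"
begin

definition C :: "real \<Rightarrow> (real^'x) measure" where
  "C t = distr C0 borel (\<Phi> t)"

lemma C0_prob_space: "prob_space C0" and sets_C0 [measurable_cong, simp]: "sets C0 = sets borel"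
  using C0_prob by (auto simp: prob_on_simplex_def)

lemma space_C0 [simp]: "space C0 = UNIV"
  using sets_eq_imp_space_eq[OF sets_C0] by simp

lemma borel_measurable_C0: "f \<in> borel_measurable C0 \<longleftrightarrow> f \<in> borel_measurable borel"
  by (simp add: measurable_cong_sets[OF sets_C0 refl])

lemma flow_continuous_space:
  assumes "0 \<le> t"
  shows "continuous_on UNIV (\<Phi> t)"
proof -
  have c: "continuous_on UNIV (\<lambda>\<nu>::real^'x. (t, \<nu>))" by (intro continuous_intros)
  have "continuous_on UNIV (\<lambda>\<nu>. case (t, \<nu>) of (t, \<nu>) \<Rightarrow> \<Phi> t \<nu>)"
    by (rule continuous_on_compose2[OF flow_continuous c]) (use assms in auto)
  then show ?thesis by simp
qed

lemma flow_measurable: "0 \<le> t \<Longrightarrow> \<Phi> t \<in> borel_measurable borel"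
  by (intro borel_measurable_continuous_onI flow_continuous_space)

lemma integral_C:
  fixes f :: "real^'x \<Rightarrow> real"
  assumes "0 \<le> t" "f \<in> borel_measurable borel"
  shows "integral\<^sup>L (C t) f = (LINT \<nu>|C0. f (\<Phi> t \<nu>))"
  unfolding C_def using assms flow_measurable[OF assms(1)] by (intro integral_distr) auto

lemma C_prob: "0 \<le> t \<Longrightarrow> prob_on_simplex (C t)"
proof -
  assume t: "0 \<le> t"
  interpret C0: prob_space C0 by (rule C0_prob_space)
  have m: "\<Phi> t \<in> measurable C0 borel" using flow_measurable[OF t] by (simp add: borel_measurable_C0)
  have PXb: "PX \<in> sets borel" by (simp add: PX_closed borel_closed)
  have "prob_space (C t)" unfolding C_def by (rule C0.prob_space_distr[OF m])
  moreover have "emeasure (C t) PX = 1"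
  proof -
    have "emeasure (C t) PX = emeasure C0 (\<Phi> t -` PX \<inter> space C0)"
      unfolding C_def by (rule emeasure_distr[OF m PXb])
    also have "\<dots> \<ge> emeasure C0 PX"
      using flow_PX t measurable_sets[OF m PXb] by (intro emeasure_mono) auto
    finally have "1 \<le> emeasure (C t) PX" using C0_prob by (simp add: prob_on_simplex_def)
    then show ?thesis using prob_space.emeasure_le_1[OF \<open>prob_space (C t)\<close>, of PX] by simp
  qed
  ultimately show ?thesis by (simp add: prob_on_simplex_def C_def)
qed

lemma C_0: "C 0 = C0"
proof -
  have "\<Phi> 0 = (\<lambda>\<nu>. \<nu>)" by (rule ext) (rule flow_0)
  then show ?thesis unfolding C_def by (simp add: distr_id2)
qed

lemma c_transition:
  assumes "0 < N" "0 \<le> t" "y \<in> configs N"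
  shows "c N t y = (\<Sum>x\<in>configs N. c N 0 x * finite_generator.trans_prob (configs N) (QB K AN N) t x y)"
proof -
  interpret G: finite_generator "configs N" "QB K AN N" by (rule generator[OF assms(1)])
  show ?thesis using assms c_ode by (intro G.solution_eq_trans_prob) auto
qed

text \<open>The law at time t is compared with the initial law carried along by the limit flow;
  replacing the initial law by \<open>C0\<close> is left as a separate step.\<close>

lemma particles_follow_flow:
  assumes f: "continuous_on PX f" and t: "0 \<le> t"
  shows "(\<lambda>N. (\<Sum>y\<in>configs N. c N t y * f (LN N y)) - (\<Sum>x\<in>configs N. c N 0 x * f (\<Phi> t (LN N x)))) \<longlonglongrightarrow> 0"
proof (rule LIMSEQ_I)
  fix r :: real assume r: "0 < r"
  obtain M where M: "0 \<le> M" "\<And>a b. a \<in> PX \<Longrightarrow> b \<in> PX \<Longrightarrow> \<bar>f a - f b\<bar> \<le> r / 4 + M * (norm (a - b))\<^sup>2"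
    using continuous_on_PX_modulus[OF f, of "r / 4"] r by auto
  obtain L where L: "L-lipschitz_on PX (bfield K A)" using bfield_lipschitz by blast
  have L0: "0 \<le> L" using L by (rule lipschitz_on_nonneg)
  obtain B where B: "0 < B" "\<And>x y \<mu>. \<mu> \<in> PX \<Longrightarrow> \<bar>Qlim K A x y \<mu>\<bar> \<le> B" using Qlim_bound by blast
  \<comment> \<open>\<open>k\<close> is the factor with which the rate error enters after
    multiplication by \<open>M\<close>. The choice of \<open>e\<close> makes that share at most r /
    4, with k + 1 to avoid division by 0; the modulus and the 1 / N term contribute at most r / 4
    each, so the total stays below r.\<close>
  define k where "k = M * (CARD('x) / (2 * L + 1) * exp ((2 * L + 1) * t))"
  have k0: "0 \<le> k" unfolding k_def using M(1) L0 by simp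
  define e where "e = r / (16 * (k + 1))"
  have e0: "0 < e" unfolding e_def using r k0 by simp
  have ke: "k * (4 * e) \<le> r / 4"
  proof -
    have "k * (4 * e) = r / 4 * (k / (k + 1))" unfolding e_def using k0 by (simp add: field_simps)
    also have "\<dots> \<le> r / 4 * 1" using r k0 by (intro mult_left_mono) (auto simp: field_simps)
    finally show ?thesis by simp
  qed
  have "\<forall>\<^sub>F N in sequentially. k * (2 * (B + e)) / real N < r / 4"
    using r by (intro order_tendstoD(2)[OF lim_const_over_n]) auto
  then have "\<forall>\<^sub>F N in sequentially. norm ((\<Sum>y\<in>configs N. c N t y * f (LN N y))
      - (\<Sum>x\<in>configs N. c N 0 x * f (\<Phi> t (LN N x))) - 0) < r"
    using rates_consistent[OF e0] eventually_gt_at_top[of 0]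
  proof eventually_elim
    case (elim N)
    then have N: "0 < N" by simp
    interpret G: finite_generator "configs N" "QB K AN N" by (rule generator[OF N])
    define P where "P = G.trans_prob t"
    have P0: "0 \<le> P x y" if "x \<in> configs N" "y \<in> configs N" for x y
      unfolding P_def using G.trans_prob_nonneg[OF that t] .
    have P1: "(\<Sum>y\<in>configs N. P x y) = 1" if "x \<in> configs N" for x
      unfolding P_def by (rule G.trans_prob_row_sum[OF that])
    have c0p: "is_prob_configs N (c N 0)" using c_prob N by simp
    have c0: "\<And>x. x \<in> configs N \<Longrightarrow> 0 \<le> c N 0 x" and c1: "(\<Sum>x\<in>configs N. c N 0 x) = 1"
      using c0p by (auto simp: is_prob_configs_def)
    have PX: "LN N x \<in> PX" for x :: "nat \<Rightarrow> 'x" by (rule LN_in_PX[OF N])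
    \<comment> \<open>Inserts the sum over final configurations, whose transition probabilities add
      up to 1.\<close>
    have s1: "(\<Sum>x\<in>configs N. \<Sum>y\<in>configs N. c N 0 x * P x y * g x) = (\<Sum>x\<in>configs N. c N 0 x * g x)" for g
    proof (intro sum.cong refl)
      fix x :: "nat \<Rightarrow> 'x" assume x: "x \<in> configs N"
      have "(\<Sum>y\<in>configs N. c N 0 x * P x y * g x) = (\<Sum>y\<in>configs N. P x y) * (c N 0 x * g x)"
        unfolding sum_distrib_right by (simp add: ac_simps)
      then show "(\<Sum>y\<in>configs N. c N 0 x * P x y * g x) = c N 0 x * g x" using P1[OF x] by simp
    qed
    have "(\<Sum>y\<in>configs N. c N t y * f (LN N y)) = (\<Sum>y\<in>configs N. \<Sum>x\<in>configs N. c N 0 x * P x y * f (LN N y))"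
      using c_transition[OF N t] unfolding P_def by (simp add: sum_distrib_right)
    also have "\<dots> = (\<Sum>x\<in>configs N. \<Sum>y\<in>configs N. c N 0 x * P x y * f (LN N y))" by (rule sum.swap)
    finally have "(\<Sum>y\<in>configs N. c N t y * f (LN N y)) - (\<Sum>x\<in>configs N. c N 0 x * f (\<Phi> t (LN N x)))
      = (\<Sum>x\<in>configs N. \<Sum>y\<in>configs N. c N 0 x * P x y * (f (LN N y) - f (\<Phi> t (LN N x))))"
      unfolding s1[of "\<lambda>x. f (\<Phi> t (LN N x))", symmetric] by (simp add: right_diff_distrib sum_subtractf)
    also have "\<bar>\<dots>\<bar> \<le> (\<Sum>x\<in>configs N. \<Sum>y\<in>configs N. c N 0 x * P x y * (r / 4 + M * (norm (LN N y - \<Phi> t (LN N x)))\<^sup>2))"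
    proof (intro order_trans[OF sum_abs] sum_mono)
      fix x y :: "nat \<Rightarrow> 'x" assume xy: "x \<in> configs N" "y \<in> configs N"
      have "\<bar>c N 0 x * P x y * (f (LN N y) - f (\<Phi> t (LN N x)))\<bar> = c N 0 x * P x y * \<bar>f (LN N y) - f (\<Phi> t (LN N x))\<bar>"
        using c0 P0 xy by (simp add: abs_mult)
      also have "\<dots> \<le> c N 0 x * P x y * (r / 4 + M * (norm (LN N y - \<Phi> t (LN N x)))\<^sup>2)"
        using c0 P0 xy flow_PX[OF PX t] PX by (intro mult_left_mono M(2)) auto
      finally show "\<bar>c N 0 x * P x y * (f (LN N y) - f (\<Phi> t (LN N x)))\<bar> \<le> \<dots>" .
    qed
    also have "\<dots> = (\<Sum>x\<in>configs N. \<Sum>y\<in>configs N. c N 0 x * P x y * (r / 4))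
        + M * (\<Sum>x\<in>configs N. \<Sum>y\<in>configs N. c N 0 x * P x y * (norm (LN N y - \<Phi> t (LN N x)))\<^sup>2)"
      unfolding sum_distrib_left sum.distrib[symmetric] by (intro sum.cong) (auto simp: algebra_simps)
    also have "(\<Sum>x\<in>configs N. \<Sum>y\<in>configs N. c N 0 x * P x y * (r / 4)) = r / 4"
      by (subst s1[of "\<lambda>_. r / 4"], subst sum_distrib_right[symmetric]) (simp add: c1)
    also have "M * (\<Sum>x\<in>configs N. \<Sum>y\<in>configs N. c N 0 x * P x y * (norm (LN N y - \<Phi> t (LN N x)))\<^sup>2)
        \<le> M * (CARD('x) * (4 * e + 2 * (B + e) / real N) / (2 * L + 1) * exp ((2 * L + 1) * t))"
      unfolding P_def using elim e0 B flow_0 flow_PX flow_ode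
      by (intro mult_left_mono[OF propagation_estimate[OF N c0p _ _ _ _ L _ _ t]] M(1)) auto
    also have "\<dots> = k * (4 * e) + k * (2 * (B + e)) / real N"
      unfolding k_def by (simp add: field_simps add_divide_distrib)
    finally have "\<bar>(\<Sum>y\<in>configs N. c N t y * f (LN N y)) - (\<Sum>x\<in>configs N. c N 0 x * f (\<Phi> t (LN N x)))\<bar>
       \<le> r / 4 + (k * (4 * e) + k * (2 * (B + e)) / real N)" by simp
    then show ?case using elim(1) ke r unfolding real_norm_def diff_0_right by linarith
  qed
  then show "\<exists>no. \<forall>N\<ge>no. norm ((\<Sum>y\<in>configs N. c N t y * f (LN N y))
      - (\<Sum>x\<in>configs N. c N 0 x * f (\<Phi> t (LN N x))) - 0) < r"
    unfolding eventually_sequentially .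
qed

text \<open>The initial weak convergence is tested with the observable pulled back along the flow.
  The projection makes it bounded and continuous on the whole space and changes nothing on empirical
  measures, which the flow keeps in the simplex.\<close>

lemma empirical_limit:
  assumes f: "continuous_on PX f" and t: "0 \<le> t"
  shows "(\<lambda>N. \<Sum>y\<in>configs N. c N t y * f (LN N y)) \<longlonglongrightarrow> (LINT \<nu>|C t. f (proj_PX \<nu>))"
proof -
  define g where "g \<nu> = f (proj_PX (\<Phi> t \<nu>))" for \<nu>
  have fp: "continuous_on UNIV (\<lambda>\<nu>. f (proj_PX \<nu>))" by (rule continuous_comp_proj_PX[OF f])
  have g: "continuous_on UNIV g"
    unfolding g_def by (rule continuous_on_compose2[OF fp flow_continuous_space[OF t]]) auto
  have "bounded (range g)"
  proof -
    obtain B where B: "0 < B" "\<And>a. a \<in> PX \<Longrightarrow> \<bar>f a\<bar> \<le> B" using continuous_on_PX_bounded[OF f] by blast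
    then show ?thesis by (auto simp: bounded_iff g_def intro!: exI[of _ B])
  qed
  then have "(\<lambda>N. integral\<^sup>L (pushLN N (c N 0)) g) \<longlonglongrightarrow> integral\<^sup>L C0 g"
    using wp_weak g unfolding weak_conv_along_def by blast
  moreover have "\<forall>\<^sub>F N in sequentially. integral\<^sup>L (pushLN N (c N 0)) g = (\<Sum>x\<in>configs N. c N 0 x * f (\<Phi> t (LN N x)))"
    using eventually_gt_at_top[of 0]
  proof eventually_elim
    case (elim N)
    have "integral\<^sup>L (pushLN N (c N 0)) g = (\<Sum>x\<in>configs N. c N 0 x * g (LN N x))"
      using c_prob elim by (intro integral_pushLN borel_measurable_continuous_onI g) auto
    then show ?case using flow_PX[OF LN_in_PX t] elim by (simp add: g_def proj_PX_id)
  qed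
  ultimately have "(\<lambda>N. \<Sum>x\<in>configs N. c N 0 x * f (\<Phi> t (LN N x))) \<longlonglongrightarrow> integral\<^sup>L C0 g"
    by (simp add: tendsto_cong)
  from tendsto_add[OF particles_follow_flow[OF f t] this]
  have "(\<lambda>N. \<Sum>y\<in>configs N. c N t y * f (LN N y)) \<longlonglongrightarrow> integral\<^sup>L C0 g" by simp
  moreover have "(LINT \<nu>|C t. f (proj_PX \<nu>)) = integral\<^sup>L C0 g"
    unfolding g_def by (rule integral_C[OF t borel_measurable_continuous_onI[OF fp]])
  ultimately show ?thesis by simp
qed

lemma weak_limit:
  assumes t: "0 \<le> t"
  shows "weak_conv_along sequentially (\<lambda>N. pushLN N (c N t)) (C t)"
  unfolding weak_conv_along_def
proof (intro allI impI, elim conjE)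
  fix f :: "real^'x \<Rightarrow> real" assume f: "continuous_on UNIV f" "bounded (range f)"
  have fP: "continuous_on PX f" using f(1) continuous_on_subset by blast
  have fm: "f \<in> borel_measurable borel" by (rule borel_measurable_continuous_onI[OF f(1)])
  have "\<forall>\<^sub>F N in sequentially. integral\<^sup>L (pushLN N (c N t)) f = (\<Sum>y\<in>configs N. c N t y * f (LN N y))"
    using eventually_gt_at_top[of 0]
    by eventually_elim (use c_prob t in \<open>auto intro!: integral_pushLN fm\<close>)
  moreover have "(LINT \<nu>|C t. f (proj_PX \<nu>)) = integral\<^sup>L (C t) f"
  proof (rule integral_cong_AE)
    have s: "sets (C t) = sets borel" by (simp add: C_def)
    show "f \<in> borel_measurable (C t)" using fm by (simp add: measurable_cong_sets[OF s refl])
    show "(\<lambda>\<nu>. f (proj_PX \<nu>)) \<in> borel_measurable (C t)"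
      using borel_measurable_continuous_onI[OF continuous_comp_proj_PX[OF fP]]
      by (simp add: measurable_cong_sets[OF s refl])
    show "AE \<nu> in C t. f (proj_PX \<nu>) = f \<nu>"
      using prob_on_simplex_AE[OF C_prob[OF t]] by (rule AE_mp) (simp add: proj_PX_id)
  qed
  ultimately show "(\<lambda>N. integral\<^sup>L (pushLN N (c N t)) f) \<longlonglongrightarrow> integral\<^sup>L (C t) f"
    using empirical_limit[OF fP t] by (simp add: tendsto_cong)
qed

lemma FFbig_split:
  assumes t: "0 \<le> t"
  shows "FFbig K (C t) = (LINT \<nu>|C t. UU K (proj_PX \<nu>)) - (LINT \<nu>|C t. shannon (proj_PX \<nu>))"
proof -
  interpret Ct: prob_space "C t" using C_prob[OF t] by (simp add: prob_on_simplex_def)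
  have s: "sets (C t) = sets borel" by (simp add: C_def)
  have int: "integrable (C t) (\<lambda>\<nu>. g (proj_PX \<nu>))" if g: "continuous_on PX g" for g :: "real^'x \<Rightarrow> real"
  proof -
    obtain B where B: "0 < B" "\<And>a. a \<in> PX \<Longrightarrow> \<bar>g a\<bar> \<le> B" using continuous_on_PX_bounded[OF g] by blast
    show ?thesis
      using borel_measurable_continuous_onI[OF continuous_comp_proj_PX[OF g]] B
      by (intro Ct.integrable_const_bound[of _ B]) (auto simp: measurable_cong_sets[OF s refl])
  qed
  show ?thesis
    unfolding FFbig_def set_integral_PX[OF C_prob[OF t] continuous_on_FE[OF UU_continuous]] FE_shannon
    by (intro Bochner_Integration.integral_diff int UU_continuous continuous_on_shannon)
qed

text \<open>Well-preparedness is solved for \<open>a 0\<close>, whose limit must be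
  \<open>- S 0\<close>. At time t the type-counting lower bound and the propagation inequality
  squeeze \<open>a t\<close> to \<open>- S t\<close>, since the contributions of \<open>S 0\<close>
  cancel.\<close>

lemma entropy_limit:
  assumes t: "0 \<le> t"
  shows "(\<lambda>N. FN K N (c N t) / real N) \<longlonglongrightarrow> FFbig K (C t) - FE0 K"
proof -
  define a where "a t N = (\<Sum>y\<in>configs N. c N t y * ln (c N t y)) / real N" for t N
  define u where "u t N = (\<Sum>y\<in>configs N. c N t y * UU K (LN N y))" for t N
  define h where "h t N = (\<Sum>y\<in>configs N. c N t y * shannon (LN N y))" for t N
  define S where "S t = (LINT \<nu>|C t. shannon (proj_PX \<nu>))" for t
  define D where "D = real CARD('x)"
  have hl: "h t \<longlonglongrightarrow> S t" if "0 \<le> t" for t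
    unfolding h_def S_def by (rule empirical_limit[OF continuous_on_shannon that])
  have ul: "u t \<longlonglongrightarrow> FFbig K (C t) + S t" if "0 \<le> t" for t
    using empirical_limit[OF UU_continuous that] unfolding u_def S_def FFbig_split[OF that] by simp
  have zl: "(\<lambda>N. ln (ZN K N) / real N) \<longlonglongrightarrow> - FE0 K" by (rule ln_ZN_tendsto[OF UU_continuous])
  have FN: "\<forall>\<^sub>F N in sequentially. FN K N (c N t) / real N = a t N + u t N + ln (ZN K N) / real N" if "0 \<le> t" for t
    using eventually_gt_at_top[of 0]
  proof eventually_elim
    case (elim N)
    have "FN K N (c N t) = real N * a t N + real N * u t N + ln (ZN K N)"
      using FN_eq[of N "c N t" K] c_prob elim that unfolding a_def u_def by simp
    then show ?case using elim by (simp add: field_simps)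
  qed
  have a0: "a 0 \<longlonglongrightarrow> - S 0"
  proof -
    have "(\<lambda>N. FN K N (c N 0) / real N - u 0 N - ln (ZN K N) / real N)
        \<longlonglongrightarrow> (FFbig K C0 - FE0 K) - (FFbig K (C 0) + S 0) - - FE0 K"
      by (intro tendsto_diff wp_entropy ul zl) simp
    then have "(\<lambda>N. FN K N (c N 0) / real N - u 0 N - ln (ZN K N) / real N) \<longlonglongrightarrow> - S 0"
      by (simp add: C_0)
    moreover have "\<forall>\<^sub>F N in sequentially. FN K N (c N 0) / real N - u 0 N - ln (ZN K N) / real N = a 0 N"
      using FN[of 0] by (auto elim!: eventually_mono)
    ultimately show ?thesis by (simp add: tendsto_cong)
  qed
  have at: "a t \<longlonglongrightarrow> - S t"
  proof (rule tendsto_sandwich)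
    show "\<forall>\<^sub>F N in sequentially. - h t N - ((D + 1) * ln (real N + 1) + 1) / real N \<le> a t N"
      using eventually_gt_at_top[of 0]
    proof eventually_elim
      case (elim N)
      have "- real N * h t N - (D + 1) * ln (real N + 1) - 1 \<le> real N * a t N"
        using entropy_lower_bound[of N "c N t"] c_prob t elim unfolding h_def a_def D_def by (simp add: add.commute)
      then show ?case using elim by (simp add: field_simps)
    qed
    show "\<forall>\<^sub>F N in sequentially. a t N \<le> a 0 N + (h 0 N - h t N) + ((2 * D + 1) * ln (real N + 1) + D + 1) / real N"
      using eventually_gt_at_top[of 0]
    proof eventually_elim
      case (elim N)
      have "real N * a t N \<le> real N * a 0 N + real N * (h 0 N - h t N) + ((2 * D + 1) * ln (real N + 1) + D + 1)"
        using entropy_propagation[of N "c N 0" t "c N t"] c_transition[of N t] c_prob t elim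
        unfolding h_def a_def D_def by (simp add: add.commute)
      then show ?case using elim by (simp add: field_simps)
    qed
    have "(\<lambda>N. ((D + 1) * ln (real N + 1) + 1) / real N) \<longlonglongrightarrow> 0" by real_asymp
    then have "(\<lambda>N. - h t N - ((D + 1) * ln (real N + 1) + 1) / real N) \<longlonglongrightarrow> - S t - 0"
      by (intro tendsto_diff tendsto_minus hl t)
    then show "(\<lambda>N. - h t N - ((D + 1) * ln (real N + 1) + 1) / real N) \<longlonglongrightarrow> - S t" by simp
    have "(\<lambda>N. ((2 * D + 1) * ln (real N + 1) + D + 1) / real N) \<longlonglongrightarrow> 0" by real_asymp
    then have "(\<lambda>N. a 0 N + (h 0 N - h t N) + ((2 * D + 1) * ln (real N + 1) + D + 1) / real N)
       \<longlonglongrightarrow> - S 0 + (S 0 - S t) + 0"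
      by (intro tendsto_add tendsto_diff a0 hl t) auto
    then show "(\<lambda>N. a 0 N + (h 0 N - h t N) + ((2 * D + 1) * ln (real N + 1) + D + 1) / real N) \<longlonglongrightarrow> - S t"
      by simp
  qed
  have "(\<lambda>N. a t N + u t N + ln (ZN K N) / real N) \<longlonglongrightarrow> - S t + (FFbig K (C t) + S t) + - FE0 K"
    by (intro tendsto_add at ul zl t)
  then show ?thesis using FN[OF t] by (simp add: tendsto_cong)
qed

section \<open>The limit curve as a solution of the Liouville equation\<close>

lemma C_weakly_continuous:
  assumes s: "0 \<le> s"
  shows "weak_conv_along (at s within {0..}) C (C s)"
  \<comment> \<open>Sequences of times make dominated convergence under \<open>C0\<close>
    applicable.\<close>
  unfolding weak_conv_along_def tendsto_at_iff_sequentially comp_def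
proof (intro allI impI, elim conjE)
  fix f :: "real^'x \<Rightarrow> real" and X :: "nat \<Rightarrow> real"
  assume f: "continuous_on UNIV f" "bounded (range f)" and X: "\<forall>i. X i \<in> {0..} - {s}" "X \<longlonglongrightarrow> s"
  interpret C0: prob_space C0 by (rule C0_prob_space)
  obtain B where B: "\<And>\<nu>. norm (f \<nu>) \<le> B" using f(2) by (auto simp: bounded_iff)
  have fm: "f \<in> borel_measurable borel" by (rule borel_measurable_continuous_onI[OF f(1)])
  have m: "(\<lambda>\<nu>. f (\<Phi> t \<nu>)) \<in> borel_measurable C0" if "0 \<le> t" for t
    unfolding borel_measurable_C0 by (rule measurable_compose[OF flow_measurable[OF that] fm])
  have "(\<lambda>i. LINT \<nu>|C0. f (\<Phi> (X i) \<nu>)) \<longlonglongrightarrow> (LINT \<nu>|C0. f (\<Phi> s \<nu>))"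
  proof (rule integral_dominated_convergence[where w = "\<lambda>_. B"])
    show "AE \<nu> in C0. (\<lambda>i. f (\<Phi> (X i) \<nu>)) \<longlonglongrightarrow> f (\<Phi> s \<nu>)"
    proof (rule AE_I2)
      fix \<nu>
      have "(\<lambda>i. case (X i, \<nu>) of (t, \<nu>) \<Rightarrow> \<Phi> t \<nu>) \<longlonglongrightarrow> (case (s, \<nu>) of (t, \<nu>) \<Rightarrow> \<Phi> t \<nu>)"
        using X s by (intro continuous_on_tendsto_compose[OF flow_continuous] tendsto_Pair) auto
      then show "(\<lambda>i. f (\<Phi> (X i) \<nu>)) \<longlonglongrightarrow> f (\<Phi> s \<nu>)"
        by (intro continuous_on_tendsto_compose[OF f(1)]) auto
    qed
  qed (use m X s B in auto)
  then show "(\<lambda>i. integral\<^sup>L (C (X i)) f) \<longlonglongrightarrow> integral\<^sup>L (C s) f"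
    using X s by (simp add: integral_C fm)
qed

text \<open>Pulled back to \<open>C0\<close>, the integrand along a flow line is the time derivative
  of \<phi> at (t, \<Phi> t \<nu>). Fubini puts the time integral inside, where it vanishes because
  \<phi> is 0 before and after its support.\<close>

lemma C_liouville:
  assumes "test_fun \<phi>"
  shows "(LBINT t:{0<..}. (LINT \<nu>:PX|C t.
              frechet_derivative \<phi> (at (t, \<nu>)) (1, 0)
            + frechet_derivative \<phi> (at (t, \<nu>)) (0, bfield K A \<nu>))) = 0"
proof -
  interpret C0: prob_space C0 by (rule C0_prob_space)
  interpret pair_sigma_finite lborel C0 by unfold_locales
  obtain \<phi>' :: "real \<times> (real^'x) \<Rightarrow> ((real \<times> (real^'x)) \<Rightarrow>\<^sub>L real)" and Kc where
    \<phi>': "\<And>p. (\<phi> has_derivative blinfun_apply (\<phi>' p)) (at p)" "continuous_on UNIV \<phi>'"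
    and Kc: "compact Kc" "Kc \<subseteq> {0<..} \<times> UNIV" "\<And>p. p \<notin> Kc \<Longrightarrow> \<phi> p = 0"
    using assms unfolding test_fun_def by blast
  \<comment> \<open>A time window with the support strictly inside, so that \<phi> vanishes at both
    end times; a > 0 keeps it within the range of the time integral.\<close>
  obtain a T where aT: "0 < a" "a < T" "\<And>p. p \<in> Kc \<Longrightarrow> a < fst p \<and> fst p < T"
  proof (cases "Kc = {}")
    case True
    then show ?thesis using that[of 1 2] by simp
  next
    case False
    have c: "compact (fst ` Kc)" by (intro compact_continuous_image continuous_intros Kc(1))
    obtain u where u: "u \<in> fst ` Kc" "\<And>t. t \<in> fst ` Kc \<Longrightarrow> u \<le> t"
      using compact_attains_inf[OF c] False by auto
    obtain v where v: "v \<in> fst ` Kc" "\<And>t. t \<in> fst ` Kc \<Longrightarrow> t \<le> v"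
      using compact_attains_sup[OF c] False by auto
    have u0: "0 < u" using u(1) Kc(2) by auto
    have le: "u \<le> fst p \<and> fst p \<le> v" if "p \<in> Kc" for p using u(2) v(2) that by blast
    have "u \<le> v" using u(2)[OF v(1)] .
    show ?thesis
    proof (rule that[of "u / 2" "v + 1"])
      fix p assume "p \<in> Kc"
      then show "u / 2 < fst p \<and> fst p < v + 1" using le u0 by fastforce
    qed (use u0 \<open>u \<le> v\<close> in auto)
  qed
  have \<phi>'0: "\<phi>' p = 0" if p: "p \<notin> Kc" for p
  proof -
    have "open (- Kc)" using Kc(1) by (simp add: compact_imp_closed open_Compl)
    then have "(\<phi> has_derivative (\<lambda>h. 0)) (at p)"
      using p Kc(3) by (intro has_derivative_transform_within_open[OF has_derivative_const[of 0]]) auto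
    then have "blinfun_apply (\<phi>' p) = (\<lambda>h. 0)" using has_derivative_unique[OF \<phi>'(1)] by blast
    then show ?thesis by (intro blinfun_eqI) simp
  qed
  \<comment> \<open>The projection confines the argument to the simplex even for starting points
    outside it, a null set of \<open>C0\<close>; continuity of \<open>bfield\<close> is known only
    on the simplex.\<close>
  define q where "q t \<nu> = proj_PX (\<Phi> t \<nu>)" for t \<nu>
  define H where "H t \<nu> = blinfun_apply (\<phi>' (t, q t \<nu>)) (1, bfield K A (q t \<nu>))" for t \<nu>
  have bc: "continuous_on PX (bfield K A)" using bfield_lipschitz lipschitz_on_continuous_on by blast
  have fd: "frechet_derivative \<phi> (at p) = blinfun_apply (\<phi>' p)" for p
    using frechet_derivative_at[OF \<phi>'(1)] by simp
  have inner: "(LINT \<nu>:PX|C t. frechet_derivative \<phi> (at (t, \<nu>)) (1, 0)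
            + frechet_derivative \<phi> (at (t, \<nu>)) (0, bfield K A \<nu>)) = (LINT \<nu>|C0. H t \<nu>)" if t: "0 < t" for t
  proof -
    define g where "g \<nu> = blinfun_apply (\<phi>' (t, \<nu>)) (1, bfield K A \<nu>)" for \<nu>
    have gc: "continuous_on PX g"
      unfolding g_def by (intro continuous_intros bc continuous_on_compose2[OF \<phi>'(2)]) auto
    have "frechet_derivative \<phi> (at (t, \<nu>)) (1, 0) + frechet_derivative \<phi> (at (t, \<nu>)) (0, bfield K A \<nu>) = g \<nu>" for \<nu>
      unfolding fd g_def blinfun.add_right[symmetric] by simp
    then have "(LINT \<nu>:PX|C t. frechet_derivative \<phi> (at (t, \<nu>)) (1, 0)
            + frechet_derivative \<phi> (at (t, \<nu>)) (0, bfield K A \<nu>)) = (LINT \<nu>|C t. g (proj_PX \<nu>))"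
      using set_integral_PX[OF C_prob gc, of t] t by simp
    also have "\<dots> = (LINT \<nu>|C0. g (proj_PX (\<Phi> t \<nu>)))"
      using t by (intro integral_C borel_measurable_continuous_onI continuous_comp_proj_PX gc) auto
    finally show ?thesis unfolding g_def H_def q_def .
  qed
  have H0: "H t \<nu> = 0" if "t \<notin> {a..T}" for t \<nu>
  proof -
    have "(t, q t \<nu>) \<notin> Kc" using aT(3)[of "(t, q t \<nu>)"] that by force
    then show ?thesis unfolding H_def by (simp add: \<phi>'0)
  qed
  have qc: "continuous_on ({a..T} \<times> UNIV) (\<lambda>p. q (fst p) (snd p))"
    unfolding q_def
  proof (rule continuous_on_compose2[OF continuous_on_proj_PX])
    show "continuous_on ({a..T} \<times> UNIV) (\<lambda>p. \<Phi> (fst p) (snd p))"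
      using continuous_on_subset[OF flow_continuous, of "{a..T} \<times> UNIV"] aT(1)
      by (simp add: case_prod_unfold subset_iff)
  qed auto
  have Hc: "continuous_on ({a..T} \<times> UNIV) (\<lambda>p. H (fst p) (snd p))"
    unfolding H_def
    by (intro continuous_intros continuous_on_compose2[OF \<phi>'(2)] continuous_on_compose2[OF bc qc] qc)
       (auto simp: q_def)
  have HB: "\<exists>B. \<forall>t\<in>{a..T}. \<forall>\<nu>. norm (H t \<nu>) \<le> B"
  proof -
    have "continuous_on ({a..T} \<times> PX) (\<lambda>p. blinfun_apply (\<phi>' p) (1, bfield K A (snd p)))"
      by (intro continuous_intros continuous_on_compose2[OF bc] continuous_on_subset[OF \<phi>'(2)]) auto
    moreover have "compact ({a..T} \<times> (PX :: (real^'x) set))" by (intro compact_Times PX_compact) simp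
    ultimately have "bounded ((\<lambda>p. blinfun_apply (\<phi>' p) (1, bfield K A (snd p))) ` ({a..T} \<times> PX))"
      using compact_imp_bounded compact_continuous_image by blast
    then obtain B where "\<And>p. p \<in> {a..T} \<times> PX \<Longrightarrow> norm (blinfun_apply (\<phi>' p) (1, bfield K A (snd p))) \<le> B"
      unfolding bounded_iff by blast
    then have "norm (H t \<nu>) \<le> B" if "t \<in> {a..T}" for t \<nu>
      unfolding H_def using that by (metis mem_Sigma_iff proj_PX_in q_def snd_conv)
    then show ?thesis by blast
  qed
  have Hint: "integrable (lborel \<Otimes>\<^sub>M C0) (\<lambda>(t, \<nu>). H t \<nu>)"
  proof -
    obtain B where B: "\<And>t \<nu>. t \<in> {a..T} \<Longrightarrow> norm (H t \<nu>) \<le> B" using HB by blast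
    \<comment> \<open>The product sigma-algebra is the Borel one, so joint continuity on the closed
      window gives joint measurability.\<close>
    have sb: "sets (lborel \<Otimes>\<^sub>M C0) = sets (borel :: (real \<times> (real^'x)) measure)"
      unfolding borel_prod[symmetric] by (intro sets_pair_measure_cong) auto
    have clo: "closed ({a..T} \<times> (UNIV :: (real^'x) set))" by (intro closed_Times) auto
    have "(\<lambda>p. indicator ({a..T} \<times> UNIV) p *\<^sub>R H (fst p) (snd p)) \<in> borel_measurable borel"
      by (rule borel_measurable_continuous_on_indicator[OF _ Hc]) (rule borel_closed[OF clo])
    moreover have "(\<lambda>p. indicator ({a..T} \<times> UNIV) p *\<^sub>R H (fst p) (snd p)) = (\<lambda>(t, \<nu>). H t \<nu>)"
      using H0 by (auto simp: fun_eq_iff indicator_def)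
    ultimately have meas: "(\<lambda>(t, \<nu>). H t \<nu>) \<in> borel_measurable (lborel \<Otimes>\<^sub>M C0)"
      by (simp add: measurable_cong_sets[OF sb refl])
    show ?thesis
    proof (rule integrableI_bounded_set[where A = "{a..T} \<times> UNIV" and B = B])
      show "{a..T} \<times> UNIV \<in> sets (lborel \<Otimes>\<^sub>M C0)" unfolding sb by (rule borel_closed[OF clo])
      have "emeasure (lborel \<Otimes>\<^sub>M C0) ({a..T} \<times> UNIV) = emeasure lborel {a..T} * emeasure C0 UNIV"
        by (rule C0.emeasure_pair_measure_Times) auto
      also have "\<dots> < \<infinity>"
        using C0.emeasure_space_1 aT by (simp add: ennreal_mult_less_top)
      finally show "emeasure (lborel \<Otimes>\<^sub>M C0) ({a..T} \<times> UNIV) < \<infinity>" .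
      show "AE p in lborel \<Otimes>\<^sub>M C0. p \<notin> {a..T} \<times> UNIV \<longrightarrow> (case p of (t, \<nu>) \<Rightarrow> H t \<nu>) = 0"
        using H0 by (intro AE_I2) (simp only: mem_Times_iff case_prod_unfold, blast)
    qed (use meas B in auto)
  qed
  have zero: "(LINT t|lborel. H t \<nu>) = 0" if \<nu>: "\<nu> \<in> PX" for \<nu>
  proof -
    have qe: "q t \<nu> = \<Phi> t \<nu>" if "t \<in> {a..T}" for t
      unfolding q_def using flow_PX[OF \<nu>, of t] that aT(1) by (simp add: proj_PX_id)
    have "(LINT t|lborel. H t \<nu>) = (LBINT t. indicator {a..T} t *\<^sub>R H t \<nu>)"
      using H0 by (intro Bochner_Integration.integral_cong) (auto simp: indicator_def)
    also have "\<dots> = \<phi> (T, \<Phi> T \<nu>) - \<phi> (a, \<Phi> a \<nu>)"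
    proof (rule integral_FTC_atLeastAtMost[where F = "\<lambda>t. \<phi> (t, \<Phi> t \<nu>)"])
      show "a \<le> T" using aT by simp
    next
      fix t assume t: "a \<le> t" "t \<le> T"
      have "((\<lambda>t. \<Phi> t \<nu>) has_vector_derivative bfield K A (\<Phi> t \<nu>)) (at t within {a..T})"
        using flow_ode[OF \<nu>, of t] t aT(1) by (intro has_vector_derivative_within_subset[OF flow_ode[OF \<nu>]]) auto
      then have "((\<lambda>t. (t, \<Phi> t \<nu>)) has_derivative (\<lambda>h. (h, h *\<^sub>R bfield K A (\<Phi> t \<nu>)))) (at t within {a..T})"
        unfolding has_vector_derivative_def by (intro has_derivative_Pair has_derivative_ident)
      then have "((\<lambda>t. \<phi> (t, \<Phi> t \<nu>)) has_derivative
          (\<lambda>h. blinfun_apply (\<phi>' (t, \<Phi> t \<nu>)) (h, h *\<^sub>R bfield K A (\<Phi> t \<nu>)))) (at t within {a..T})"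
        by (rule has_derivative_compose[where f = "\<lambda>t. (t, \<Phi> t \<nu>)", OF _ \<phi>'(1)])
      moreover have "blinfun_apply (\<phi>' (t, \<Phi> t \<nu>)) (h, h *\<^sub>R bfield K A (\<Phi> t \<nu>)) = h *\<^sub>R H t \<nu>" for h
        using blinfun.scaleR_right[of "\<phi>' (t, \<Phi> t \<nu>)" h "(1, bfield K A (\<Phi> t \<nu>))"] qe[of t] t
        by (simp add: H_def)
      ultimately show "((\<lambda>t. \<phi> (t, \<Phi> t \<nu>)) has_vector_derivative H t \<nu>) (at t within {a..T})"
        unfolding has_vector_derivative_def by simp
    next
      have "continuous_on {a..T} (\<lambda>t. (\<lambda>p. H (fst p) (snd p)) (t, \<nu>))"
        by (rule continuous_on_compose2[OF Hc]) (auto intro!: continuous_intros)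
      then show "continuous_on {a..T} (\<lambda>t. H t \<nu>)" by simp
    qed
    also have "\<dots> = 0"
    proof -
      have "(T, \<Phi> T \<nu>) \<notin> Kc" "(a, \<Phi> a \<nu>) \<notin> Kc" using aT(3) by fastforce+
      then show ?thesis by (simp add: Kc(3))
    qed
    finally show ?thesis .
  qed
  have "(LBINT t:{0<..}. (LINT \<nu>:PX|C t.
              frechet_derivative \<phi> (at (t, \<nu>)) (1, 0)
            + frechet_derivative \<phi> (at (t, \<nu>)) (0, bfield K A \<nu>))) = (LINT t|lborel. (LINT \<nu>|C0. H t \<nu>))"
    unfolding set_lebesgue_integral_def[of lborel]
  proof (intro Bochner_Integration.integral_cong refl)
    fix t :: real
    show "indicator {0<..} t *\<^sub>R (LINT \<nu>:PX|C t. frechet_derivative \<phi> (at (t, \<nu>)) (1, 0)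
            + frechet_derivative \<phi> (at (t, \<nu>)) (0, bfield K A \<nu>)) = (LINT \<nu>|C0. H t \<nu>)"
      using inner[of t] H0[of t] aT(1) by (cases "0 < t") auto
  qed
  also have "\<dots> = (LINT \<nu>|C0. (LINT t|lborel. H t \<nu>))"
    by (rule Fubini_integral[OF Hint, symmetric])
  also have "\<dots> = (LINT \<nu>|C0. 0)"
    using prob_on_simplex_AE[OF C0_prob] zero Hint
    by (intro integral_cong_AE borel_measurable_integrable[OF integrable_snd]) (auto elim!: AE_mp)
  finally show ?thesis by simp
qed

lemma C_liouville_weak_sol: "liouville_weak_sol K A C C0"
  unfolding liouville_weak_sol_def
  using C_0 C_prob C_weakly_continuous C_liouville by blast

end

theorem theorem3p12:
  fixes K :: "'x::finite \<Rightarrow> real^'x \<Rightarrow> real"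
    and A :: "real^'x \<Rightarrow> 'x \<Rightarrow> 'x \<Rightarrow> real"
    and AN :: "nat \<Rightarrow> real^'x \<Rightarrow> 'x \<Rightarrow> 'x \<Rightarrow> real"
    and c :: "nat \<Rightarrow> real \<Rightarrow> (nat \<Rightarrow> 'x) \<Rightarrow> real"
    and C0 :: "(real^'x) measure"
  assumes K_C2: "\<exists>S. open S \<and> PX \<subseteq> S \<and> (\<forall>x. C2_on S (K x))"
    and A_good: "\<forall>\<mu>\<in>PX. good_mat (A \<mu>)"
    and A_lip: "\<forall>x y. \<exists>L. L-lipschitz_on PX (\<lambda>\<mu>. A \<mu> x y)"
    and AN_good: "\<forall>N. \<forall>\<mu>\<in>PX. good_mat (AN N \<mu>)"
    and AN_conv: "\<forall>x y. uniform_limit PX (\<lambda>N \<mu>. AN N \<mu> x y) (\<lambda>\<mu>. A \<mu> x y) sequentially"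
    and c_prob: "\<forall>N\<ge>1. \<forall>t\<ge>0. is_prob_configs N (c N t)"
    and c_ode: "\<forall>N\<ge>1. \<forall>t\<ge>0. \<forall>cy\<in>configs N.
          ((\<lambda>s. c N s cy) has_real_derivative (\<Sum>cx\<in>configs N. c N t cx * QB K AN N cx cy))
            (at t within {0..})"
    and C0_prob: "prob_on_simplex C0"
    and wp_entropy: "(\<lambda>N. FN K N (c N 0) / real N) \<longlonglongrightarrow> FFbig K C0 - FE0 K"
    and wp_weak: "weak_conv_along sequentially (\<lambda>N. pushLN N (c N 0)) C0"
  shows "\<exists>C. liouville_weak_sol K A C C0
           \<and> (\<forall>t>0. weak_conv_along sequentially (\<lambda>N. pushLN N (c N t)) (C t))
           \<and> (\<forall>t>0. (\<lambda>N. FN K N (c N t) / real N) \<longlonglongrightarrow> FFbig K (C t) - FE0 K)"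
proof -
  interpret mean_field K A AN
    using K_C2 A_good A_lip AN_good AN_conv by unfold_locales
  obtain \<Phi> :: "real \<Rightarrow> real^'x \<Rightarrow> real^'x" where \<Phi>: "\<And>\<nu>. \<Phi> 0 \<nu> = \<nu>"
    "continuous_on ({0..} \<times> UNIV) (\<lambda>(t, \<nu>). \<Phi> t \<nu>)"
    "\<And>\<nu> t. \<nu> \<in> PX \<Longrightarrow> 0 \<le> t \<Longrightarrow> \<Phi> t \<nu> \<in> PX"
    "\<And>\<nu> t. \<nu> \<in> PX \<Longrightarrow> 0 \<le> t \<Longrightarrow>
        ((\<lambda>t. \<Phi> t \<nu>) has_vector_derivative bfield K A (\<Phi> t \<nu>)) (at t within {0..})"
    using flow_exists by blast
  interpret mean_field_limit K A AN \<Phi> c C0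
    using \<Phi> c_prob c_ode C0_prob wp_entropy wp_weak by unfold_locales auto
  show ?thesis
    using C_liouville_weak_sol weak_limit entropy_limit by (intro exI[of _ C]) auto
qed

end
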